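(* Let $p,q\in(1,\infty)$, $\sigma\in(0,\frac1p)$ and $\alpha\in(0,\frac1q)$, and set $$w:=\frac{\Delta_p^\sigma\kappa_{q,-\alpha}}{\kappa_{q,-\alpha}^{p-1}}\quad\text{on }\mathbb Z .$$ (a) If $p(\sigma+1-q\alpha)\ge 1$, i.e. $\alpha\le\frac{p-1+p\sigma}{pq}$, then $w$ is $p$-critical. (b) If $p(\sigma+1-q\alpha)\le 1$, i.e. $\alpha\ge\frac{p-1+p\sigma}{pq}$, then $\kappa_{q,-\alpha}\notin\ell^p(\mathbb Z,|w|)$, i.e. $\sum_{x\in\mathbb Z}|w(x)|\,\kappa_{q,-\alpha}(x)^p=\infty$. In particular, if $p(\sigma+1-q\alpha)=1$, then $w$ is an optimal Hardy-type weight. Moreover, $w(0)>0$. If $\alpha>\frac{p-2+p\sigma}{(p-1)q}$, then $w>0$ outside a compact (i.e. finite) set and $w(x)\asymp|x|^{-p\sigma}$ as $|x|\to\infty$.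
   Context: Notation: $C(\mathbb Z)$ is the space of real functions on $\mathbb Z$, $C_c(\mathbb Z)$ those of finite support; $1_y$ is the indicator function of $\{y\}$; $t^{\langle p-1\rangle}:=|t|^{p-1}\operatorname{sgn}(t)$ with $\operatorname{sgn}(0)=0$. $a\asymp b$ means $C_1b\le a\le C_2b$ for positive constants $C_1,C_2$. Kernels. Let $\Delta_2f(x)=2f(x)-f(x+1)-f(x-1)$ on $\mathbb Z$ and $p_t(x,y)=e^{-t\Delta_2}1_y(x)$ its heat kernel. For $r>1$ and $\beta\in(-\frac1r,\frac2r)$, $\beta\ne0$, put $$\kappa_{r,\beta}(x,y):=\frac1{|\Gamma(-\frac{r\beta}2)|}\int_0^\infty p_t(x,y)\frac{dt}{t^{1+\frac{r\beta}2}}\quad\text{for }|x-y|>\tfrac{r\beta}2,\qquad \kappa_{r,\beta}(x,x):=0\text{ if }\beta>0.$$ It depends only on $x-y$: $\kappa_{r,\beta}(x,y)=\kappa_{r,\beta}(x-y,0)=:\kappa_{r,\beta}(x-y)$. Explicitly, for $|x|>\frac{r\beta}2$, $$\kappa_{r,\beta}(x)=c_{r,\beta}\frac{\Gamma(|x|-\frac{r\beta}2)}{\Gamma(|x|+1+\frac{r\beta}2)},\qquad c_{r,\beta}=\frac{4^{\frac{r\beta}2}\Gamma(\frac{1+r\beta}2)}{\sqrt\pi\,|\Gamma(-\frac{r\beta}2)|}.$$ In particular $\kappa_{q,-\alpha}$ is a strictly positive function on $\mathbb Z$. Operator. $\kappa_{p,\sigma}$ is regarded as a graph (symmetric, summable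 edge weights) over $(\mathbb Z,1)$. Let $\mathcal F_p$ be the set of $f\in C(\mathbb Z)$ with $\sum_y\kappa_{p,\sigma}(x-y)|f(x)-f(y)|^{p-1}<\infty$ for all $x$. The fractional $p$-Laplacian is $\Delta_p^\sigma f(x)=\sum_{y\in\mathbb Z}\kappa_{p,\sigma}(x-y)\,(f(x)-f(y))^{\langle p-1\rangle}$ for $f\in\mathcal F_p$. The $p$-energy is $\mathcal E_p(\varphi)=\frac12\sum_{x,y\in\mathbb Z}\kappa_{p,\sigma}(x-y)|\varphi(x)-\varphi(y)|^p$, $\varphi\in C_c(\mathbb Z)$. Weights. $w\in C(\mathbb Z)$ is a ($p$-)Hardy-type weight if $\mathcal E_p(\varphi)\ge\sum_xw(x)|\varphi(x)|^p$ for all $\varphi\in C_c(\mathbb Z)$. A Hardy-type weight $w$ is $p$-critical if there is no Hardy-type weight $\tilde w$ with $\tilde w\ge w$, $\tilde w\ne w$. This is equivalent to the existence of an Agmon ground state: a positive $u\in\mathcal F_p$, unique up to positive multiples, with $\Delta_p^\sigma u\ge wu^{p-1}$ (then in fact $\Delta_p^\sigma u=wu^{p-1}$). A $p$-critical $w$ is $p$-null-critical if its Agmon ground state $u$ satisfies $\sum_x|w(x)|u(x)^p=\infty$. A Hardy-type weight is optimal if it is $p$-critical and $p$-null-critical. *)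

theory Defs
  imports "HOL-Analysis.Analysis"
begin

definition laplace2 :: "(int \<Rightarrow> real) \<Rightarrow> int \<Rightarrow> real" where
  "laplace2 f x = 2 * f x - f (x + 1) - f (x - 1)"

text \<open>The Laplacian is a bounded operator on every \<open>\<ell>\<^sup>r(\<int>)\<close>, so its heat semigroup is the
  exponential power series, here evaluated pointwise.\<close>

definition heat_kernel :: "real \<Rightarrow> int \<Rightarrow> int \<Rightarrow> real" where
  "heat_kernel t x y = (\<Sum>n. (- t) ^ n / fact n * (laplace2 ^^ n) (indicat_real {y}) x)"

text \<open>For \<open>-1/r < \<beta> < 2/r\<close> the condition \<open>\<bar>x - y\<bar> > r * \<beta> / 2\<close> always holds if
  \<open>\<beta> < 0\<close>, and says \<open>x \<noteq> y\<close> if \<open>\<beta> > 0\<close>; so the value 0 is taken exactly on the diagonal for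
  \<open>\<beta> > 0\<close>.\<close>

definition kappa2 :: "real \<Rightarrow> real \<Rightarrow> int \<Rightarrow> int \<Rightarrow> real" where
  "kappa2 r \<beta> x y =
    (if of_int \<bar>x - y\<bar> > r * \<beta> / 2
     then 1 / \<bar>Gamma (- (r * \<beta> / 2))\<bar> *
            (LBINT t:{0<..}. heat_kernel t x y / t powr (1 + r * \<beta> / 2))
     else 0)"

definition kappa :: "real \<Rightarrow> real \<Rightarrow> int \<Rightarrow> real" where
  "kappa r \<beta> z = kappa2 r \<beta> z 0"

definition signed_powr :: "real \<Rightarrow> real \<Rightarrow> real" where
  "signed_powr t s = \<bar>t\<bar> powr s * sgn t"

definition formal_domain :: "real \<Rightarrow> real \<Rightarrow> (int \<Rightarrow> real) set" where
  "formal_domain p \<sigma> =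
    {f. \<forall>x. (\<lambda>y. kappa p \<sigma> (x - y) * \<bar>f x - f y\<bar> powr (p - 1)) summable_on UNIV}"

text \<open>Meaningful only for \<open>f \<in> formal_domain p \<sigma>\<close>.\<close>

definition frac_p_laplace :: "real \<Rightarrow> real \<Rightarrow> (int \<Rightarrow> real) \<Rightarrow> int \<Rightarrow> real" where
  "frac_p_laplace p \<sigma> f x =
    (\<Sum>\<^sub>\<infinity>y. kappa p \<sigma> (x - y) * signed_powr (f x - f y) (p - 1))"

definition p_energy :: "real \<Rightarrow> real \<Rightarrow> (int \<Rightarrow> real) \<Rightarrow> real" where
  "p_energy p \<sigma> \<phi> =
    1 / 2 * (\<Sum>\<^sub>\<infinity>(x, y). kappa p \<sigma> (x - y) * \<bar>\<phi> x - \<phi> y\<bar> powr p)"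

definition hardy_type_weight :: "real \<Rightarrow> real \<Rightarrow> (int \<Rightarrow> real) \<Rightarrow> bool" where
  "hardy_type_weight p \<sigma> w \<longleftrightarrow>
    (\<forall>\<phi>. finite {x. \<phi> x \<noteq> 0} \<longrightarrow>
       p_energy p \<sigma> \<phi> \<ge> (\<Sum>\<^sub>\<infinity>x. w x * \<bar>\<phi> x\<bar> powr p))"

definition p_critical :: "real \<Rightarrow> real \<Rightarrow> (int \<Rightarrow> real) \<Rightarrow> bool" where
  "p_critical p \<sigma> w \<longleftrightarrow> hardy_type_weight p \<sigma> w \<and>
    \<not> (\<exists>w'. hardy_type_weight p \<sigma> w' \<and> (\<forall>x. w' x \<ge> w x) \<and> w' \<noteq> w)"

definition positive_supersolution ::
    "real \<Rightarrow> real \<Rightarrow> (int \<Rightarrow> real) \<Rightarrow> (int \<Rightarrow> real) \<Rightarrow> bool" where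
  "positive_supersolution p \<sigma> w u \<longleftrightarrow>
    (\<forall>x. u x > 0) \<and> u \<in> formal_domain p \<sigma> \<and>
    (\<forall>x. frac_p_laplace p \<sigma> u x \<ge> w x * u x powr (p - 1))"

definition agmon_ground_state ::
    "real \<Rightarrow> real \<Rightarrow> (int \<Rightarrow> real) \<Rightarrow> (int \<Rightarrow> real) \<Rightarrow> bool" where
  "agmon_ground_state p \<sigma> w u \<longleftrightarrow> positive_supersolution p \<sigma> w u \<and>
    (\<forall>v. positive_supersolution p \<sigma> w v \<longrightarrow> (\<exists>c>0. \<forall>x. v x = c * u x))"

text \<open>Since ground states agree up to a positive factor, it does not matter which one is tested.\<close>

definition p_null_critical :: "real \<Rightarrow> real \<Rightarrow> (int \<Rightarrow> real) \<Rightarrow> bool" where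
  "p_null_critical p \<sigma> w \<longleftrightarrow> p_critical p \<sigma> w \<and>
    (\<exists>u. agmon_ground_state p \<sigma> w u \<and>
         \<not> (\<lambda>x. \<bar>w x\<bar> * u x powr p) summable_on UNIV)"

definition optimal_hardy_weight :: "real \<Rightarrow> real \<Rightarrow> (int \<Rightarrow> real) \<Rightarrow> bool" where
  "optimal_hardy_weight p \<sigma> w \<longleftrightarrow>
    hardy_type_weight p \<sigma> w \<and> p_critical p \<sigma> w \<and> p_null_critical p \<sigma> w"

end

theory Submission
  imports Defs
begin

text \<open>Write \<open>k\<close> for the kernel \<open>\<kappa>\<^bsub>p,\<sigma>\<^esub>\<close>, \<open>u\<close> for \<open>\<kappa>\<^bsub>q,-\<alpha>\<^esub>\<close>, and put \<open>S = p \<sigma>\<close>, \<open>\<gamma> = 1 - q \<alpha>\<close>.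
  The whole theorem rests on two power laws: \<open>k x\<close> behaves like \<open>\<bar>x\<bar>\<close> to the power \<open>- 1 - S\<close>,
  and \<open>u x\<close> like \<open>\<bar>x\<bar>\<close> to the power \<open>- \<gamma>\<close>, with matching behaviour of first and second differences of
  \<open>u\<close>. They come from a recurrence. The heat equation and the Bessel recurrence for the heat kernel combine
  into a total derivative in time (\<open>heat_mellin_recurrence\<close>), so that the Mellin transform of the heat
  kernel satisfies a first order recurrence in the site; its solution is a quotient of Gamma functions.
  The normalising constants matter only through their sign.

  Hardy's inequality with weight \<open>w = \<Delta>u / u\<^sup>p\<^sup>-\<^sup>1\<close> is Picone's inequality summed over all pairs of
  sites: \<open>ground_state_representation\<close> writes twice the deficit of a test function as the sum of
  \<open>k\<close> times the nonnegative \<open>picone_gap\<close>. If there are finitely supported functions that converge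
  to \<open>u\<close> pointwise and whose deficit tends to 0, then no larger weight is of Hardy type; moreover, for
  every positive supersolution \<open>v\<close> the gap of \<open>u\<close> relative to \<open>v\<close> vanishes, and the strict form of
  Picone's inequality makes \<open>v\<close> a multiple of \<open>u\<close> (\<open>critical_of_null_sequence\<close>). Such functions
  are \<open>u x\<close> times the logarithmic cutoff \<open>max 0 (1 - ln (1 + \<bar>x\<bar>) / N)\<close>. With \<open>\<mu> = min (p - 1) 1\<close>,
  the row of a site \<open>x\<close>
  contributes at most a constant times \<open>N\<close> to the power \<open>- 1 - \<mu>\<close> times
  \<open>1 + \<bar>x\<bar>\<close> to the power \<open>- S - \<gamma> p\<close>. If \<open>S + \<gamma> p \<ge> 1\<close>, which is the hypothesis of (a), then the sum
  over the support is of order \<open>N\<close>, and the deficit is of order \<open>N\<close> to the power \<open>- \<mu>\<close>.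

  For the asymptotics of \<open>w\<close>, multiply \<open>w n\<close> by \<open>n\<close> to the power \<open>S\<close>. This is a Riemann sum for the
  principal value integral over the real line of \<open>\<bar>1 - t\<bar>\<close> to the power \<open>- 1 - S\<close> times the signed power
  \<open>p - 1\<close> of \<open>1 - \<bar>t\<bar>\<^sup>-\<^sup>\<gamma>\<close>. The substitution \<open>t = 1 / r\<close> maps the negative part of the integrand to
  the positive part multiplied by \<open>- r\<close> to the power \<open>S + \<gamma> (p - 1) - 1\<close> (\<open>lower_profile_eq\<close>). Hence the
  limit is positive if \<open>S + \<gamma> (p - 1) < 1\<close>, and this is the lower bound on \<open>\<alpha>\<close> in the last part of the theorem.
  Away from \<open>t = 1\<close> the sums converge by dominated convergence. The sites within distance \<open>\<delta> n\<close> of \<open>n\<close>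
  contribute only \<open>O(\<delta>\<^sup>p\<^sup>-\<^sup>S + \<delta>)\<close>, uniformly in large \<open>n\<close>, because the terms at \<open>n + m\<close> and \<open>n - m\<close> cancel
  to leading order (\<open>symmetric_pair_bound\<close>).

  Part (b) is a corollary: its hypothesis \<open>S + \<gamma> p \<le> 1\<close> implies \<open>S + \<gamma> (p - 1) < 1\<close>, and then
  \<open>w u\<^sup>p\<close> is bounded below by a multiple of \<open>1 / \<bar>x\<bar>\<close> far out.\<close>

section \<open>The heat kernel and the recurrence for the kernels\<close>

text \<open>The heat kernel with pole at 0 in Fourier representation: \<open>2 - 2 cos
  \<theta>\<close> is the symbol of \<open>\<Delta>\<^sub>2\<close>.\<close>

definition fourier_heat :: "real \<Rightarrow> int \<Rightarrow> real" where
  "fourier_heat t x =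
    integral {0..pi} (\<lambda>\<theta>. exp (- t * (2 - 2 * cos \<theta>)) * cos (of_int x * \<theta>)) / pi"

lemma integral_cos_int:
  "integral {0..pi} (\<lambda>\<theta>. cos (of_int x * \<theta>)) = (if x = 0 then pi else 0)"
proof (cases "x = 0")
  case False
  have "((\<lambda>\<theta>. cos (of_int x * \<theta>)) has_integral
      sin (of_int x * pi) / of_int x - sin (of_int x * 0) / of_int x) {0..pi}"
    by (rule fundamental_theorem_of_calculus)
       (use False in \<open>auto intro!: derivative_eq_intros simp: has_real_derivative_iff_has_vector_derivative[symmetric]\<close>)
  then show ?thesis
    using False by (simp add: integral_unique mult.commute)
qed simp

lemma laplace2_iterate_fourier:
  "(laplace2 ^^ m) (indicat_real {0}) x =
    integral {0..pi} (\<lambda>\<theta>. (2 - 2 * cos \<theta>) ^ m * cos (of_int x * \<theta>)) / pi"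
proof (induction m arbitrary: x)
  case 0
  show ?case by (simp add: integral_cos_int indicator_def)
next
  case (Suc m)
  define g where "g = (\<lambda>(y::int) \<theta>::real. (2 - 2 * cos \<theta>) ^ m * cos (of_int y * \<theta>))"
  have i [simp]: "g y integrable_on {0..pi}" for y
    unfolding g_def by (intro integrable_continuous_interval continuous_intros)
  have eq: "(2 - 2 * cos \<theta>) ^ Suc m * cos (of_int x * \<theta>)
      = 2 * g x \<theta> - g (x + 1) \<theta> - g (x - 1) \<theta>" for \<theta>
    by (simp add: g_def cos_add cos_diff ring_distribs)
  have "integral {0..pi} (\<lambda>\<theta>. (2 - 2 * cos \<theta>) ^ Suc m * cos (of_int x * \<theta>))
      = integral {0..pi} (\<lambda>\<theta>. 2 * g x \<theta> - g (x + 1) \<theta> - g (x - 1) \<theta>)"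
    by (simp only: eq)
  also have "\<dots> = 2 * integral {0..pi} (g x) - integral {0..pi} (g (x + 1))
      - integral {0..pi} (g (x - 1))"
    using i by (simp add: integral_diff integrable_diff)
  finally show ?case
    using Suc.IH by (simp add: laplace2_def g_def diff_divide_distrib)
qed

text \<open>The symbol is bounded by 4, so the exponential series converges uniformly in
  \<open>\<theta>\<close> and may be integrated term by term.\<close>

lemma heat_kernel_fourier: "heat_kernel t x 0 = fourier_heat t x"
proof -
  define f where "f = (\<lambda>(m::nat) \<theta>. (- t) ^ m / fact m * ((2 - 2 * cos \<theta>) ^ m * cos (of_int x * \<theta>)))"
  have bound: "norm (f m \<theta>) \<le> (4 * \<bar>t\<bar>) ^ m / fact m" for m \<theta>
  proof -
    have "\<bar>2 - 2 * cos \<theta>\<bar> \<le> 4" using cos_le_one[of \<theta>] cos_ge_minus_one[of \<theta>] by linarith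
    then have "\<bar>2 - 2 * cos \<theta>\<bar> ^ m \<le> 4 ^ m" by (intro power_mono) auto
    then have "\<bar>2 - 2 * cos \<theta>\<bar> ^ m * \<bar>cos (of_int x * \<theta>)\<bar> \<le> 4 ^ m * 1"
      by (intro mult_mono) auto
    then have "\<bar>t\<bar> ^ m / fact m * (\<bar>2 - 2 * cos \<theta>\<bar> ^ m * \<bar>cos (of_int x * \<theta>)\<bar>)
        \<le> \<bar>t\<bar> ^ m / fact m * (4 ^ m * 1)"
      by (intro mult_left_mono) auto
    then show ?thesis
      by (simp add: f_def abs_mult power_abs power_mult_distrib mult.commute)
  qed
  have summ: "summable (\<lambda>m. (4 * \<bar>t\<bar>) ^ m / fact m)"
    using summable_exp[of "4 * \<bar>t\<bar>"] by (simp add: divide_inverse mult.commute)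
  have sumf: "(\<lambda>m. f m \<theta>) sums (exp (- t * (2 - 2 * cos \<theta>)) * cos (of_int x * \<theta>))" for \<theta>
  proof -
    have "(\<lambda>m. (- t * (2 - 2 * cos \<theta>)) ^ m /\<^sub>R fact m) sums exp (- t * (2 - 2 * cos \<theta>))"
      by (rule exp_converges)
    from sums_mult2[OF this, of "cos (of_int x * \<theta>)"]
    have "(\<lambda>m. (- t * (2 - 2 * cos \<theta>)) ^ m /\<^sub>R fact m * cos (of_int x * \<theta>))
      sums (exp (- t * (2 - 2 * cos \<theta>)) * cos (of_int x * \<theta>))" .
    moreover have "(- t * (2 - 2 * cos \<theta>)) ^ m /\<^sub>R fact m * cos (of_int x * \<theta>) = f m \<theta>" for m
      unfolding f_def power_mult_distrib by (simp add: divide_inverse)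
    ultimately show ?thesis by simp
  qed
  have ul: "uniform_limit {0..pi} (\<lambda>n \<theta>. \<Sum>m<n. f m \<theta>) (\<lambda>\<theta>. \<Sum>m. f m \<theta>) sequentially"
    by (rule Weierstrass_m_test[OF _ summ]) (rule bound)
  have cf: "continuous_on {0..pi} (\<lambda>\<theta>. \<Sum>m<n. f m \<theta>)" for n
    unfolding f_def by (intro continuous_intros)
  obtain I J where IJ: "\<And>n. ((\<lambda>\<theta>. \<Sum>m<n. f m \<theta>) has_integral I n) {0..pi}"
      "((\<lambda>\<theta>. \<Sum>m. f m \<theta>) has_integral J) {0..pi}" "I \<longlonglongrightarrow> J"
    using uniform_limit_integral[OF ul cf] by auto
  have fi: "f m integrable_on {0..pi}" for m
    unfolding f_def by (intro integrable_continuous_interval continuous_intros)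
  have "I n = (\<Sum>m<n. integral {0..pi} (f m))" for n
    using integral_unique[OF IJ(1)[of n]] integral_sum[of "{..<n}" f "{0..pi}"] fi by simp
  moreover have "integral {0..pi} (f m) = (- t) ^ m / fact m * (laplace2 ^^ m) (indicat_real {0}) x * pi" for m
    unfolding f_def by (simp add: laplace2_iterate_fourier)
  ultimately have "I = (\<lambda>n. \<Sum>m<n. (- t) ^ m / fact m * (laplace2 ^^ m) (indicat_real {0}) x * pi)"
    by (intro ext) (simp only:)
  then have "(\<lambda>m. (- t) ^ m / fact m * (laplace2 ^^ m) (indicat_real {0}) x * pi) sums J"
    using IJ(3) by (simp only: sums_def)
  then have "(\<lambda>m. (- t) ^ m / fact m * (laplace2 ^^ m) (indicat_real {0}) x * pi / pi) sums (J / pi)"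
    by (rule sums_divide)
  moreover have "J = pi * fourier_heat t x"
    using IJ(2) sums_unique[OF sumf] by (simp add: fourier_heat_def integral_unique)
  ultimately show ?thesis
    by (simp add: heat_kernel_def sums_iff)
qed

lemma fourier_heat_integrable [simp]:
  "(\<lambda>\<theta>. exp (- t * (2 - 2 * cos \<theta>)) * cos (of_int x * \<theta>)) integrable_on {0..pi}"
  by (intro integrable_continuous_interval continuous_intros)

lemma fourier_heat_minus: "fourier_heat t (- x) = fourier_heat t x"
  by (simp add: fourier_heat_def)

text \<open>The heat equation. Differentiation under the integral brings down the symbol, which
  the addition theorem for the cosine turns into a second difference in the site.\<close>

lemma fourier_heat_derivative:
  "((\<lambda>t. fourier_heat t x) has_real_derivative
     fourier_heat t (x + 1) + fourier_heat t (x - 1) - 2 * fourier_heat t x) (at t)"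
proof -
  define g where "g = (\<lambda>(y::int) \<theta>. exp (- t * (2 - 2 * cos \<theta>)) * cos (of_int y * \<theta>))"
  define f' where "f' = (\<lambda>(t::real) (\<theta>::real). - (2 - 2 * cos \<theta>) * (exp (- t * (2 - 2 * cos \<theta>)) * cos (of_int x * \<theta>)))"
  have "((\<lambda>t. integral (cbox 0 pi) (\<lambda>\<theta>. exp (- t * (2 - 2 * cos \<theta>)) * cos (of_int x * \<theta>)))
      has_field_derivative integral (cbox 0 pi) (f' t)) (at t within UNIV)"
  proof (rule leibniz_rule_field_derivative)
    show "continuous_on (UNIV \<times> cbox 0 pi) (\<lambda>(s, \<theta>). f' s \<theta>)"
      unfolding f'_def split_beta by (intro continuous_intros)
    show "(\<lambda>\<theta>. exp (- s * (2 - 2 * cos \<theta>)) * cos (real_of_int x * \<theta>)) integrable_on cbox 0 pi" for s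
      using fourier_heat_integrable by (simp only: cbox_interval)
  qed (auto simp: f'_def intro!: derivative_eq_intros)
  then have d: "((\<lambda>t. fourier_heat t x) has_field_derivative integral {0..pi} (f' t) / pi) (at t)"
    unfolding fourier_heat_def by (intro DERIV_cdivide) simp
  have eq: "f' t = (\<lambda>\<theta>. g (x + 1) \<theta> + g (x - 1) \<theta> - 2 * g x \<theta>)"
    by (simp add: fun_eq_iff f'_def g_def cos_add cos_diff ring_distribs)
  have i [simp]: "g y integrable_on {0..pi}" for y
    unfolding g_def by (rule fourier_heat_integrable)
  have "integral {0..pi} (f' t) = integral {0..pi} (\<lambda>\<theta>. g (x + 1) \<theta> + g (x - 1) \<theta> - 2 * g x \<theta>)"
    by (simp only: eq)
  also have "\<dots> = integral {0..pi} (g (x + 1)) + integral {0..pi} (g (x - 1)) - 2 * integral {0..pi} (g x)"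
    by (simp add: integral_diff integral_add integrable_add)
  finally show ?thesis
    using d by (simp add: fourier_heat_def g_def add_divide_distrib diff_divide_distrib)
qed

text \<open>The three-term recurrence of the Bessel functions, obtained by integrating by parts
  in \<open>\<theta>\<close>: the product of the exponential with \<open>sin (x
  \<theta>)\<close> vanishes at both ends of the interval.\<close>

lemma fourier_heat_recurrence:
  "of_int x * fourier_heat t x = t * (fourier_heat t (x - 1) - fourier_heat t (x + 1))"
proof -
  define g where "g = (\<lambda>(y::int) \<theta>. exp (- t * (2 - 2 * cos \<theta>)) * cos (of_int y * \<theta>))"
  have i [simp]: "g y integrable_on {0..pi}" for y
    unfolding g_def by (rule fourier_heat_integrable)
  define F where "F = (\<lambda>\<theta>. exp (- t * (2 - 2 * cos \<theta>)) * sin (of_int x * \<theta>))"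
  define f where "f = (\<lambda>\<theta>. of_int x * g x \<theta> - t * (g (x - 1) \<theta> - g (x + 1) \<theta>))"
  have "(F has_real_derivative f \<theta>) (at \<theta> within {0..pi})" for \<theta>
    unfolding F_def f_def g_def
    by (auto intro!: derivative_eq_intros simp: cos_add cos_diff algebra_simps)
  then have "(f has_integral F pi - F 0) {0..pi}"
    by (intro fundamental_theorem_of_calculus)
       (auto simp: has_real_derivative_iff_has_vector_derivative[symmetric])
  then have "integral {0..pi} f = 0"
    by (simp add: F_def integral_unique mult.commute)
  moreover have "integral {0..pi} f = of_int x * integral {0..pi} (g x)
      - t * (integral {0..pi} (g (x - 1)) - integral {0..pi} (g (x + 1)))"
    unfolding f_def by (simp add: integral_diff integrable_diff integrable_on_mult_right)
  ultimately show ?thesis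
    by (simp add: fourier_heat_def g_def[symmetric] divide_simps) (simp add: g_def algebra_simps)
qed

lemma abs_fourier_heat_le: "\<bar>fourier_heat t x\<bar> \<le> fourier_heat t 0"
proof -
  have "\<bar>integral {0..pi} (\<lambda>\<theta>. exp (- t * (2 - 2 * cos \<theta>)) * cos (of_int x * \<theta>))\<bar>
     \<le> integral {0..pi} (\<lambda>\<theta>. exp (- t * (2 - 2 * cos \<theta>)) * cos (of_int 0 * \<theta>))"
    unfolding real_norm_def[symmetric]
    by (rule integral_norm_bound_integral) (auto intro!: integrable_continuous_interval continuous_intros simp: abs_mult)
  then show ?thesis
    by (simp add: fourier_heat_def abs_divide divide_right_mono)
qed

text \<open>Only the quadratic order in \<open>\<theta>\<close> matters for the decay in time;
  the constant is chosen so that the cubic Taylor bound for the sine suffices.\<close>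

lemma one_minus_cos_lower:
  assumes "\<bar>\<theta>\<bar> \<le> pi"
  shows "\<theta>\<^sup>2 / 16 \<le> 2 - 2 * cos \<theta>"
proof -
  define y where "y = \<bar>\<theta>\<bar> / 2"
  have y: "0 \<le> y" "y \<le> 2" using assms pi_less_4 by (auto simp: y_def)
  have "\<bar>sin y - y\<bar> \<le> \<bar>y\<bar> ^ 3 / 6"
    using Maclaurin_sin_bound[of y 3] by (simp add: numeral_3_eq_3 sin_coeff_def fact_numeral inverse_eq_divide)
  moreover have "y ^ 3 \<le> 4 * y"
  proof -
    have "y * y \<le> 2 * 2" using y by (intro mult_mono) auto
    then have "y * y * y \<le> 4 * y" using y by (intro mult_right_mono) auto
    then show ?thesis by (simp add: power3_eq_cube)
  qed
  ultimately have "y / 4 \<le> sin y" using y by (simp add: abs_if split: if_splits)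
  then have "(y / 4)\<^sup>2 \<le> (sin y)\<^sup>2" using y by (intro power_mono) auto
  moreover have "cos \<theta> = 1 - 2 * (sin y)\<^sup>2"
    using cos_double_sin[of y] by (simp add: y_def abs_if split: if_splits)
  ultimately show ?thesis by (simp add: y_def power_divide)
qed

text \<open>Near \<open>\<theta> = 0\<close> the integrand is essentially Gaussian with variance
  of order \<open>1 / t\<close>. Estimating \<open>exp (- y)\<close> by \<open>1 / (1 +
  y)\<close> gives an arctangent as antiderivative.\<close>

lemma fourier_heat_zero_decay:
  assumes "t > 0"
  shows "fourier_heat t 0 \<le> 2 / sqrt t"
proof -
  define c where "c = sqrt t / 4"
  have c: "c > 0" "c\<^sup>2 = t / 16" using assms by (auto simp: c_def power_divide)
  have "((\<lambda>\<theta>. 1 / (1 + (c * \<theta>)\<^sup>2)) has_integral arctan (c * pi) / c - arctan (c * 0) / c) {0..pi}"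
    by (rule fundamental_theorem_of_calculus)
       (use c in \<open>auto intro!: derivative_eq_intros
          simp: has_real_derivative_iff_has_vector_derivative[symmetric] divide_simps\<close>)
  then have h: "((\<lambda>\<theta>. 1 / (1 + (c * \<theta>)\<^sup>2)) has_integral arctan (c * pi) / c) {0..pi}" by simp
  have le: "exp (- t * (2 - 2 * cos \<theta>)) * cos (of_int 0 * \<theta>) \<le> 1 / (1 + (c * \<theta>)\<^sup>2)"
    if "\<theta> \<in> {0..pi}" for \<theta>
  proof -
    have "(c * \<theta>)\<^sup>2 = t * (\<theta>\<^sup>2 / 16)" by (simp add: power_mult_distrib c)
    also have "\<dots> \<le> t * (2 - 2 * cos \<theta>)"
      using that assms by (intro mult_left_mono one_minus_cos_lower) auto
    finally have "exp (- (t * (2 - 2 * cos \<theta>))) \<le> exp (- (c * \<theta>)\<^sup>2)" by simp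
    also have "\<dots> = 1 / exp ((c * \<theta>)\<^sup>2)" by (simp add: exp_minus divide_inverse)
    also have "\<dots> \<le> 1 / (1 + (c * \<theta>)\<^sup>2)"
      by (intro divide_left_mono exp_ge_add_one_self mult_pos_pos)
         (auto intro: add_pos_nonneg)
    finally show ?thesis by simp
  qed
  have "pi * fourier_heat t 0 \<le> arctan (c * pi) / c"
    unfolding fourier_heat_def
    using has_integral_le[OF integrable_integral[OF fourier_heat_integrable[of t 0]] h le] by simp
  also have "\<dots> \<le> (pi / 2) / c"
    using c arctan_ubound[of "c * pi"] by (intro divide_right_mono) auto
  finally have "pi * fourier_heat t 0 \<le> pi * (2 / sqrt t)" by (simp add: c_def mult.commute)
  then show ?thesis by (subst (asm) mult_le_cancel_left_pos) auto
qed

lemma fourier_heat_le_1: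
  assumes "t \<ge> 0"
  shows "fourier_heat t 0 \<le> 1"
proof -
  have "integral {0..pi} (\<lambda>\<theta>. exp (- t * (2 - 2 * cos \<theta>)) * cos (of_int 0 * \<theta>))
    \<le> integral {0..pi} (\<lambda>\<theta>. 1)"
    using assms by (intro integral_le fourier_heat_integrable integrable_const_ivl) auto
  then show ?thesis by (simp add: fourier_heat_def)
qed

lemma fourier_heat_0_pos: "fourier_heat t 0 > 0"
proof -
  let ?f = "\<lambda>\<theta>. exp (- t * (2 - 2 * cos \<theta>)) * cos (of_int 0 * \<theta>)"
  have "integral {0..pi} ?f \<ge> 0" by (intro integral_nonneg fourier_heat_integrable) auto
  moreover have "integral {0..pi} ?f \<noteq> 0"
    by (subst integral_eq_0_iff) (auto intro!: continuous_intros intro: exI[of _ 0])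
  ultimately show ?thesis by (simp add: fourier_heat_def)
qed

text \<open>The integrand at site 1 changes sign. The recurrence replaces it by the one with
  \<open>1 - cos (2 \<theta>)\<close>, which does not.\<close>

lemma fourier_heat_1_pos:
  assumes "t > 0"
  shows "fourier_heat t 1 > 0"
proof -
  let ?f = "\<lambda>\<theta>. exp (- t * (2 - 2 * cos \<theta>)) * (1 - cos (2 * \<theta>))"
  have "integral {0..pi} ?f \<ge> 0"
    by (rule integral_nonneg) (auto intro!: integrable_continuous_interval continuous_intros)
  moreover have "integral {0..pi} ?f \<noteq> 0"
  proof (subst integral_eq_0_iff)
    show "\<not> (\<forall>\<theta>\<in>{0..pi}. ?f \<theta> = 0)"
    proof
      assume "\<forall>\<theta>\<in>{0..pi}. ?f \<theta> = 0"
      then have "?f (pi / 2) = 0" by (rule bspec) auto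
      then show False by simp
    qed
  qed (auto intro!: continuous_intros)
  moreover have "integral {0..pi} ?f =
     integral {0..pi} (\<lambda>\<theta>. exp (- t * (2 - 2 * cos \<theta>)) * cos (of_int 0 * \<theta>)
        - exp (- t * (2 - 2 * cos \<theta>)) * cos (of_int 2 * \<theta>))"
    by (simp add: right_diff_distrib)
  then have "integral {0..pi} ?f = pi * (fourier_heat t 0 - fourier_heat t 2)"
    by (simp only: integral_diff[OF fourier_heat_integrable fourier_heat_integrable])
       (simp add: fourier_heat_def right_diff_distrib)
  ultimately have "0 < pi * (fourier_heat t 0 - fourier_heat t 2)" by linarith
  then have "fourier_heat t 0 - fourier_heat t 2 > 0"
    by (simp add: zero_less_mult_iff)
  then show ?thesis
    using fourier_heat_recurrence[of 1 t] assms by simp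
qed

lemma set_integrable_powr_at_infinity:
  fixes b c :: real
  assumes "b < -1" "c > 0"
  shows "set_integrable lborel {c<..} (\<lambda>t. t powr b)"
proof -
  have "set_integrable lborel (einterval (ereal c) \<infinity>) (\<lambda>t. t powr b)"
  proof (rule interval_integral_FTC_nonneg(1)[where F = "\<lambda>t. t powr (b + 1) / (b + 1)" and B = 0])
    show "(((\<lambda>t. t powr (b + 1) / (b + 1)) \<circ> real_of_ereal) \<longlongrightarrow> c powr (b + 1) / (b + 1)) (at_right (ereal c))"
      unfolding ereal_tendsto_simps using assms by (intro tendsto_intros) auto
    show "(((\<lambda>t. t powr (b + 1) / (b + 1)) \<circ> real_of_ereal) \<longlongrightarrow> 0) (at_left \<infinity>)"
      unfolding ereal_tendsto_simps
      using assms by (intro tendsto_divide_zero tendsto_neg_powr filterlim_ident) auto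
  qed (use assms in \<open>auto intro!: derivative_eq_intros continuous_intros\<close>)
  then show ?thesis by simp
qed

lemma set_integrable_powr_at_0:
  fixes b c :: real
  assumes "b > -1" "c > 0"
  shows "set_integrable lborel {0<..<c} (\<lambda>t. t powr b)"
proof -
  have "set_integrable lborel (einterval (ereal 0) (ereal c)) (\<lambda>t. t powr b)"
  proof (rule interval_integral_FTC_nonneg(1)[where F = "\<lambda>t. t powr (b + 1) / (b + 1)" and A = 0])
    show "(((\<lambda>t. t powr (b + 1) / (b + 1)) \<circ> real_of_ereal) \<longlongrightarrow> c powr (b + 1) / (b + 1)) (at_left (ereal c))"
      unfolding ereal_tendsto_simps using assms by (intro tendsto_intros) auto
    have "((\<lambda>t::real. t powr (b + 1)) \<longlongrightarrow> 0 powr (b + 1)) (at_right 0)"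
      using assms by (intro tendsto_powr' tendsto_intros) (auto simp: eventually_at_filter)
    then show "(((\<lambda>t. t powr (b + 1) / (b + 1)) \<circ> real_of_ereal) \<longlongrightarrow> 0) (at_right (ereal 0))"
      unfolding ereal_tendsto_simps by (intro tendsto_divide_zero) simp
  qed (use assms in \<open>auto intro!: derivative_eq_intros continuous_intros\<close>)
  then show ?thesis by simp
qed

text \<open>The integral in \<^const>\<open>kappa2\<close> is the Mellin transform of the heat
  kernel at \<open>z = - r \<beta> / 2\<close>; in this form positive and negative orders are
  treated together.\<close>

definition heat_mellin :: "int \<Rightarrow> real \<Rightarrow> real" where
  "heat_mellin n z = (LBINT t:{0<..}. fourier_heat t n * t powr (z - 1))"

lemma continuous_fourier_heat: "continuous_on A (\<lambda>t. fourier_heat t n)"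
  using DERIV_isCont[OF fourier_heat_derivative] by (auto intro: continuous_at_imp_continuous_on)

lemma fourier_heat_small_time:
  assumes "n \<ge> 1" "t \<ge> 0"
  shows "\<bar>fourier_heat t n\<bar> \<le> 2 * t"
proof -
  have "\<bar>fourier_heat t m\<bar> \<le> 1" for m
    using abs_fourier_heat_le fourier_heat_le_1[OF assms(2)] by (rule order_trans)
  from this[of "n - 1"] this[of "n + 1"]
  have "\<bar>fourier_heat t (n - 1) - fourier_heat t (n + 1)\<bar> \<le> 2" by linarith
  then have "t * \<bar>fourier_heat t (n - 1) - fourier_heat t (n + 1)\<bar> \<le> t * 2"
    using assms by (intro mult_left_mono) auto
  then have "of_int n * \<bar>fourier_heat t n\<bar> \<le> 2 * t"
    using fourier_heat_recurrence[of n t] assms by (metis abs_mult abs_of_nonneg mult.commute of_int_nonneg order_trans zero_le_one)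
  moreover have "1 * \<bar>fourier_heat t n\<bar> \<le> of_int n * \<bar>fourier_heat t n\<bar>"
    using assms by (intro mult_right_mono) auto
  ultimately show ?thesis by linarith
qed

lemma fourier_heat_decay:
  assumes "t > 0"
  shows "\<bar>fourier_heat t n\<bar> \<le> 2 * t powr (- 1 / 2)"
  using order_trans[OF abs_fourier_heat_le fourier_heat_zero_decay[OF assms], of n] assms
  by (simp add: powr_minus_divide powr_half_sqrt)

text \<open>As time tends to 0, the kernel is bounded at the pole and vanishes at least linearly
  at all other sites; the exponent covers both cases.\<close>

lemma fourier_heat_near_0:
  assumes "0 \<le> n" "0 < t"
  shows "\<bar>fourier_heat t n\<bar> \<le> 2 * t powr of_int (min n 1)"
proof (cases "n \<le> 0")
  case True
  then show ?thesis
    using order_trans[OF abs_fourier_heat_le fourier_heat_le_1, of t n] assms by simp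
next
  case False
  then show ?thesis using fourier_heat_small_time[of n t] assms by (simp add: min_absorb2)
qed

text \<open>The condition on \<open>n\<close> and \<open>z\<close> is integrability at \<open>t
  = 0\<close>; the bound \<open>z < 1/2\<close> is integrability at infinity, where the heat
  kernel decays like \<open>t\<close> to the power \<open>-1/2\<close>.\<close>

lemma heat_mellin_integrable:
  assumes "0 \<le> n" "0 < of_int (min n 1) + z" "z < 1/2"
  shows "set_integrable lborel {0<..} (\<lambda>t. fourier_heat t n * t powr (z - 1))"
proof -
  define b where "b = real_of_int (min n 1)"
  have meas: "set_borel_measurable lborel A (\<lambda>t. fourier_heat t n * t powr (z - 1))"
    if "A \<in> sets borel" for A
  proof -
    have "(\<lambda>t. fourier_heat t n) \<in> borel_measurable borel"
      using continuous_fourier_heat by (rule borel_measurable_continuous_onI)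
    then show ?thesis using that unfolding set_borel_measurable_def by measurable
  qed
  have "set_integrable lborel {0<..<2} (\<lambda>t. fourier_heat t n * t powr (z - 1))"
  proof (rule set_integrable_bound)
    show "set_integrable lborel {0<..<2} (\<lambda>t. 2 * t powr (b + z - 1))"
      by (intro set_integrable_mult_right set_integrable_powr_at_0) (use assms in \<open>auto simp: b_def\<close>)
    have "\<bar>fourier_heat t n * t powr (z - 1)\<bar> \<le> 2 * t powr (b + z - 1)" if "t > 0" for t
    proof -
      have "\<bar>fourier_heat t n\<bar> * t powr (z - 1) \<le> (2 * t powr b) * t powr (z - 1)"
        using fourier_heat_near_0[OF assms(1) that] unfolding b_def by (intro mult_right_mono) auto
      then show ?thesis using that by (simp add: abs_mult powr_add[symmetric] mult.assoc add_diff_eq)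
    qed
    then show "AE t in lborel. t \<in> {0<..<2} \<longrightarrow> norm (fourier_heat t n * t powr (z - 1)) \<le> norm (2 * t powr (b + z - 1))"
      by auto
  qed (rule meas, simp)
  moreover have "set_integrable lborel {1<..} (\<lambda>t. fourier_heat t n * t powr (z - 1))"
  proof (rule set_integrable_bound)
    show "set_integrable lborel {1<..} (\<lambda>t. 2 * t powr (z - 3 / 2))"
      by (intro set_integrable_mult_right set_integrable_powr_at_infinity) (use assms in auto)
    have "\<bar>fourier_heat t n * t powr (z - 1)\<bar> \<le> 2 * t powr (z - 3 / 2)" if "t > 0" for t
    proof -
      have "\<bar>fourier_heat t n\<bar> * t powr (z - 1) \<le> (2 * t powr (- 1 / 2)) * t powr (z - 1)"
        using fourier_heat_decay[OF that] by (intro mult_right_mono) auto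
      also have "\<dots> = 2 * t powr (- 1 / 2 + (z - 1))" by (simp only: powr_add mult.assoc)
      also have "- 1 / 2 + (z - 1) = z - 3 / 2" by simp
      finally show ?thesis by (simp add: abs_mult)
    qed
    then show "AE t in lborel. t \<in> {1<..} \<longrightarrow> norm (fourier_heat t n * t powr (z - 1)) \<le> norm (2 * t powr (z - 3 / 2))"
      by auto
  qed (rule meas, simp)
  ultimately have "set_integrable lborel ({0<..<2} \<union> {1<..}) (\<lambda>t. fourier_heat t n * t powr (z - 1))"
    by (rule set_integrable_Un) auto
  also have "{0<..<2} \<union> {1<..} = {0::real<..}" by auto
  finally show ?thesis .
qed

lemma heat_mellin_boundary:
  assumes "0 \<le> n" "0 < of_int (min n 1) + z" "z < 1/2"
  shows "((\<lambda>t. fourier_heat t n * t powr z) \<longlongrightarrow> 0) (at_right 0)"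
    and "((\<lambda>t. fourier_heat t n * t powr z) \<longlongrightarrow> 0) at_top"
proof -
  define b where "b = real_of_int (min n 1) + z"
  have "((\<lambda>t::real. t powr b) \<longlongrightarrow> 0 powr b) (at_right 0)"
    using assms by (intro tendsto_powr' tendsto_intros) (auto simp: eventually_at_filter b_def)
  then have lim0: "((\<lambda>t::real. 2 * t powr b) \<longlongrightarrow> 0) (at_right 0)"
    by (intro tendsto_mult_right_zero) simp
  have "\<bar>fourier_heat t n * t powr z\<bar> \<le> 2 * t powr b" if "t > 0" for t
  proof -
    have "\<bar>fourier_heat t n\<bar> * t powr z \<le> (2 * t powr of_int (min n 1)) * t powr z"
      using fourier_heat_near_0[OF assms(1) that] by (intro mult_right_mono) auto
    then show ?thesis by (simp add: b_def abs_mult powr_add)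
  qed
  then have "\<forall>\<^sub>F t in at_right 0. norm (fourier_heat t n * t powr z) \<le> 2 * t powr b"
    by (auto simp: eventually_at_filter)
  then show "((\<lambda>t. fourier_heat t n * t powr z) \<longlongrightarrow> 0) (at_right 0)"
    using lim0 by (rule Lim_null_comparison)
  have "((\<lambda>t::real. t powr (z - 1 / 2)) \<longlongrightarrow> 0) at_top"
    using assms by (intro tendsto_neg_powr filterlim_ident) auto
  then have lim1: "((\<lambda>t::real. 2 * t powr (z - 1 / 2)) \<longlongrightarrow> 0) at_top"
    by (intro tendsto_mult_right_zero)
  have "\<bar>fourier_heat t n * t powr z\<bar> \<le> 2 * t powr (z - 1 / 2)" if "t > 0" for t
  proof -
    have "\<bar>fourier_heat t n\<bar> * t powr z \<le> (2 * t powr (- 1 / 2)) * t powr z"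
      using fourier_heat_decay[OF that] by (intro mult_right_mono) auto
    also have "\<dots> = 2 * t powr (- 1 / 2 + z)" by (simp only: powr_add mult.assoc)
    finally show ?thesis by (simp add: abs_mult add.commute)
  qed
  then have "\<forall>\<^sub>F t in at_top. norm (fourier_heat t n * t powr z) \<le> 2 * t powr (z - 1 / 2)"
    by (intro eventually_mono[OF eventually_gt_at_top[of 0]]) auto
  then show "((\<lambda>t. fourier_heat t n * t powr z) \<longlongrightarrow> 0) at_top"
    using lim1 by (rule Lim_null_comparison)
qed

text \<open>The heat equation and the three-term recurrence show that, with the factors in the
  statement, the difference of the two integrands is the time derivative of the sum of the
  kernels at \<open>n\<close> and \<open>n + 1\<close>, multiplied by \<open>t\<close> to the
  power \<open>z\<close>. This function vanishes at both ends of the time axis.\<close>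

lemma heat_mellin_recurrence:
  assumes "0 \<le> n" "0 < of_int (min n 1) + z" "z < 1/2"
  shows "(of_int n + 1 - z) * heat_mellin (n + 1) z = (of_int n + z) * heat_mellin n z"
proof -
  have n1: "0 \<le> n + 1" "0 < of_int (min (n + 1) 1) + z" using assms by (auto simp: min_def split: if_splits)
  define F where "F = (\<lambda>t. fourier_heat t n * t powr z + fourier_heat t (n + 1) * t powr z)"
  define f where "f = (\<lambda>t. (of_int n + z) * (fourier_heat t n * t powr (z - 1)) -
     (of_int n + 1 - z) * (fourier_heat t (n + 1) * t powr (z - 1)))"
  have int: "set_integrable lborel {0<..} f"
    unfolding f_def using assms n1 by (intro set_integral_diff set_integrable_mult_right heat_mellin_integrable) auto
  have deriv: "(F has_real_derivative f t) (at t)" if "t > 0" for t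
  proof -
    have tz: "t powr z = t * t powr (z - 1)"
      using that by (simp add: powr_diff)
    have "(F has_real_derivative
       (fourier_heat t (n + 1) + fourier_heat t (n - 1) - 2 * fourier_heat t n) * t powr z
       + fourier_heat t n * (z * t powr (z - 1))
       + ((fourier_heat t (n + 2) + fourier_heat t n - 2 * fourier_heat t (n + 1)) * t powr z
       + fourier_heat t (n + 1) * (z * t powr (z - 1)))) (at t)"
      unfolding F_def using that
      by (auto intro!: derivative_eq_intros fourier_heat_derivative[THEN DERIV_cong] simp: algebra_simps)
    also have "(fourier_heat t (n + 1) + fourier_heat t (n - 1) - 2 * fourier_heat t n) * t powr z
       + fourier_heat t n * (z * t powr (z - 1))
       + ((fourier_heat t (n + 2) + fourier_heat t n - 2 * fourier_heat t (n + 1)) * t powr z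
       + fourier_heat t (n + 1) * (z * t powr (z - 1))) =
       t powr (z - 1) * (t * (fourier_heat t (n - 1) - fourier_heat t (n + 1))
         - t * (fourier_heat t (n + 1 - 1) - fourier_heat t (n + 1 + 1))
         + z * fourier_heat t n + z * fourier_heat t (n + 1))"
      unfolding tz by (simp add: algebra_simps)
    also have "\<dots> = f t"
      unfolding fourier_heat_recurrence[symmetric] f_def by (simp add: algebra_simps)
    finally show ?thesis .
  qed
  have cont: "isCont f t" if "t > 0" for t
  proof -
    have "isCont (\<lambda>t. fourier_heat t m) t" for m
      using fourier_heat_derivative by (rule DERIV_isCont)
    then show ?thesis unfolding f_def using that by (intro continuous_intros) auto
  qed
  have "(LBINT t=ereal 0..\<infinity>. f t) = 0 - 0"
  proof (rule interval_integral_FTC_integrable)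
    show "((F \<circ> real_of_ereal) \<longlongrightarrow> 0) (at_right (ereal 0))"
      unfolding ereal_tendsto_simps F_def
      using heat_mellin_boundary(1)[OF assms] heat_mellin_boundary(1)[OF n1 assms(3)]
      by (rule tendsto_add_zero)
    show "((F \<circ> real_of_ereal) \<longlongrightarrow> 0) (at_left \<infinity>)"
      unfolding ereal_tendsto_simps F_def
      using heat_mellin_boundary(2)[OF assms] heat_mellin_boundary(2)[OF n1 assms(3)]
      by (rule tendsto_add_zero)
  qed (use deriv cont int in \<open>auto simp: has_real_derivative_iff_has_vector_derivative\<close>)
  then have "(LBINT t:{0<..}. f t) = 0"
    by (simp add: interval_integral_to_infinity_eq)
  moreover have "(LBINT t:{0<..}. f t) = (of_int n + z) * heat_mellin n z - (of_int n + 1 - z) * heat_mellin (n + 1) z"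
    unfolding f_def heat_mellin_def
    using heat_mellin_integrable[OF assms] heat_mellin_integrable[OF n1 assms(3)]
    by (subst set_integral_diff) (auto intro: set_integrable_mult_right)
  ultimately show ?thesis by simp
qed

lemma integral_pos_on_interval:
  fixes f :: "real \<Rightarrow> real"
  assumes f: "integrable lborel f" and nonneg: "\<And>x. 0 \<le> f x"
    and ab: "a < b" and pos: "\<And>x. a < x \<Longrightarrow> x < b \<Longrightarrow> 0 < f x"
  shows "0 < (LBINT x. f x)"
proof -
  have "(LBINT x. f x) \<noteq> 0"
  proof
    assume "(LBINT x. f x) = 0"
    then have "AE x in lborel. f x = 0"
      using integral_nonneg_eq_0_iff_AE[OF f] nonneg by simp
    then have "AE x in lborel. x \<notin> {a<..<b}"
      by (rule eventually_mono) (use pos in fastforce)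
    then have "emeasure lborel {a<..<b} = 0"
      by (subst (asm) AE_iff_measurable[of "{a<..<b}"]) auto
    then show False using ab by simp
  qed
  moreover have "0 \<le> (LBINT x. f x)" using nonneg by simp
  ultimately show ?thesis by simp
qed

lemma heat_mellin_pos:
  assumes "0 \<le> n" "0 < of_int (min n 1) + z" "z < 1/2"
    and pos: "\<And>t. t > 0 \<Longrightarrow> fourier_heat t n > 0"
  shows "heat_mellin n z > 0"
proof -
  let ?f = "\<lambda>t. indicat_real {0<..} t *\<^sub>R (fourier_heat t n * t powr (z - 1))"
  have int: "integrable lborel ?f"
    using heat_mellin_integrable[OF assms(1-3)] by (simp add: set_integrable_def)
  have "0 < integral\<^sup>L lborel ?f"
    by (rule integral_pos_on_interval[OF int, of 0 1]) (use pos in \<open>auto simp: indicator_def less_imp_le\<close>)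
  then show ?thesis by (simp add: heat_mellin_def set_lebesgue_integral_def)
qed

lemma kappa_eq_heat_mellin: "kappa r b z = (if of_int \<bar>z\<bar> > r * b / 2
    then heat_mellin z (- (r * b / 2)) / \<bar>Gamma (- (r * b / 2))\<bar> else 0)"
proof -
  have "heat_kernel t z 0 / t powr (1 + r * b / 2) = fourier_heat t z * t powr (- (r * b / 2) - 1)" for t
  proof -
    have "- (r * b / 2) - 1 = - (1 + r * b / 2)" by simp
    then have "t powr (- (r * b / 2) - 1) = inverse (t powr (1 + r * b / 2))"
      by (simp only: powr_minus)
    then show ?thesis by (simp only: heat_kernel_fourier divide_inverse)
  qed
  then show ?thesis unfolding kappa_def kappa2_def heat_mellin_def by simp
qed

lemma kappa_minus: "kappa r b (- z) = kappa r b z"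
  by (simp add: kappa_eq_heat_mellin heat_mellin_def fourier_heat_minus)

text \<open>For positive order the recurrence starts at site 1, since the integral defining the
  kernel diverges at the pole.\<close>

lemma kappa_positive_order_facts:
  assumes "0 < r * b" "r * b < 1"
  shows "kappa r b 0 = 0" and "kappa r b 1 > 0"
    and "n \<ge> 1 \<Longrightarrow> (of_int n + 1 + r * b / 2) * kappa r b (n + 1) = (of_int n - r * b / 2) * kappa r b n"
proof -
  show "kappa r b 0 = 0" using assms by (simp add: kappa_eq_heat_mellin)
  have "- (r * b / 2) \<notin> \<int>\<^sub>\<le>\<^sub>0"
  proof
    assume "- (r * b / 2) \<in> \<int>\<^sub>\<le>\<^sub>0"
    then obtain m :: nat where "- (r * b / 2) = - of_nat m" by (auto elim!: nonpos_Ints_cases')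
    then have "real m = r * b / 2" by simp
    then have "0 < real m" "real m < 1" using assms by auto
    then show False by simp
  qed
  then have "Gamma (- (r * b / 2)) \<noteq> 0" by (simp add: Gamma_eq_zero_iff)
  moreover have "heat_mellin 1 (- (r * b / 2)) > 0"
    by (rule heat_mellin_pos) (use assms fourier_heat_1_pos in auto)
  ultimately show "kappa r b 1 > 0" using assms by (simp add: kappa_eq_heat_mellin)
  show "(of_int n + 1 + r * b / 2) * kappa r b (n + 1) = (of_int n - r * b / 2) * kappa r b n" if "n \<ge> 1"
  proof -
    have "real_of_int n \<ge> 1" using that by simp
    then have "of_int \<bar>n\<bar> > r * b / 2" "of_int \<bar>n + 1\<bar> > r * b / 2" using assms that by auto
    then have "kappa r b n = heat_mellin n (- (r * b / 2)) / \<bar>Gamma (- (r * b / 2))\<bar>"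
      "kappa r b (n + 1) = heat_mellin (n + 1) (- (r * b / 2)) / \<bar>Gamma (- (r * b / 2))\<bar>"
      by (simp_all add: kappa_eq_heat_mellin)
    moreover have "(of_int n + 1 + r * b / 2) * heat_mellin (n + 1) (- (r * b / 2)) =
        (of_int n - r * b / 2) * heat_mellin n (- (r * b / 2))"
      using heat_mellin_recurrence[of n "- (r * b / 2)"] that assms by (simp add: min_absorb2)
    ultimately show ?thesis by simp
  qed
qed

lemma kappa_negative_order_facts:
  assumes "0 < r * b" "r * b < 1"
  shows "kappa r (- b) 0 > 0"
    and "n \<ge> 0 \<Longrightarrow> (of_int n + 1 - r * b / 2) * kappa r (- b) (n + 1) = (of_int n + r * b / 2) * kappa r (- b) n"
proof -
  have "heat_mellin 0 (r * b / 2) > 0"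
    by (rule heat_mellin_pos) (use assms fourier_heat_0_pos in auto)
  moreover have "Gamma (r * b / 2) > 0" using assms by (intro Gamma_real_pos) simp
  ultimately show "kappa r (- b) 0 > 0" using assms by (simp add: kappa_eq_heat_mellin)
  show "(of_int n + 1 - r * b / 2) * kappa r (- b) (n + 1) = (of_int n + r * b / 2) * kappa r (- b) n" if "n \<ge> 0"
  proof -
    have "of_int \<bar>n\<bar> > - (r * b / 2)" "of_int \<bar>n + 1\<bar> > - (r * b / 2)" using assms that by auto
    then have "kappa r (- b) n = heat_mellin n (r * b / 2) / \<bar>Gamma (r * b / 2)\<bar>"
      "kappa r (- b) (n + 1) = heat_mellin (n + 1) (r * b / 2) / \<bar>Gamma (r * b / 2)\<bar>"
      by (simp_all add: kappa_eq_heat_mellin)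
    moreover have "(of_int n + 1 - r * b / 2) * heat_mellin (n + 1) (r * b / 2) =
        (of_int n + r * b / 2) * heat_mellin n (r * b / 2)"
      by (rule heat_mellin_recurrence) (use that assms in \<open>auto simp: min_def\<close>)
    ultimately show ?thesis by simp
  qed
qed

section \<open>Powers and the Picone inequality\<close>

lemma powr_mean_value:
  fixes x y r :: real
  assumes "0 \<le> y" "y < x" "0 < r"
  obtains \<xi> where "y < \<xi>" "\<xi> < x" "x powr r - y powr r = r * \<xi> powr (r - 1) * (x - y)"
proof -
  have "\<exists>l \<xi>. y < \<xi> \<and> \<xi> < x \<and> ((\<lambda>t. t powr r) has_real_derivative l) (at \<xi>) \<and> x powr r - y powr r = (x - y) * l"
  proof (rule MVT)
    show "continuous_on {y..x} (\<lambda>t. t powr r)"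
      using assms by (intro continuous_on_powr' continuous_intros) auto
    show "(\<lambda>t. t powr r) differentiable (at t)" if "y < t" "t < x" for t
      using that assms by (intro differentiableI[OF has_real_derivative_powr[THEN has_field_derivative_imp_has_derivative]]) auto
  qed (use assms in auto)
  then obtain l \<xi> where *: "y < \<xi>" "\<xi> < x" "((\<lambda>t. t powr r) has_real_derivative l) (at \<xi>)"
      "x powr r - y powr r = (x - y) * l" by blast
  have "l = r * \<xi> powr (r - 1)"
    using * assms by (intro DERIV_unique[OF *(3)] has_real_derivative_powr) auto
  then show ?thesis using that * by (simp add: mult_ac)
qed

lemma powr_subadditive:
  fixes a b r :: real
  assumes "0 \<le> a" "0 \<le> b" "0 \<le> r" "r \<le> 1"
  shows "(a + b) powr r \<le> a powr r + b powr r"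
proof (cases "a + b = 0")
  case False
  define c where "c = a + b"
  have c: "c > 0" using False assms by (simp add: c_def)
  have unit: "t \<le> t powr r" if "0 \<le> t" "t \<le> 1" for t :: real
    using powr_mono'[of r 1 t] that assms by (cases "t = 0") auto
  have "c powr r = (a / c + b / c) * c powr r"
    using c by (simp add: c_def add_divide_distrib[symmetric])
  also have "\<dots> \<le> ((a / c) powr r + (b / c) powr r) * c powr r"
    using c assms by (intro mult_right_mono add_mono unit) (auto simp: c_def divide_le_eq)
  also have "\<dots> = a powr r + b powr r"
    using c assms by (simp add: powr_divide distrib_right)
  finally show ?thesis by (simp add: c_def)
qed (use assms in auto)

text \<open>One estimate for concave and convex powers: a power at most 1 is subadditive, and to
  a power above 1 the mean value theorem applies.\<close>

lemma powr_diff_upper: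
  fixes A X e :: real
  assumes "0 \<le> A" "A \<le> X" "0 < e"
  shows "X powr e - A powr e \<le> max 1 e * ((X - A) powr min e 1 * X powr (e - min e 1))"
proof (cases "A = X")
  case False
  then have X: "0 < X" "A < X" using assms by auto
  show ?thesis
  proof (cases "e \<le> 1")
    case True
    then show ?thesis using powr_subadditive[of A "X - A" e] assms X by (simp add: min_def max_def)
  next
    case e: False
    obtain \<xi> where \<xi>: "A < \<xi>" "\<xi> < X" "X powr e - A powr e = e * \<xi> powr (e - 1) * (X - A)"
      using powr_mean_value[OF assms(1) X(2) assms(3)] .
    have "\<xi> powr (e - 1) \<le> X powr (e - 1)"
      using \<xi> assms e by (intro powr_mono2) auto
    then have "e * \<xi> powr (e - 1) * (X - A) \<le> e * X powr (e - 1) * (X - A)"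
      using assms X by (intro mult_right_mono mult_left_mono) auto
    then show ?thesis using \<xi> X e by (simp add: min_def max_def mult_ac)
  qed
qed (use assms in auto)

lemma powr_tangent_less:
  fixes x y r :: real
  assumes "0 \<le> x" "0 \<le> y" "1 < r" "x \<noteq> y"
  shows "y powr r + r * y powr (r - 1) * (x - y) < x powr r"
proof (cases "y < x")
  case True
  obtain \<xi> where \<xi>: "y < \<xi>" "\<xi> < x" "x powr r - y powr r = r * \<xi> powr (r - 1) * (x - y)"
    using powr_mean_value[of y x r] True assms by auto
  have "y powr (r - 1) < \<xi> powr (r - 1)"
    using \<xi> assms by (intro powr_less_mono2) auto
  then have "r * y powr (r - 1) * (x - y) < r * \<xi> powr (r - 1) * (x - y)"
    using True assms by simp
  then show ?thesis using \<xi> by linarith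
next
  case False
  then have xy: "x < y" using assms by auto
  obtain \<xi> where \<xi>: "x < \<xi>" "\<xi> < y" "y powr r - x powr r = r * \<xi> powr (r - 1) * (y - x)"
    using powr_mean_value[of x y r] xy assms by auto
  have "\<xi> powr (r - 1) < y powr (r - 1)"
    using \<xi> assms by (intro powr_less_mono2) auto
  then have "r * \<xi> powr (r - 1) * (y - x) < r * y powr (r - 1) * (y - x)"
    using xy assms by simp
  also have "\<dots> = - (r * y powr (r - 1) * (x - y))" by (simp add: algebra_simps)
  finally show ?thesis using \<xi> by linarith
qed

lemma powr_strict_convex:
  fixes x y r l m :: real
  assumes "0 \<le> x" "0 \<le> y" "1 < r" "x \<noteq> y" "0 < l" "0 < m" "l + m = 1"
  shows "(l * x + m * y) powr r < l * x powr r + m * y powr r"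
proof -
  define z where "z = l * x + m * y"
  have z: "0 \<le> z" using assms by (simp add: z_def)
  have "z - y = l * (x - y)" "z - x = m * (y - x)"
    using assms(7) by (auto simp: z_def algebra_simps) (metis distrib_left mult.commute mult.right_neutral)+
  then have ne: "x \<noteq> z" "y \<noteq> z" using assms by auto
  have "l * (z powr r + r * z powr (r - 1) * (x - z)) < l * x powr r"
    using powr_tangent_less[OF assms(1) z assms(3) ne(1)] assms by simp
  moreover have "m * (z powr r + r * z powr (r - 1) * (y - z)) < m * y powr r"
    using powr_tangent_less[OF assms(2) z assms(3) ne(2)] assms by simp
  moreover have "l * (z powr r + r * z powr (r - 1) * (x - z)) + m * (z powr r + r * z powr (r - 1) * (y - z))
     = (l + m) * z powr r + r * z powr (r - 1) * (l * x + m * y - (l + m) * z)"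
    by (simp add: algebra_simps)
  moreover have "\<dots> = z powr r" using assms(7) by (simp add: z_def)
  ultimately show ?thesis by (simp add: z_def)
qed

text \<open>The remainder in Picone's inequality for a test function with values
  \<open>a\<close>, \<open>b\<close> and a positive function with values \<open>v1\<close>,
  \<open>v2\<close> at the two ends of an edge.\<close>

definition picone_gap :: "real \<Rightarrow> real \<Rightarrow> real \<Rightarrow> real \<Rightarrow> real \<Rightarrow> real" where
  "picone_gap p v1 v2 a b = \<bar>a - b\<bar> powr p -
     (\<bar>a\<bar> powr p / v1 powr (p - 1) - \<bar>b\<bar> powr p / v2 powr (p - 1)) * signed_powr (v1 - v2) (p - 1)"

lemma signed_powr_minus: "signed_powr (- t) r = - signed_powr t r"
  by (simp add: signed_powr_def sgn_minus)

lemma signed_powr_nonneg: "0 \<le> t \<Longrightarrow> signed_powr t r = t powr r"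
  by (auto simp: signed_powr_def sgn_if)

lemma abs_signed_powr [simp]: "\<bar>signed_powr t r\<bar> = \<bar>t\<bar> powr r"
  by (auto simp: signed_powr_def abs_mult sgn_if)

lemma picone_gap_sym: "picone_gap p v2 v1 b a = picone_gap p v1 v2 a b"
  using signed_powr_minus[of "v1 - v2" "p - 1"] by (simp add: picone_gap_def abs_minus_commute algebra_simps)

text \<open>Let \<open>c = v1 - v2\<close> and \<open>D = v1 s - v2 t\<close>. Then
  \<open>s\<close> is the convex combination of \<open>D / c\<close> and \<open>t\<close> with
  weights \<open>c / v1\<close> and \<open>v2 / v1\<close>, and the claim is (strict) convexity
  of the \<open>p\<close>-th power. If \<open>D < 0\<close>, monotonicity suffices.\<close>

lemma picone_aux:
  assumes p: "1 < p" and v: "0 < v2" "v2 \<le> v1" and st: "0 \<le> s" "0 \<le> t"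
  shows "0 \<le> picone_gap p v1 v2 (v1 * s) (v2 * t)"
    and "s \<noteq> t \<Longrightarrow> 0 < picone_gap p v1 v2 (v1 * s) (v2 * t)"
proof -
  have simp1: "\<bar>v * r\<bar> powr p / v powr (p - 1) = v * r powr p" if "v > 0" "r \<ge> 0" for v r
    using that by (simp add: powr_mult powr_diff)
  define c where "c = v1 - v2"
  define D where "D = v1 * s - v2 * t"
  have gap: "picone_gap p v1 v2 (v1 * s) (v2 * t) = \<bar>D\<bar> powr p - (v1 * s powr p - v2 * t powr p) * c powr (p - 1)"
    using v st unfolding picone_gap_def c_def D_def
    by (subst (1 2) simp1) (simp_all add: signed_powr_nonneg)
  have main: "0 < picone_gap p v1 v2 (v1 * s) (v2 * t)" if ne: "s \<noteq> t"
  proof (cases "c = 0")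
    case True
    then have "D = v1 * (s - t)" by (simp add: D_def c_def algebra_simps)
    then have "D \<noteq> 0" using ne v by simp
    then show ?thesis using True gap by simp
  next
    case False
    then have c: "c > 0" using v by (simp add: c_def)
    have v1: "v1 > 0" using v by simp
    have less: "v1 * s powr p - v2 * t powr p < \<bar>D\<bar> powr p * c powr (1 - p)"
    proof (cases "D < 0")
      case True
      then have lt: "v1 * s < v2 * t" by (simp add: D_def)
      then have t: "t > 0" using v st v1 by (metis mult_nonneg_nonneg less_eq_real_def linorder_not_less mult_zero_right order_less_le_trans)
      have "v2 * t \<le> v1 * t" using v st by (intro mult_right_mono) auto
      then have "s < t" using lt v1 by (metis mult_less_cancel_left_pos order_less_le_trans)
      have "v1 * s powr p = (v1 * s) * s powr (p - 1)"
        using st by (cases "s = 0") (simp_all add: powr_diff)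
      also have "\<dots> \<le> (v2 * t) * s powr (p - 1)"
        using lt by (intro mult_right_mono) auto
      also have "\<dots> \<le> (v2 * t) * t powr (p - 1)"
        using \<open>s < t\<close> st v p by (intro mult_left_mono powr_mono2) auto
      also have "\<dots> = v2 * t powr p" using t by (simp add: powr_diff)
      finally have "v1 * s powr p - v2 * t powr p \<le> 0" by simp
      also have "0 < \<bar>D\<bar> powr p * c powr (1 - p)" using True c by simp
      finally show ?thesis .
    next
      case D: False
      define x where "x = D / c"
      have x: "x \<ge> 0" using D c by (simp add: x_def)
      have s_eq: "s = (c / v1) * x + (v2 / v1) * t"
        using c v1 by (simp add: x_def D_def add_divide_distrib[symmetric])
      have "x \<noteq> t"
      proof
        assume "x = t"
        then have "s = (c / v1 + v2 / v1) * t" using s_eq by (simp add: distrib_right)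
        also have "c / v1 + v2 / v1 = 1" using v1 by (simp add: c_def add_divide_distrib[symmetric])
        finally show False using ne by simp
      qed
      then have "s powr p < (c / v1) * x powr p + (v2 / v1) * t powr p"
        unfolding s_eq using x st p c v v1
        by (intro powr_strict_convex) (auto simp: c_def add_divide_distrib[symmetric])
      then have "v1 * s powr p < v1 * ((c / v1) * x powr p + (v2 / v1) * t powr p)"
        using v1 by simp
      also have "\<dots> = c * x powr p + v2 * t powr p" using v1 by (simp add: distrib_left)
      also have "c * x powr p = \<bar>D\<bar> powr p * c powr (1 - p)"
        using c D by (simp add: x_def powr_divide powr_diff)
      finally show ?thesis by simp
    qed
    have "(v1 * s powr p - v2 * t powr p) * c powr (p - 1) < \<bar>D\<bar> powr p * c powr (1 - p) * c powr (p - 1)"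
      using less c by simp
    also have "\<dots> = \<bar>D\<bar> powr p" using c by (simp add: mult.assoc powr_add[symmetric])
    finally show ?thesis using gap by simp
  qed
  then show "s \<noteq> t \<Longrightarrow> 0 < picone_gap p v1 v2 (v1 * s) (v2 * t)" .
  show "0 \<le> picone_gap p v1 v2 (v1 * s) (v2 * t)"
  proof (cases "s = t")
    case True
    have "v1 * t powr p - v2 * t powr p = c * t powr p" by (simp add: c_def algebra_simps)
    moreover have "D = c * t" using True by (simp add: D_def c_def algebra_simps)
    moreover have "c * c powr (p - 1) = c powr p"
      using v by (cases "c = 0") (auto simp: c_def powr_diff)
    moreover have "c \<ge> 0" using v by (simp add: c_def)
    ultimately have "picone_gap p v1 v2 (v1 * s) (v2 * t) = 0"
      using True st unfolding gap by (simp add: powr_mult abs_mult algebra_simps)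
    then show ?thesis by simp
  qed (use main in \<open>simp add: less_imp_le\<close>)
qed

lemma picone_gap_nonneg_strict:
  assumes p: "1 < p" and v: "0 < v1" "0 < v2" and ab: "0 \<le> a" "0 \<le> b"
  shows "0 \<le> picone_gap p v1 v2 a b"
    and "a * v2 \<noteq> b * v1 \<Longrightarrow> 0 < picone_gap p v1 v2 a b"
proof -
  have eq: "a = v1 * (a / v1)" "b = v2 * (b / v2)" using v by simp_all
  have pos: "0 \<le> a / v1" "0 \<le> b / v2" using v ab by simp_all
  have "0 \<le> picone_gap p v1 v2 a b \<and> (a / v1 \<noteq> b / v2 \<longrightarrow> 0 < picone_gap p v1 v2 a b)"
  proof (cases "v2 \<le> v1")
    case True
    show ?thesis
      using picone_aux[OF p v(2) True pos] eq by metis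
  next
    case False
    then have "v1 \<le> v2" by simp
    from picone_aux[OF p v(1) this pos(2,1)] show ?thesis
      using eq picone_gap_sym by metis
  qed
  then show "0 \<le> picone_gap p v1 v2 a b" "a * v2 \<noteq> b * v1 \<Longrightarrow> 0 < picone_gap p v1 v2 a b"
    using v by (auto simp: field_simps)
qed

lemma picone_gap_nonneg:
  assumes p: "1 < p" and v: "0 < v1" "0 < v2"
  shows "0 \<le> picone_gap p v1 v2 a b"
proof -
  have "0 \<le> picone_gap p v1 v2 \<bar>a\<bar> \<bar>b\<bar>" using assms by (intro picone_gap_nonneg_strict) auto
  moreover have "\<bar>\<bar>a\<bar> - \<bar>b\<bar>\<bar> powr p \<le> \<bar>a - b\<bar> powr p"
    using p by (intro powr_mono2) auto
  ultimately show ?thesis by (simp add: picone_gap_def)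
qed

text \<open>If function and cutoff are both larger at the first end, then with \<open>A = (a -
  b) s\<close> and \<open>B = b d\<close> the energy term is the \<open>p\<close>-th power of
  \<open>A + B\<close>. The gap is then a sum of two first order Taylor remainders of the
  \<open>p\<close>-th power, one at \<open>A\<close> with increment \<open>B\<close>, the other
  at \<open>s\<close> with increment \<open>- d\<close>. Each remainder is of order \<open>1 +
  \<mu> = min p 2\<close> in \<open>d\<close>.\<close>

lemma picone_gap_upper:
  assumes p: "1 < p" and ab: "0 < b" "b \<le> a" and st: "0 \<le> t" "t \<le> s" "s \<le> 1"
  defines "\<mu> \<equiv> min (p - 1) 1" and "d \<equiv> s - t"
  shows "picone_gap p a b (a * s) (b * t) \<le> p * max 1 (p - 1) *
    ((b * d) powr (1 + \<mu>) * ((a - b) + b * d) powr (p - 1 - \<mu>) + b * (a - b) powr (p - 1) * d powr (1 + \<mu>))"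
proof -
  define e where "e = p - 1"
  define K where "K = max 1 e"
  have e: "e > 0" "p = e + 1" and \<mu>: "\<mu> = min e 1" using p by (auto simp: e_def \<mu>_def)
  have a: "a > 0" and s: "s \<ge> 0" and d: "d \<ge> 0" using ab st by (auto simp: d_def)
  have \<mu>': "\<mu> \<le> e" "\<mu> > 0" using e by (auto simp: \<mu>)
  have simp1: "\<bar>v * r\<bar> powr p / v powr (p - 1) = v * r powr p" if "v > 0" "r \<ge> 0" for v r
    using that by (simp add: powr_mult powr_diff)
  define A where "A = (a - b) * s"
  define B where "B = b * d"
  have AB: "A \<ge> 0" "B \<ge> 0" "a * s - b * t = A + B" using ab s d by (simp_all add: A_def B_def) (simp add: d_def algebra_simps)
  have gap: "picone_gap p a b (a * s) (b * t) = (A + B) powr p - (a * s powr p - b * t powr p) * (a - b) powr e"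
    using ab a s st AB unfolding picone_gap_def e_def
    by (subst (1 2) simp1) (simp_all add: signed_powr_nonneg)
  have Ap: "(a - b) * s powr p * (a - b) powr e = A powr p"
    using ab s unfolding A_def e(2) by (cases "a = b") (auto simp: powr_mult powr_add)
  \<comment> \<open>The \<open>p\<close>-th power of \<open>A\<close> is added and subtracted to
    expose the two Taylor remainders.\<close>
  have split: "picone_gap p a b (a * s) (b * t) =
     ((A + B) powr p - A powr p) - b * (s powr p - t powr p) * (a - b) powr e"
    unfolding gap Ap[symmetric] by (simp add: algebra_simps)
  \<comment> \<open>both differences of \<open>p\<close>-th powers are linearised\<close>
  have first: "(A + B) powr p - A powr p \<le> p * B * A powr e + p * B * (K * (B powr \<mu> * (A + B) powr (e - \<mu>)))"
  proof (cases "B = 0")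
    case False
    then have "A < A + B" using AB by simp
    then obtain \<xi> where \<xi>: "A < \<xi>" "\<xi> < A + B" "(A + B) powr p - A powr p = p * \<xi> powr (p - 1) * (A + B - A)"
      using powr_mean_value[of A "A + B" p] AB p by auto
    have "\<xi> powr e \<le> (A + B) powr e" using \<xi> AB e by (intro powr_mono2) auto
    also have "\<dots> \<le> A powr e + K * (B powr \<mu> * (A + B) powr (e - \<mu>))"
      using powr_diff_upper[of A "A + B" e] AB e by (simp add: K_def \<mu>)
    finally have "p * B * \<xi> powr e \<le> p * B * (A powr e + K * (B powr \<mu> * (A + B) powr (e - \<mu>)))"
      using AB p by (intro mult_left_mono) auto
    then show ?thesis using \<xi>(3) by (simp add: e_def algebra_simps)
  qed simp
  have second: "p * d * s powr e - (s powr p - t powr p) \<le> p * d * (K * d powr \<mu>)"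
  proof (cases "d = 0")
    case False
    then have "t < s" using st by (simp add: d_def)
    then obtain \<xi> where \<xi>: "t < \<xi>" "\<xi> < s" "s powr p - t powr p = p * \<xi> powr (p - 1) * (s - t)"
      using powr_mean_value[of t s p] st p by auto
    have "s powr e - t powr e \<le> K * (d powr \<mu> * s powr (e - \<mu>))"
      using powr_diff_upper[of t s e] st e by (simp add: K_def \<mu> d_def)
    also have "\<dots> \<le> K * (d powr \<mu> * 1)"
      using st s \<mu>' powr_mono2[of "e - \<mu>" s 1] by (intro mult_left_mono) (auto simp: K_def)
    finally have "s powr e - t powr e \<le> K * d powr \<mu>" by simp
    moreover have "t powr e \<le> \<xi> powr e" using \<xi> st e by (intro powr_mono2) auto
    ultimately have "s powr e - \<xi> powr e \<le> K * d powr \<mu>" by simp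
    then have "p * d * (s powr e - \<xi> powr e) \<le> p * d * (K * d powr \<mu>)"
      using d p by (intro mult_left_mono) auto
    then show ?thesis using \<xi>(3) by (simp add: e_def d_def algebra_simps)
  qed (simp add: d_def)
  have BA: "p * B * A powr e = b * (p * d * s powr e) * (a - b) powr e"
    using ab s by (simp add: A_def B_def powr_mult)
  have A_le: "A \<le> a - b" using ab st by (simp add: A_def mult_left_le)
  have "picone_gap p a b (a * s) (b * t) \<le> p * B * A powr e + p * B * (K * (B powr \<mu> * (A + B) powr (e - \<mu>)))
      - b * (s powr p - t powr p) * (a - b) powr e"
    using first unfolding split by simp
  also have "\<dots> = p * K * (B * B powr \<mu> * (A + B) powr (e - \<mu>)) +
      b * (a - b) powr e * (p * d * s powr e - (s powr p - t powr p))"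
    unfolding BA by (simp add: algebra_simps)
  also have "\<dots> \<le> p * K * (B * B powr \<mu> * ((a - b) + B) powr (e - \<mu>)) + b * (a - b) powr e * (p * d * (K * d powr \<mu>))"
    using second A_le AB ab p \<mu>' by (intro add_mono mult_left_mono powr_mono2) (auto simp: K_def)
  also have "\<dots> = p * K * (B * B powr \<mu> * ((a - b) + B) powr (e - \<mu>) + b * (a - b) powr e * (d * d powr \<mu>))"
    by (simp add: algebra_simps)
  also have "B * B powr \<mu> = B powr (1 + \<mu>)"
    using AB by (cases "B = 0") (auto simp: powr_add)
  also have "d * d powr \<mu> = d powr (1 + \<mu>)"
    using d by (cases "d = 0") (auto simp: powr_add)
  finally show ?thesis by (simp add: B_def K_def e_def mult_ac)
qed

text \<open>Every power of the logarithm grows more slowly than every positive power.\<close>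

lemma ln_power_bound:
  fixes r s :: real
  assumes "0 < r" "0 < s"
  obtains K where "0 < K" "\<And>z. 1 \<le> z \<Longrightarrow> ln (1 + z) powr r \<le> K * z powr s"
proof -
  define \<delta> where "\<delta> = s / r"
  have \<delta>: "\<delta> > 0" "\<delta> * r = s" using assms by (auto simp: \<delta>_def)
  have "ln (1 + z) powr r \<le> (2 powr s / \<delta> powr r) * z powr s" if "1 \<le> z" for z
  proof -
    have "ln (1 + z) \<le> (1 + z) powr \<delta> / \<delta>" using that \<delta> by (intro ln_powr_bound) auto
    also have "\<dots> \<le> (2 * z) powr \<delta> / \<delta>" using that \<delta> by (intro divide_right_mono powr_mono2) auto
    finally have "ln (1 + z) powr r \<le> ((2 * z) powr \<delta> / \<delta>) powr r"
      using that assms by (intro powr_mono2) auto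
    also have "\<dots> = 2 powr s / \<delta> powr r * z powr s"
      using that \<delta> by (simp add: powr_divide powr_powr powr_mult)
    finally show ?thesis .
  qed
  then show ?thesis using that[of "2 powr s / \<delta> powr r"] \<delta> by auto
qed

lemma powr_divide_minus:
  fixes A N r :: real
  assumes "0 \<le> A" "0 < N"
  shows "(A / N) powr r = A powr r * N powr (- r)"
  using assms by (simp add: powr_divide powr_minus_divide)

section \<open>Sums and asymptotics of power type\<close>

text \<open>The recurrence makes \<open>f\<close> a quotient of Pochhammer symbols, and Gauss's
  product for the Gamma function gives their asymptotics.\<close>

lemma gamma_ratio_asymptotics:
  fixes f :: "nat \<Rightarrow> real"
  assumes bc: "0 < b" "0 < c" and f0: "0 < f 0"
    and rec: "\<And>n. (real n + c) * f (Suc n) = (real n + b) * f n"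
  obtains L where "0 < L" "(\<lambda>n. f n * real n powr (c - b)) \<longlonglongrightarrow> L"
proof -
  have poch: "f n * pochhammer c n = f 0 * pochhammer b n" for n
  proof (induction n)
    case (Suc n)
    have "f (Suc n) * pochhammer c (Suc n) = ((real n + c) * f (Suc n)) * pochhammer c n"
      by (simp add: pochhammer_Suc algebra_simps)
    also have "\<dots> = (real n + b) * (f n * pochhammer c n)" by (simp add: rec)
    finally show ?case by (simp add: Suc.IH pochhammer_Suc algebra_simps)
  qed simp
  have pos: "pochhammer c n > 0" "pochhammer b n > 0" for n
    using bc by (auto intro: pochhammer_pos)
  define L where "L = f 0 * (Gamma c / Gamma b)"
  have "(\<lambda>n. f 0 * (Gamma_series c n / Gamma_series b n)) \<longlonglongrightarrow> L"
    unfolding L_def using bc by (intro tendsto_intros) (auto simp: Gamma_eq_zero_iff dest!: nonpos_Ints_nonpos)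
  moreover have "f 0 * (Gamma_series c n / Gamma_series b n) = f (Suc n) * real n powr (c - b)" if "n > 0" for n
  proof -
    have "f (Suc n) = f 0 * pochhammer b (Suc n) / pochhammer c (Suc n)"
      using poch[of "Suc n"] pos(1)[of "Suc n"] by (simp add: field_simps)
    moreover have "real n powr (c - b) = exp (c * ln n) / exp (b * ln n)"
      using that by (simp add: powr_def left_diff_distrib exp_diff)
    ultimately show ?thesis by (simp add: Gamma_series_def)
  qed
  ultimately have lim: "(\<lambda>n. f (Suc n) * real n powr (c - b)) \<longlonglongrightarrow> L"
    by (elim Lim_transform_eventually) (intro eventually_mono[OF eventually_gt_at_top[of 0]], auto)
  have "(\<lambda>n. (real (Suc n) / real n) powr (c - b)) \<longlonglongrightarrow> 1 powr (c - b)"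
    by (intro tendsto_intros LIMSEQ_Suc_n_over_n) auto
  from tendsto_mult[OF lim this]
  have "(\<lambda>n. f (Suc n) * real n powr (c - b) * (real (Suc n) / real n) powr (c - b)) \<longlonglongrightarrow> L" by simp
  moreover have "f (Suc n) * real n powr (c - b) * (real (Suc n) / real n) powr (c - b) = f (Suc n) * real (Suc n) powr (c - b)"
    if "n > 0" for n
    using that by (simp add: powr_divide)
  ultimately have "(\<lambda>n. f (Suc n) * real (Suc n) powr (c - b)) \<longlonglongrightarrow> L"
    by (elim Lim_transform_eventually) (intro eventually_mono[OF eventually_gt_at_top[of 0]], auto)
  then have "(\<lambda>n. f n * real n powr (c - b)) \<longlonglongrightarrow> L" by (rule LIMSEQ_imp_Suc)
  moreover have "L > 0" using f0 bc by (simp add: L_def Gamma_real_pos)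
  ultimately show ?thesis using that by blast
qed

lemma power_asymptotics_shift:
  fixes f :: "nat \<Rightarrow> real"
  assumes "(\<lambda>n. f n * real n powr r) \<longlonglongrightarrow> L"
  shows "(\<lambda>n. f n * real (Suc n) powr r) \<longlonglongrightarrow> L"
proof -
  have "(\<lambda>n. (real (Suc n) / real n) powr r) \<longlonglongrightarrow> 1 powr r"
    by (intro tendsto_intros LIMSEQ_Suc_n_over_n) auto
  from tendsto_mult[OF assms this]
  have "(\<lambda>n. f n * real n powr r * (real (Suc n) / real n) powr r) \<longlonglongrightarrow> L" by simp
  moreover have "f n * real n powr r * (real (Suc n) / real n) powr r = f n * real (Suc n) powr r"
    if "n > 0" for n
    using that by (simp add: powr_divide)
  ultimately show ?thesis
    by (elim Lim_transform_eventually) (intro eventually_mono[OF eventually_gt_at_top[of 0]], auto)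
qed

lemma positive_sequence_bounds:
  fixes X :: "nat \<Rightarrow> real"
  assumes "X \<longlonglongrightarrow> L" "0 < L" "\<And>n. 0 < X n"
  obtains c C where "0 < c" "0 < C" "\<And>n. c \<le> X n" "\<And>n. X n \<le> C"
proof -
  have "Bseq X" using assms(1) by (rule convergent_imp_Bseq[OF convergentI])
  then obtain C where C: "0 < C" "\<And>n. norm (X n) \<le> C" by (rule BseqE) blast
  have "(\<lambda>n. inverse (X n)) \<longlonglongrightarrow> inverse L" using assms by (intro tendsto_intros) auto
  then have "Bseq (\<lambda>n. inverse (X n))" by (rule convergent_imp_Bseq[OF convergentI])
  then obtain D where D: "0 < D" "\<And>n. norm (inverse (X n)) \<le> D" by (rule BseqE) blast
  have "inverse D \<le> X n" for n
    using D(2)[of n] assms(3)[of n] D(1) by (metis abs_of_pos inverse_inverse_eq inverse_le_iff_le inverse_positive_iff_positive real_norm_def)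
  then show ?thesis using that[of "inverse D" C] C D abs_le_D1 by fastforce
qed

text \<open>For \<open>\<beta> \<ge> 1\<close> the last summand dominates all others; for
  \<open>\<beta> < 1\<close> the mean value theorem bounds each summand by a difference of
  values of the \<open>\<beta>\<close>-th power, and the sum telescopes.\<close>

lemma sum_powr_le:
  fixes \<beta> :: real
  assumes "\<beta> > 0"
  shows "(\<Sum>h=1..N. real h powr (\<beta> - 1)) \<le> max 1 (1 / \<beta>) * real N powr \<beta>"
proof (cases "\<beta> \<ge> 1")
  case True
  have "(\<Sum>h=1..N. real h powr (\<beta> - 1)) \<le> (\<Sum>h=1..N. real N powr (\<beta> - 1))"
    using True by (intro sum_mono powr_mono2) auto
  also have "\<dots> = real N powr \<beta>" by (cases "N = 0") (auto simp: powr_diff)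
  also have "\<dots> \<le> max 1 (1 / \<beta>) * real N powr \<beta>" using mult_right_mono[of 1 "max 1 (1 / \<beta>)" "real N powr \<beta>"] by simp
  finally show ?thesis .
next
  case False
  have "\<beta> * (\<Sum>h=1..N. real h powr (\<beta> - 1)) \<le> real N powr \<beta>"
  proof (induction N)
    case (Suc N)
    obtain \<xi> where \<xi>: "real N < \<xi>" "\<xi> < real (Suc N)"
        "real (Suc N) powr \<beta> - real N powr \<beta> = \<beta> * \<xi> powr (\<beta> - 1) * (real (Suc N) - real N)"
      using powr_mean_value[of "real N" "real (Suc N)" \<beta>] assms by auto
    have "real (Suc N) powr (\<beta> - 1) \<le> \<xi> powr (\<beta> - 1)"
      using \<xi> False by (intro powr_mono2') auto
    then have "\<beta> * real (Suc N) powr (\<beta> - 1) \<le> real (Suc N) powr \<beta> - real N powr \<beta>"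
      using \<xi> assms by simp
    then show ?case using Suc.IH by (simp add: distrib_left)
  qed simp
  then have "(\<Sum>h=1..N. real h powr (\<beta> - 1)) \<le> (1 / \<beta>) * real N powr \<beta>"
    using assms by (simp add: field_simps)
  then show ?thesis using False assms by (simp add: max_def)
qed

lemma sum_powr_tail_le:
  fixes \<beta> :: real
  assumes "\<beta> > 0" "1 \<le> N"
  shows "(\<Sum>h=Suc N..M. real h powr (- 1 - \<beta>)) \<le> real N powr (- \<beta>) / \<beta>"
proof (cases "N \<le> M")
  case True
  have "\<beta> * (\<Sum>h=Suc N..M. real h powr (- 1 - \<beta>)) \<le> real N powr (- \<beta>) - real M powr (- \<beta>)"
    using True
  proof (induction M rule: dec_induct)
    case (step M)
    have M: "M > 0" using step assms by simp
    have "\<exists>z>real M. z < real (Suc M) \<and> real (Suc M) powr (- \<beta>) - real M powr (- \<beta>) = (real (Suc M) - real M) * (- \<beta> * z powr (- \<beta> - 1))"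
      by (rule MVT2) (use M in \<open>auto intro!: derivative_eq_intros\<close>)
    then obtain z where z: "z > real M" "z < real (Suc M)"
      "real (Suc M) powr (- \<beta>) - real M powr (- \<beta>) = (real (Suc M) - real M) * (- \<beta> * z powr (- \<beta> - 1))" by blast
    have "real (Suc M) powr (- \<beta> - 1) \<le> z powr (- \<beta> - 1)"
      using z M assms by (intro powr_mono2') auto
    then have "\<beta> * real (Suc M) powr (- \<beta> - 1) \<le> \<beta> * z powr (- \<beta> - 1)"
      using assms by (intro mult_left_mono) auto
    moreover have eq: "- \<beta> - 1 = - 1 - \<beta>" by simp
    ultimately have "\<beta> * real (Suc M) powr (- 1 - \<beta>) \<le> real M powr (- \<beta>) - real (Suc M) powr (- \<beta>)"
      using z(3) unfolding eq by (simp add: algebra_simps)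
    moreover have "(\<Sum>h=Suc N..Suc M. real h powr (- 1 - \<beta>)) = (\<Sum>h=Suc N..M. real h powr (- 1 - \<beta>)) + real (Suc M) powr (- 1 - \<beta>)"
      using step by simp
    ultimately show ?case using step.IH by (simp add: distrib_left)
  qed simp
  also have "\<dots> \<le> real N powr (- \<beta>)" by simp
  finally show ?thesis using assms by (simp add: field_simps)
qed (use assms in auto)

lemma even_summable_int:
  fixes g :: "int \<Rightarrow> real"
  assumes nonneg: "\<And>z. 0 \<le> g z" and zero: "g 0 = 0" and even: "\<And>z. g (- z) = g z"
    and bound: "\<And>M. (\<Sum>h=1..M. g (int h)) \<le> B"
  shows "g summable_on UNIV" and "infsum g UNIV \<le> 2 * B"
proof -
  have fin: "sum g F \<le> 2 * B" if F: "finite F" for F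
  proof -
    obtain M :: nat where M: "\<And>z. z \<in> F \<Longrightarrow> \<bar>z\<bar> \<le> int M"
    proof -
      have "z \<in> F \<Longrightarrow> \<bar>z\<bar> \<le> int (nat (\<Sum>y\<in>F. \<bar>y\<bar>))" for z
        using member_le_sum[of z F "\<lambda>y. \<bar>y\<bar>"] F by (simp add: sum_nonneg)
      then show ?thesis using that by blast
    qed
    have "F \<subseteq> int ` {1..M} \<union> (\<lambda>h. - int h) ` {1..M} \<union> {0}"
    proof
      fix z assume z: "z \<in> F"
      consider "z = 0" | "z > 0" | "z < 0" by linarith
      then show "z \<in> int ` {1..M} \<union> (\<lambda>h. - int h) ` {1..M} \<union> {0}"
      proof cases
        case 2
        then have "z = int (nat z)" "nat z \<in> {1..M}" using M[OF z] by auto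
        then show ?thesis by blast
      next
        case 3
        then have "z = - int (nat (- z))" "nat (- z) \<in> {1..M}" using M[OF z] by auto
        then show ?thesis by blast
      qed auto
    qed
    then have "sum g F \<le> sum g (int ` {1..M} \<union> (\<lambda>h. - int h) ` {1..M} \<union> {0})"
      using nonneg by (intro sum_mono2) auto
    also have "\<dots> \<le> sum g (int ` {1..M}) + sum g ((\<lambda>h. - int h) ` {1..M}) + sum g {0}"
    proof -
      have un: "sum g (A \<union> B) \<le> sum g A + sum g B" if "finite A" "finite B" for A B
        using sum.union_inter[OF that, of g] sum_nonneg[of "A \<inter> B" g] nonneg by simp
      show ?thesis by (intro order_trans[OF un] add_mono un) auto
    qed
    also have "\<dots> = 2 * (\<Sum>h=1..M. g (int h))"
      by (simp add: sum.reindex inj_on_def even zero)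
    finally show ?thesis using bound[of M] by simp
  qed
  show s: "g summable_on UNIV"
    by (rule nonneg_bdd_above_summable_on) (use nonneg fin in \<open>auto intro!: bdd_aboveI2\<close>)
  show "infsum g UNIV \<le> 2 * B"
    by (rule infsum_le_finite_sums[OF s]) (use fin in auto)
qed

lemma sum_inverse_le_ln: "(\<Sum>i<M. 1 / (1 + real i)) \<le> 2 * ln (1 + real M)"
proof (induction M)
  case (Suc M)
  have "1 / (2 + real M) \<le> ln (1 + real (Suc M)) - ln (1 + real M)"
    using ln_diff_le[of "1 + real M" "1 + real (Suc M)"] by (simp add: field_simps)
  moreover have "1 / (1 + real M) \<le> 2 * (1 / (2 + real M))" by (simp add: field_simps)
  ultimately show ?case using Suc.IH by simp
qed simp

lemma sum_symmetric_interval: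
  fixes F :: "nat \<Rightarrow> real"
  assumes "h \<le> n"
  shows "sum F {n - h..n + h} = F n + (\<Sum>m=1..h. F (n + m) + F (n - m))"
  using assms
proof (induction h)
  case (Suc h)
  have "{n - Suc h..n + Suc h} = insert (n - Suc h) (insert (n + Suc h) {n - h..n + h})"
    using Suc.prems by auto
  moreover have "n - Suc h \<notin> insert (n + Suc h) {n - h..n + h}" "n + Suc h \<notin> {n - h..n + h}"
    using Suc.prems by auto
  ultimately have "sum F {n - Suc h..n + Suc h} = F (n - Suc h) + (F (n + Suc h) + sum F {n - h..n + h})"
    by simp
  then show ?case using Suc by simp
qed simp

lemma has_sum_finite_rows:
  fixes g :: "'a \<Rightarrow> 'b \<Rightarrow> real"
  assumes "finite F" "\<And>x. x \<in> F \<Longrightarrow> (g x has_sum s x) UNIV"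
  shows "((\<lambda>(x, y). if x \<in> F then g x y else 0) has_sum (\<Sum>x\<in>F. s x)) UNIV"
  using assms
proof (induction F rule: finite_induct)
  case (insert a F)
  have "((\<lambda>(x, y). g x y) has_sum s a) (Pair a ` UNIV)"
    using insert.prems[of a] by (subst has_sum_reindex) (auto simp: inj_on_def o_def)
  then have "((\<lambda>(x, y). if x = a then g x y else 0) has_sum s a) UNIV"
    by (rule has_sum_cong_neutral[THEN iffD1, rotated -1]) auto
  then have "((\<lambda>z. (case z of (x, y) \<Rightarrow> if x = a then g x y else 0) +
      (case z of (x, y) \<Rightarrow> if x \<in> F then g x y else 0)) has_sum s a + (\<Sum>x\<in>F. s x)) UNIV"
    using insert by (intro has_sum_add) auto
  also have "(\<lambda>z. (case z of (x, y) \<Rightarrow> if x = a then g x y else 0) +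
      (case z of (x, y) \<Rightarrow> if x \<in> F then g x y else 0)) = (\<lambda>(x, y). if x \<in> insert a F then g x y else 0)"
    using insert.hyps by (auto simp: fun_eq_iff)
  finally show ?case using insert.hyps by simp
qed (simp add: has_sum_0)

lemma has_sum_swap_pairs:
  fixes f :: "'a \<times> 'a \<Rightarrow> real"
  assumes "(f has_sum s) UNIV"
  shows "((\<lambda>(x, y). f (y, x)) has_sum s) UNIV"
proof -
  have "(f has_sum s) (prod.swap ` UNIV)" using assms by simp
  then have "((f \<circ> prod.swap) has_sum s) UNIV" by (subst (asm) has_sum_reindex) auto
  also have "f \<circ> prod.swap = (\<lambda>(x, y). f (y, x))" by auto
  finally show ?thesis .
qed

lemma has_sum_difference:
  fixes f g :: "'a \<Rightarrow> real"
  assumes "(f has_sum a) A" "(g has_sum b) A"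
  shows "((\<lambda>x. f x - g x) has_sum a - b) A"
  using has_sum_add[OF assms(1) has_sum_uminusI[OF assms(2)]] by simp

text \<open>Folding a sum over the integers onto the positive integers, for use with series
  indexed by natural numbers.\<close>

lemma has_sum_int_split:
  fixes f :: "int \<Rightarrow> real"
  assumes f: "(f has_sum s) UNIV"
  defines "V \<equiv> \<lambda>j::nat. if j = 0 then 0 else f (int j) + f (- int j)"
  shows "V sums (s - f 0)" and "summable (\<lambda>j. \<bar>V j\<bar>)"
proof -
  have sub: "f summable_on A" for A
    using has_sum_imp_summable[OF f] by (rule summable_on_subset_banach) simp
  define P where "P = int ` {1..}"
  define N where "N = (\<lambda>j. - int j) ` {1..}"
  have un: "UNIV = insert 0 (P \<union> N)"
  proof -
    have "z \<in> insert 0 (P \<union> N)" for z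
    proof -
      consider "z = 0" | "z > 0" | "z < 0" by linarith
      then show ?thesis
      proof cases
        case 2
        then have "z = int (nat z)" "nat z \<in> {1..}" by auto
        then show ?thesis unfolding P_def by blast
      next
        case 3
        then have "z = - int (nat (- z))" "nat (- z) \<in> {1..}" by auto
        then show ?thesis unfolding N_def by blast
      qed simp
    qed
    then show ?thesis by blast
  qed
  have "s = infsum f UNIV" using f by (simp add: infsumI)
  also have "\<dots> = infsum f ({0} \<union> (P \<union> N))" using un by simp
  also have "\<dots> = infsum f {0} + infsum f (P \<union> N)"
    by (rule infsum_Un_disjoint[OF sub sub]) (auto simp: P_def N_def)
  also have "infsum f (P \<union> N) = infsum f P + infsum f N"
    by (rule infsum_Un_disjoint[OF sub sub]) (auto simp: P_def N_def)
  finally have s: "s - f 0 = infsum f P + infsum f N" by simp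
  have "((f \<circ> int) has_sum infsum f P) {1..}"
    using has_sum_infsum[OF sub[of P]] unfolding P_def by (subst (asm) has_sum_reindex) (auto simp: inj_on_def)
  moreover have "((f \<circ> (\<lambda>j. - int j)) has_sum infsum f N) {1..}"
    using has_sum_infsum[OF sub[of N]] unfolding N_def by (subst (asm) has_sum_reindex) (auto simp: inj_on_def)
  ultimately have "((\<lambda>j. (f \<circ> int) j + (f \<circ> (\<lambda>j. - int j)) j) has_sum s - f 0) {1..}"
    unfolding s by (rule has_sum_add)
  then have V: "(V has_sum s - f 0) UNIV"
    by (rule has_sum_cong_neutral[THEN iffD1, rotated -1]) (auto simp: V_def)
  then show "V sums (s - f 0)" by (rule has_sum_imp_sums)
  have "(\<lambda>j. norm (V j)) summable_on UNIV"
    by (rule summable_on_iff_abs_summable_on_real[THEN iffD1, OF has_sum_imp_summable[OF V]])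
  then show "summable (\<lambda>j. \<bar>V j\<bar>)" using summable_on_imp_summable[of "\<lambda>j. \<bar>V j\<bar>"] by simp
qed

lemma signed_powr_divide:
  assumes "0 < c"
  shows "signed_powr (t / c) r = signed_powr t r / c powr r"
  using assms by (auto simp: signed_powr_def powr_divide sgn_divide abs_divide)

section \<open>The ground state representation and criticality\<close>

locale kappa_graph =
  fixes p \<sigma> :: real
  assumes p: "1 < p" and \<sigma>: "0 < \<sigma>" "\<sigma> < 1 / p"
begin

abbreviation k :: "int \<Rightarrow> real" where "k \<equiv> kappa p \<sigma>"

text \<open>The decay exponent of the kernel: \<open>k z\<close> is of order
  \<open>\<bar>z\<bar>\<close> to the power \<open>- 1 - S\<close>.\<close>

definition S :: real where "S = p * \<sigma>"

lemma S: "0 < S" "S < 1"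
  using p \<sigma> by (auto simp: S_def field_simps)

lemma k_0 [simp]: "k 0 = 0"
  using kappa_positive_order_facts(1)[of p \<sigma>] S by (simp add: S_def)

lemma k_minus [simp]: "k (- z) = k z"
  by (rule kappa_minus)

lemma k_commute: "k (x - y) = k (y - x)"
  using k_minus[of "x - y"] by simp

lemma k_rec: "(real n + 2 + S / 2) * k (int (Suc (Suc n))) = (real n + 1 - S / 2) * k (int (Suc n))"
  using kappa_positive_order_facts(3)[of p \<sigma> "int (Suc n)"] S by (simp add: S_def add_ac)

lemma k_Suc_pos: "0 < k (int (Suc n))"
proof (induction n)
  case 0
  then show ?case using kappa_positive_order_facts(2)[of p \<sigma>] S by (simp add: S_def)
next
  case (Suc n)
  have "0 < (real n + 1 - S / 2) * k (int (Suc n))" using Suc S by (intro mult_pos_pos) auto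
  then have "0 < (real n + 2 + S / 2) * k (int (Suc (Suc n)))" by (simp only: k_rec)
  then show ?case using S by (simp add: zero_less_mult_iff)
qed

lemma k_pos: "z \<noteq> 0 \<Longrightarrow> 0 < k z"
proof (cases "0 < z")
  case True
  then have "z = int (Suc (nat (z - 1)))" by simp
  then show ?thesis using k_Suc_pos by metis
next
  case False
  moreover assume "z \<noteq> 0"
  ultimately have "- z = int (Suc (nat (- z - 1)))" by simp
  then show ?thesis using k_Suc_pos k_minus by metis
qed

lemma k_nonneg: "0 \<le> k z"
  using k_pos[of z] by (cases "z = 0") auto

lemma k_asymptotics:
  obtains L where "0 < L" "(\<lambda>n. k (int n) * real n powr (1 + S)) \<longlonglongrightarrow> L"
proof -
  obtain L where L: "0 < L" "(\<lambda>n. k (int (Suc n)) * real n powr ((2 + S / 2) - (1 - S / 2))) \<longlonglongrightarrow> L"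
  proof (rule gamma_ratio_asymptotics[of "1 - S / 2" "2 + S / 2" "\<lambda>n. k (int (Suc n))"])
    show "(real n + (2 + S / 2)) * k (int (Suc (Suc n))) = (real n + (1 - S / 2)) * k (int (Suc n))" for n
      using k_rec[of n] by (simp only: add.assoc add_diff_eq)
  qed (use S k_Suc_pos[of 0] in auto)
  have "(\<lambda>n. k (int (Suc n)) * real (Suc n) powr (1 + S)) \<longlonglongrightarrow> L"
    using power_asymptotics_shift[OF L(2)] by (simp add: algebra_simps)
  then have "(\<lambda>n. k (int n) * real n powr (1 + S)) \<longlonglongrightarrow> L" by (rule LIMSEQ_imp_Suc)
  then show ?thesis using that L by blast
qed

lemma k_upper:
  obtains C where "0 < C" "\<And>n. n \<ge> 1 \<Longrightarrow> k (int n) \<le> C * real n powr (- 1 - S)"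
proof -
  obtain L where L: "0 < L" "(\<lambda>n. k (int n) * real n powr (1 + S)) \<longlonglongrightarrow> L"
    by (rule k_asymptotics)
  have lim: "(\<lambda>n. k (int (Suc n)) * real (Suc n) powr (1 + S)) \<longlonglongrightarrow> L"
    using L(2) by (rule LIMSEQ_Suc)
  have pos: "0 < k (int (Suc n)) * real (Suc n) powr (1 + S)" for n
    using k_Suc_pos[of n] by (intro mult_pos_pos) auto
  obtain C where C: "0 < C" "\<And>n. k (int (Suc n)) * real (Suc n) powr (1 + S) \<le> C"
    by (rule positive_sequence_bounds[OF lim L(1) pos]) (rule that)
  have "k (int n) \<le> C * real n powr (- 1 - S)" if n: "n \<ge> 1" for n
  proof -
    obtain m where m: "n = Suc m" using n by (cases n) auto
    have "real n powr (- 1 - S) = inverse (real n powr (1 + S))"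
      using powr_minus[of "real n" "1 + S"] by simp
    moreover have "k (int n) * real n powr (1 + S) * inverse (real n powr (1 + S)) \<le> C * inverse (real n powr (1 + S))"
      using C(2)[of m] unfolding m[symmetric] by (intro mult_right_mono) auto
    moreover have "k (int n) * real n powr (1 + S) * inverse (real n powr (1 + S)) = k (int n)"
      using n by simp
    ultimately show ?thesis by simp
  qed
  then show ?thesis using that C by blast
qed

lemma k_summable: "k summable_on UNIV"
proof -
  obtain C where C: "0 < C" "\<And>n. n \<ge> 1 \<Longrightarrow> k (int n) \<le> C * real n powr (- 1 - S)"
    using k_upper by blast
  have "(\<Sum>h=1..M. k (int h)) \<le> C + C * (1 / S)" for M
  proof (cases "M \<ge> 1")
    case True
    have "(\<Sum>h=1..M. k (int h)) \<le> (\<Sum>h=1..M. C * real h powr (- 1 - S))"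
      by (intro sum_mono C) auto
    also have "\<dots> = C * 1 + C * (\<Sum>h=Suc 1..M. real h powr (- 1 - S))"
      using True by (simp add: sum.atLeast_Suc_atMost sum_distrib_left)
    also have "\<dots> \<le> C + C * (1 / S)"
      using sum_powr_tail_le[of S 1 M] S C by (intro add_mono mult_left_mono) auto
    finally show ?thesis .
  qed (use C S in simp)
  then show ?thesis by (rule even_summable_int(1)[rotated -1]) (auto simp: k_nonneg)
qed

lemma k_shift_summable: "(\<lambda>y. k (x - y)) summable_on UNIV"
proof -
  have "bij_betw (\<lambda>y. x - y) UNIV UNIV" by (rule bij_betwI[of _ _ _ "\<lambda>y. x - y"]) auto
  then show ?thesis using summable_on_reindex_bij_betw[of "\<lambda>y. x - y" UNIV UNIV k] k_summable by simp
qed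

lemma bounded_in_formal_domain:
  assumes "\<And>x. \<bar>f x\<bar> \<le> B"
  shows "f \<in> formal_domain p \<sigma>"
  unfolding formal_domain_def
proof (intro CollectI allI)
  fix x
  have "(\<lambda>y. k (x - y) * (2 * B) powr (p - 1)) summable_on UNIV"
    by (intro summable_on_cmult_left k_shift_summable)
  moreover have "k (x - y) * \<bar>f x - f y\<bar> powr (p - 1) \<le> k (x - y) * (2 * B) powr (p - 1)" for y
  proof -
    have "\<bar>f x - f y\<bar> \<le> 2 * B" using assms[of x] assms[of y] by linarith
    then show ?thesis using p by (intro mult_left_mono powr_mono2 k_nonneg) auto
  qed
  ultimately show "(\<lambda>y. k (x - y) * \<bar>f x - f y\<bar> powr (p - 1)) summable_on UNIV"
    by (rule summable_on_comparison_test) (auto simp: k_nonneg)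
qed

lemma frac_p_laplace_has_sum:
  assumes "f \<in> formal_domain p \<sigma>"
  shows "((\<lambda>y. k (x - y) * signed_powr (f x - f y) (p - 1)) has_sum frac_p_laplace p \<sigma> f x) UNIV"
proof -
  have "(\<lambda>y. k (x - y) * \<bar>f x - f y\<bar> powr (p - 1)) summable_on UNIV"
    using assms by (auto simp: formal_domain_def)
  then have "(\<lambda>y. norm (k (x - y) * signed_powr (f x - f y) (p - 1))) summable_on UNIV"
    by (simp add: abs_mult k_nonneg)
  then show ?thesis
    unfolding frac_p_laplace_def by (rule has_sum_infsum[OF abs_summable_summable])
qed

text \<open>A summand can only be nonzero if one of the two sites lies in the finite support,
  and the kernel is summable in the other site.\<close>

lemma p_energy_summable:
  assumes fin: "finite {x. \<phi> x \<noteq> 0}"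
  shows "(\<lambda>(x, y). k (x - y) * \<bar>\<phi> x - \<phi> y\<bar> powr p) summable_on UNIV"
proof -
  define F where "F = {x. \<phi> x \<noteq> 0}"
  define B where "B = (\<Sum>x\<in>F. \<bar>\<phi> x\<bar>)"
  have B: "\<bar>\<phi> x\<bar> \<le> B" for x
  proof (cases "x \<in> F")
    case True
    then show ?thesis using fin unfolding B_def F_def by (intro member_le_sum) auto
  next
    case False
    then show ?thesis by (simp add: F_def B_def sum_nonneg)
  qed
  define D where "D = (2 * B) powr p"
  have h: "((\<lambda>(x, y). if x \<in> F then k (x - y) * D else 0) has_sum (\<Sum>x\<in>F. infsum (\<lambda>y. k (x - y) * D) UNIV)) UNIV"
    using fin unfolding F_def
    by (intro has_sum_finite_rows has_sum_infsum summable_on_cmult_left k_shift_summable) auto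
  have "(\<lambda>(x, y). (\<lambda>(x, y). if x \<in> F then k (x - y) * D else 0) (y, x)) =
      (\<lambda>(x, y). if y \<in> F then k (x - y) * D else 0)"
    using k_commute by (intro ext) auto
  then have "(\<lambda>z. (case z of (x, y) \<Rightarrow> if x \<in> F then k (x - y) * D else 0)
      + (case z of (x, y) \<Rightarrow> if y \<in> F then k (x - y) * D else 0)) summable_on UNIV"
    using has_sum_imp_summable[OF h] has_sum_imp_summable[OF has_sum_swap_pairs[OF h]]
    by (intro summable_on_add) simp_all
  then show ?thesis
  proof (rule summable_on_comparison_test)
    fix z :: "int \<times> int"
    obtain x y where z: "z = (x, y)" by (cases z)
    have "\<bar>\<phi> x - \<phi> y\<bar> \<le> 2 * B" using B[of x] B[of y] by linarith
    then have "\<bar>\<phi> x - \<phi> y\<bar> powr p \<le> D" unfolding D_def using p by (intro powr_mono2) auto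
    then have *: "k (x - y) * \<bar>\<phi> x - \<phi> y\<bar> powr p \<le> k (x - y) * D" by (intro mult_left_mono k_nonneg)
    define KD where "KD = k (x - y) * D"
    have D: "0 \<le> KD" by (simp add: D_def KD_def k_nonneg)
    show "(case z of (x, y) \<Rightarrow> k (x - y) * \<bar>\<phi> x - \<phi> y\<bar> powr p)
       \<le> (case z of (x, y) \<Rightarrow> if x \<in> F then k (x - y) * D else 0)
      + (case z of (x, y) \<Rightarrow> if y \<in> F then k (x - y) * D else 0)"
      using * D unfolding z F_def by (auto simp: KD_def[symmetric])
    show "0 \<le> (case z of (x, y) \<Rightarrow> k (x - y) * \<bar>\<phi> x - \<phi> y\<bar> powr p)"
      unfolding z by (simp add: k_nonneg)
  qed
qed

text \<open>Green's formula. The second part of the gap is the sum of a term with \<open>\<phi>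
  x\<close> and a term with \<open>\<phi> y\<close>. The antisymmetry of the signed power makes
  them images of one another under the exchange of \<open>x\<close> and \<open>y\<close>, so
  both sum up to the pairing of \<open>\<bar>\<phi>\<bar>\<^sup>p /
  v\<^sup>p\<^sup>-\<^sup>1\<close> with the \<open>p\<close>-Laplacian of
  \<open>v\<close>.\<close>

theorem ground_state_representation:
  assumes v: "\<And>x. 0 < v x" "v \<in> formal_domain p \<sigma>" and fin: "finite {x. \<phi> x \<noteq> 0}"
  shows "((\<lambda>(x, y). k (x - y) * picone_gap p (v x) (v y) (\<phi> x) (\<phi> y)) has_sum
     2 * (p_energy p \<sigma> \<phi> - (\<Sum>x | \<phi> x \<noteq> 0. \<bar>\<phi> x\<bar> powr p / v x powr (p - 1) * frac_p_laplace p \<sigma> v x))) UNIV"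
proof -
  define F where "F = {x. \<phi> x \<noteq> 0}"
  define \<psi> where "\<psi> = (\<lambda>x. \<bar>\<phi> x\<bar> powr p / v x powr (p - 1))"
  define s where "s = (\<Sum>x\<in>F. \<psi> x * frac_p_laplace p \<sigma> v x)"
  define N where "N = (\<lambda>(x, y). \<psi> x * (k (x - y) * signed_powr (v x - v y) (p - 1)))"
  have "((\<lambda>(x, y). if x \<in> F then \<psi> x * (k (x - y) * signed_powr (v x - v y) (p - 1)) else 0) has_sum s) UNIV"
    unfolding s_def using fin v(2) unfolding F_def
    by (intro has_sum_finite_rows has_sum_cmult_right frac_p_laplace_has_sum) auto
  also have "(\<lambda>(x, y). if x \<in> F then \<psi> x * (k (x - y) * signed_powr (v x - v y) (p - 1)) else 0) = N"
    by (auto simp: N_def F_def \<psi>_def fun_eq_iff)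
  finally have N: "(N has_sum s) UNIV" .
  have "((\<lambda>(x, y). k (x - y) * \<bar>\<phi> x - \<phi> y\<bar> powr p) has_sum 2 * p_energy p \<sigma> \<phi>) UNIV"
    using has_sum_infsum[OF p_energy_summable[OF fin]] by (simp add: p_energy_def)
  then have "((\<lambda>z. (case z of (x, y) \<Rightarrow> k (x - y) * \<bar>\<phi> x - \<phi> y\<bar> powr p)
      - (N z + (case z of (x, y) \<Rightarrow> N (y, x)))) has_sum 2 * p_energy p \<sigma> \<phi> - (s + s)) UNIV"
    using N has_sum_swap_pairs[OF N] by (intro has_sum_difference has_sum_add)
  also have "(\<lambda>z. (case z of (x, y) \<Rightarrow> k (x - y) * \<bar>\<phi> x - \<phi> y\<bar> powr p)
      - (N z + (case z of (x, y) \<Rightarrow> N (y, x)))) =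
      (\<lambda>(x, y). k (x - y) * picone_gap p (v x) (v y) (\<phi> x) (\<phi> y))"
  proof (intro ext, clarify)
    fix x y
    have "signed_powr (v y - v x) (p - 1) = - signed_powr (v x - v y) (p - 1)"
      using signed_powr_minus[of "v x - v y" "p - 1"] by simp
    then show "k (x - y) * \<bar>\<phi> x - \<phi> y\<bar> powr p - (N (x, y) + N (y, x)) =
        k (x - y) * picone_gap p (v x) (v y) (\<phi> x) (\<phi> y)"
      by (simp add: N_def \<psi>_def picone_gap_def k_commute[of y x] algebra_simps)
  qed
  finally show ?thesis by (simp add: s_def \<psi>_def F_def)
qed

lemma infsum_weighted_power:
  assumes "finite {x. \<phi> x \<noteq> 0}"
  shows "(\<Sum>\<^sub>\<infinity>x. w x * \<bar>\<phi> x\<bar> powr p) = (\<Sum>x | \<phi> x \<noteq> 0. w x * \<bar>\<phi> x\<bar> powr p)"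
proof -
  have "infsum (\<lambda>x. w x * \<bar>\<phi> x\<bar> powr p) {x. \<phi> x \<noteq> 0} = infsum (\<lambda>x. w x * \<bar>\<phi> x\<bar> powr p) UNIV"
    by (intro infsum_cong_neutral) simp_all
  then show ?thesis by (simp only: infsum_finite[OF assms])
qed

lemma supersolution_sum_le:
  assumes v: "positive_supersolution p \<sigma> w v" and fin: "finite {x. \<phi> x \<noteq> 0}"
  shows "(\<Sum>\<^sub>\<infinity>x. w x * \<bar>\<phi> x\<bar> powr p) \<le> (\<Sum>x | \<phi> x \<noteq> 0. \<bar>\<phi> x\<bar> powr p / v x powr (p - 1) * frac_p_laplace p \<sigma> v x)"
  unfolding infsum_weighted_power[OF fin]
proof (rule sum_mono)
  fix x
  have vx: "v x > 0" "w x * v x powr (p - 1) \<le> frac_p_laplace p \<sigma> v x"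
    using v by (auto simp: positive_supersolution_def)
  have "\<bar>\<phi> x\<bar> powr p / v x powr (p - 1) * (w x * v x powr (p - 1)) \<le> \<bar>\<phi> x\<bar> powr p / v x powr (p - 1) * frac_p_laplace p \<sigma> v x"
    using vx by (intro mult_left_mono) auto
  then show "w x * \<bar>\<phi> x\<bar> powr p \<le> \<bar>\<phi> x\<bar> powr p / v x powr (p - 1) * frac_p_laplace p \<sigma> v x"
    using vx by (simp add: mult.commute)
qed

text \<open>A single summand of the ground state representation is at most the whole sum, as all
  summands are nonnegative.\<close>

lemma picone_gap_le_hardy_deficit:
  assumes v: "positive_supersolution p \<sigma> w v" and fin: "finite {x. \<phi> x \<noteq> 0}"
  shows "k (x - y) * picone_gap p (v x) (v y) (\<phi> x) (\<phi> y)
    \<le> 2 * (p_energy p \<sigma> \<phi> - (\<Sum>\<^sub>\<infinity>x. w x * \<bar>\<phi> x\<bar> powr p))"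
proof -
  have v': "\<And>x. 0 < v x" "v \<in> formal_domain p \<sigma>" using v by (auto simp: positive_supersolution_def)
  have "sum (\<lambda>(x, y). k (x - y) * picone_gap p (v x) (v y) (\<phi> x) (\<phi> y)) {(x, y)} \<le>
    2 * (p_energy p \<sigma> \<phi> - (\<Sum>x | \<phi> x \<noteq> 0. \<bar>\<phi> x\<bar> powr p / v x powr (p - 1) * frac_p_laplace p \<sigma> v x))"
    by (rule finite_sum_le_has_sum[OF ground_state_representation[OF v' fin]])
       (auto intro!: mult_nonneg_nonneg k_nonneg picone_gap_nonneg p v')
  then show ?thesis using supersolution_sum_le[OF v fin] by simp
qed

lemma hardy_type_weight_of_supersolution:
  assumes v: "positive_supersolution p \<sigma> w v"
  shows "hardy_type_weight p \<sigma> w"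
  unfolding hardy_type_weight_def
proof (intro allI impI)
  fix \<phi> :: "int \<Rightarrow> real" assume fin: "finite {x. \<phi> x \<noteq> 0}"
  show "(\<Sum>\<^sub>\<infinity>x. w x * \<bar>\<phi> x\<bar> powr p) \<le> p_energy p \<sigma> \<phi>"
    using picone_gap_le_hardy_deficit[OF v fin, of 0 0] by simp
qed

text \<open>A larger Hardy-type weight would keep the deficit away from 0 by its surplus at one
  site. For a further supersolution \<open>v\<close>, the gap of \<open>u\<close> relative to
  \<open>v\<close> is a limit of terms dominated by the deficit, hence 0 on all edges, and
  strictness in Picone's inequality gives proportionality.\<close>

theorem critical_of_null_sequence:
  assumes u: "positive_supersolution p \<sigma> w u"
    and fin: "\<And>n. finite {x. \<phi> n x \<noteq> 0}"
    and lim: "\<And>x. (\<lambda>n. \<phi> n x) \<longlonglongrightarrow> u x"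
    and null: "(\<lambda>n. p_energy p \<sigma> (\<phi> n) - (\<Sum>\<^sub>\<infinity>x. w x * \<bar>\<phi> n x\<bar> powr p)) \<longlonglongrightarrow> 0"
  shows "p_critical p \<sigma> w" and "agmon_ground_state p \<sigma> w u"
proof -
  have upos: "u x > 0" for x using u by (simp add: positive_supersolution_def)
  have lim_powr: "(\<lambda>n. \<bar>\<phi> n x\<bar> powr p) \<longlonglongrightarrow> u x powr p" for x
    using upos[of x] tendsto_powr[OF tendsto_rabs[OF lim[of x]] tendsto_const[of p]] by simp
  show "p_critical p \<sigma> w"
    unfolding p_critical_def
  proof (intro conjI notI)
    show "hardy_type_weight p \<sigma> w" using u by (rule hardy_type_weight_of_supersolution)
    assume "\<exists>w'. hardy_type_weight p \<sigma> w' \<and> (\<forall>x. w x \<le> w' x) \<and> w' \<noteq> w"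
    then obtain w' where w': "hardy_type_weight p \<sigma> w'" "\<And>x. w x \<le> w' x" "w' \<noteq> w" by auto
    then obtain x0 where "w' x0 \<noteq> w x0" by (auto simp: fun_eq_iff)
    with w'(2)[of x0] have gt: "w' x0 > w x0" by simp
    have le: "(w' x0 - w x0) * \<bar>\<phi> n x0\<bar> powr p \<le> p_energy p \<sigma> (\<phi> n) - (\<Sum>\<^sub>\<infinity>x. w x * \<bar>\<phi> n x\<bar> powr p)" for n
    proof -
      have "(w' x0 - w x0) * \<bar>\<phi> n x0\<bar> powr p \<le> (\<Sum>x | \<phi> n x \<noteq> 0. (w' x - w x) * \<bar>\<phi> n x\<bar> powr p)"
      proof (cases "\<phi> n x0 = 0")
        case True
        then show ?thesis using w'(2) by (auto intro!: sum_nonneg)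
      next
        case False
        then show ?thesis using w'(2) fin[of n]
          by (intro member_le_sum[of x0 "{x. \<phi> n x \<noteq> 0}" "\<lambda>x. (w' x - w x) * \<bar>\<phi> n x\<bar> powr p"]) auto
      qed
      also have "\<dots> = (\<Sum>\<^sub>\<infinity>x. w' x * \<bar>\<phi> n x\<bar> powr p) - (\<Sum>\<^sub>\<infinity>x. w x * \<bar>\<phi> n x\<bar> powr p)"
        unfolding infsum_weighted_power[OF fin] by (simp add: sum_subtractf left_diff_distrib)
      also have "\<dots> \<le> p_energy p \<sigma> (\<phi> n) - (\<Sum>\<^sub>\<infinity>x. w x * \<bar>\<phi> n x\<bar> powr p)"
        using w'(1) fin[of n] by (auto simp: hardy_type_weight_def)
      finally show ?thesis .
    qed
    have "(w' x0 - w x0) * u x0 powr p \<le> 0"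
      by (rule LIMSEQ_le[OF tendsto_mult_left[OF lim_powr] null]) (use le in auto)
    then show False using gt upos[of x0] by (simp add: mult_le_0_iff)
  qed
  show "agmon_ground_state p \<sigma> w u"
    unfolding agmon_ground_state_def
  proof (intro conjI allI impI u)
    fix v assume v: "positive_supersolution p \<sigma> w v"
    have vpos: "v x > 0" for x using v by (simp add: positive_supersolution_def)
    have ratio: "u x * v y = u y * v x" for x y
    proof (cases "x = y")
      case False
      have "(\<lambda>n. k (x - y) * picone_gap p (v x) (v y) (\<phi> n x) (\<phi> n y)) \<longlonglongrightarrow>
          k (x - y) * picone_gap p (v x) (v y) (u x) (u y)"
        unfolding picone_gap_def using lim_powr[of x] lim_powr[of y] upos vpos[of x] vpos[of y] p
        by (intro tendsto_intros lim tendsto_powr') (auto simp: less_imp_le)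
      moreover have "(\<lambda>n. 2 * (p_energy p \<sigma> (\<phi> n) - (\<Sum>\<^sub>\<infinity>x. w x * \<bar>\<phi> n x\<bar> powr p))) \<longlonglongrightarrow> 2 * 0"
        by (intro tendsto_mult_left null)
      ultimately have "k (x - y) * picone_gap p (v x) (v y) (u x) (u y) \<le> 2 * 0"
        by (rule LIMSEQ_le) (use picone_gap_le_hardy_deficit[OF v fin] in auto)
      then have "picone_gap p (v x) (v y) (u x) (u y) \<le> 0"
        using k_pos[of "x - y"] False by (simp add: mult_le_0_iff)
      then show ?thesis
        using picone_gap_nonneg_strict(2)[OF p vpos[of x] vpos[of y], of "u x" "u y"] upos
        by (force simp: less_imp_le)
    qed simp
    have "v x = (v 0 / u 0) * u x" for x
      using ratio[of x 0] upos[of 0] by (simp add: field_simps)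
    moreover have "v 0 / u 0 > 0" using upos vpos by simp
    ultimately show "\<exists>c>0. \<forall>x. v x = c * u x" by blast
  qed
qed

end

section \<open>The ground state and its null sequence\<close>

locale hardy_pair = kappa_graph +
  fixes q \<alpha> :: real
  assumes q: "1 < q" and \<alpha>: "0 < \<alpha>" "\<alpha> < 1 / q"
begin

abbreviation u :: "int \<Rightarrow> real" where "u \<equiv> kappa q (- \<alpha>)"

text \<open>The decay exponent of the ground state: \<open>u x\<close> is of order
  \<open>\<bar>x\<bar>\<close> to the power \<open>- \<gamma>\<close>.\<close>

definition \<gamma> :: real where "\<gamma> = 1 - q * \<alpha>"

lemma \<gamma>: "0 < \<gamma>" "\<gamma> < 1"
  using q \<alpha> by (auto simp: \<gamma>_def field_simps)

lemma u_minus [simp]: "u (- z) = u z"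
  by (rule kappa_minus)

lemma u_abs: "u z = u (int (nat \<bar>z\<bar>))"
  by (cases "0 \<le> z") auto

lemma u_rec: "(real n + (1 + \<gamma>) / 2) * u (int (Suc n)) = (real n + (1 - \<gamma>) / 2) * u (int n)"
  using kappa_negative_order_facts(2)[of q \<alpha> "int n"] \<gamma> by (simp add: \<gamma>_def field_simps)

lemma u_coeff_pos: "0 < real n + (1 + \<gamma>) / 2" "0 < real n + (1 - \<gamma>) / 2"
  using \<gamma> by (auto intro!: add_nonneg_pos)

lemma u_nat_pos: "0 < u (int n)"
proof (induction n)
  case 0
  then show ?case using kappa_negative_order_facts(1)[of q \<alpha>] \<gamma> by (simp add: \<gamma>_def)
next
  case (Suc n)
  have "0 < (real n + (1 - \<gamma>) / 2) * u (int n)" using Suc u_coeff_pos(2) by (intro mult_pos_pos)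
  then have "0 < (real n + (1 + \<gamma>) / 2) * u (int (Suc n))" by (simp only: u_rec)
  then show ?case using u_coeff_pos(1)[of n] zero_less_mult_pos by blast
qed

lemma u_pos: "0 < u z"
  using u_nat_pos u_abs by metis

lemma u_step: "u (int n) - u (int (Suc n)) = \<gamma> * u (int n) / (real n + (1 + \<gamma>) / 2)"
proof -
  have D: "real n + (1 + \<gamma>) / 2 > 0" by (rule u_coeff_pos)
  have "(u (int n) - u (int (Suc n))) * (real n + (1 + \<gamma>) / 2) =
     (real n + (1 + \<gamma>) / 2) * u (int n) - (real n + (1 - \<gamma>) / 2) * u (int n)"
    unfolding u_rec[symmetric] by (simp add: algebra_simps)
  also have "\<dots> = \<gamma> * u (int n)" by (simp add: field_simps)
  finally show ?thesis using D by (simp add: eq_divide_eq)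
qed

lemma u_Suc_less: "u (int (Suc n)) < u (int n)"
proof -
  have "0 < \<gamma> * u (int n) / (real n + (1 + \<gamma>) / 2)"
    using \<gamma> by (intro divide_pos_pos mult_pos_pos u_pos u_coeff_pos)
  then show ?thesis using u_step[of n] by simp
qed

lemma u_nat_antimono: "i \<le> j \<Longrightarrow> u (int j) \<le> u (int i)"
  using lift_Suc_antimono_le[of "\<lambda>n. u (int n)" i j] u_Suc_less by (simp add: less_imp_le)

lemma u_antimono: "\<bar>x\<bar> \<le> \<bar>y\<bar> \<Longrightarrow> u y \<le> u x"
  using u_nat_antimono[of "nat \<bar>x\<bar>" "nat \<bar>y\<bar>"] u_abs[of x] u_abs[of y] by simp

lemma u_less_at_0:
  assumes "y \<noteq> 0"
  shows "u y < u 0"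
proof -
  have "1 \<le> nat \<bar>y\<bar>" using assms by simp
  then show ?thesis using u_nat_antimono[of 1 "nat \<bar>y\<bar>"] u_abs[of y] u_Suc_less[of 0] by simp
qed

lemma u_in_formal_domain: "u \<in> formal_domain p \<sigma>"
  using u_antimono[of 0] u_pos by (intro bounded_in_formal_domain[of _ "u 0"]) (simp add: less_imp_le)

lemma u_asymptotics:
  obtains L where "0 < L" "(\<lambda>n. u (int n) * real n powr \<gamma>) \<longlonglongrightarrow> L"
proof (rule gamma_ratio_asymptotics[of "(1 - \<gamma>) / 2" "(1 + \<gamma>) / 2" "\<lambda>n. u (int n)"])
  fix L assume L: "0 < L" "(\<lambda>n. u (int n) * real n powr ((1 + \<gamma>) / 2 - (1 - \<gamma>) / 2)) \<longlonglongrightarrow> L"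
  have "(1 + \<gamma>) / 2 - (1 - \<gamma>) / 2 = \<gamma>" by (simp add: field_simps)
  then show thesis using that[OF L(1)] L(2) by simp
qed (use \<gamma> u_pos u_rec in \<open>auto simp: add.commute\<close>)

lemma u_bounds:
  obtains c C where "0 < c" "0 < C" "\<And>n. c * (1 + real n) powr (- \<gamma>) \<le> u (int n)"
    "\<And>n. u (int n) \<le> C * (1 + real n) powr (- \<gamma>)"
proof -
  obtain L where L: "0 < L" "(\<lambda>n. u (int n) * real n powr \<gamma>) \<longlonglongrightarrow> L" by (rule u_asymptotics)
  have lim: "(\<lambda>n. u (int n) * real (Suc n) powr \<gamma>) \<longlonglongrightarrow> L" using L(2) by (rule power_asymptotics_shift)
  have pos: "0 < u (int n) * real (Suc n) powr \<gamma>" for n using u_pos by (intro mult_pos_pos) auto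
  obtain c C where cC: "0 < c" "0 < C" "\<And>n. c \<le> u (int n) * real (Suc n) powr \<gamma>" "\<And>n. u (int n) * real (Suc n) powr \<gamma> \<le> C"
    by (rule positive_sequence_bounds[OF lim L(1) pos]) (rule that)
  have eq: "u (int n) = u (int n) * real (Suc n) powr \<gamma> * (1 + real n) powr (- \<gamma>)" for n
    by (simp add: powr_minus field_simps)
  show ?thesis
  proof
    show "c * (1 + real n) powr (- \<gamma>) \<le> u (int n)" for n
      by (subst eq) (intro mult_right_mono cC, simp)
    show "u (int n) \<le> C * (1 + real n) powr (- \<gamma>)" for n
      by (subst eq) (intro mult_right_mono cC, simp)
  qed (fact cC)+
qed

lemma u_step_upper:
  obtains C where "0 < C" "\<And>n. u (int n) - u (int (Suc n)) \<le> C * (1 + real n) powr (- \<gamma> - 1)"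
proof -
  obtain C where C: "0 < C" "\<And>n. u (int n) \<le> C * (1 + real n) powr (- \<gamma>)" using u_bounds by metis
  have "u (int n) - u (int (Suc n)) \<le> 2 * C * (1 + real n) powr (- \<gamma> - 1)" for n
  proof -
    have "(1 + real n) / 2 \<le> real n + (1 + \<gamma>) / 2" using \<gamma> by (simp add: add_divide_distrib)
    then have "u (int n) - u (int (Suc n)) \<le> 1 * (C * (1 + real n) powr (- \<gamma>)) / ((1 + real n) / 2)"
      unfolding u_step using \<gamma> C(1) C(2)[of n] u_pos[of "int n"] by (intro frac_le mult_mono) auto
    also have "\<dots> = 2 * C * (1 + real n) powr (- \<gamma> - 1)" by (simp add: powr_diff)
    finally show ?thesis .
  qed
  then show ?thesis using that[of "2 * C"] C by simp
qed

abbreviation log_size :: "int \<Rightarrow> real" where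
  "log_size x \<equiv> ln (1 + of_int \<bar>x\<bar>)"

text \<open>Since \<open>u\<close> is essentially an exponential function of \<open>ln (1 +
  \<bar>x\<bar>)\<close>, its increments are controlled by those of the logarithm, in the same
  way as the increments of the logarithmic cutoff.\<close>

lemma u_diff_le_log:
  obtains C where "0 < C" "\<And>x y. \<bar>x\<bar> \<le> \<bar>y\<bar> \<Longrightarrow>
     u x - u y \<le> C * (1 + real_of_int \<bar>x\<bar>) powr (- \<gamma>) * (log_size y - log_size x)"
proof -
  obtain C where C: "0 < C" "\<And>n. u (int n) - u (int (Suc n)) \<le> C * (1 + real n) powr (- \<gamma> - 1)"
    using u_step_upper by metis
  have nat: "u (int i) - u (int j) \<le> 2 * C * (1 + real i) powr (- \<gamma>) * (ln (1 + real j) - ln (1 + real i))"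
    if "i \<le> j" for i j
    using that
  proof (induction j rule: dec_induct)
    case (step j)
    have "u (int j) - u (int (Suc j)) \<le> C * ((1 + real j) powr (- \<gamma>) * (1 / (1 + real j)))"
      using C(2)[of j] by (simp add: powr_diff)
    also have "\<dots> \<le> C * ((1 + real i) powr (- \<gamma>) * (2 * (1 / (2 + real j))))"
      using step C \<gamma> by (intro mult_left_mono mult_mono powr_mono2') (auto simp: field_simps)
    also have "\<dots> \<le> C * ((1 + real i) powr (- \<gamma>) * (2 * (ln (1 + real (Suc j)) - ln (1 + real j))))"
      using C ln_diff_le[of "1 + real j" "1 + real (Suc j)"]
      by (intro mult_left_mono) (auto simp: field_simps)
    finally show ?case using step.IH by (simp add: algebra_simps)
  qed simp
  have "u x - u y \<le> 2 * C * (1 + real_of_int \<bar>x\<bar>) powr (- \<gamma>) * (log_size y - log_size x)"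
    if "\<bar>x\<bar> \<le> \<bar>y\<bar>" for x y
    using nat[of "nat \<bar>x\<bar>" "nat \<bar>y\<bar>"] that u_abs[of x] u_abs[of y] by simp
  then show ?thesis using that[of "2 * C"] C by simp
qed

text \<open>In the borderline case all dyadic scales contribute equally to the energy. A cutoff
  that is linear in the logarithm distributes the unavoidable decrease evenly over the scales up
  to \<open>exp N\<close>.\<close>

definition log_cutoff :: "real \<Rightarrow> int \<Rightarrow> real" where
  "log_cutoff N x = max 0 (1 - log_size x / N)"

abbreviation \<mu> :: real where "\<mu> \<equiv> min (p - 1) 1"

text \<open>Write \<open>l\<close> for the logarithmic distance of the two sites. Increments of
  the cutoff are at most \<open>l / N\<close> and increments of \<open>u\<close> at most a
  multiple of \<open>u x\<close> times \<open>l\<close>, so that everything scales with the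
  \<open>p\<close>-th power of \<open>1 + \<bar>x\<bar>\<close> to the power \<open>-
  \<gamma>\<close>; only the \<open>1 + \<mu>\<close> factors that stem from the cutoff carry
  the small number \<open>1 / N\<close>.\<close>

lemma log_cutoff_gap_le:
  obtains C where "0 < C" "\<And>N x y. 1 \<le> N \<Longrightarrow> \<bar>x\<bar> \<le> \<bar>y\<bar> \<Longrightarrow>
    picone_gap p (u x) (u y) (u x * log_cutoff N x) (u y * log_cutoff N y) \<le>
      C * N powr (- 1 - \<mu>) * (1 + real_of_int \<bar>x\<bar>) powr (- (\<gamma> * p)) *
      ((log_size y - log_size x) powr p +
       (log_size y - log_size x) powr (p + \<mu>))"
proof -
  obtain C1 where C1: "0 < C1" "\<And>n. u (int n) \<le> C1 * (1 + real n) powr (- \<gamma>)" using u_bounds by metis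
  obtain C2 where C2: "0 < C2" "\<And>x y. \<bar>x\<bar> \<le> \<bar>y\<bar> \<Longrightarrow>
     u x - u y \<le> C2 * (1 + real_of_int \<bar>x\<bar>) powr (- \<gamma>) * (log_size y - log_size x)"
    using u_diff_le_log by metis
  define M where "M = max C1 C2"
  define K where "K = p * max 1 (p - 1)"
  define C where "C = K * ((2 * M) powr p + M powr p)"
  have M: "0 < M" "C1 \<le> M" "C2 \<le> M" using C1 by (auto simp: M_def)
  have K: "0 < K" using p by (simp add: K_def)
  have \<mu>: "0 < \<mu>" "\<mu> \<le> p - 1" using p by auto
  have "picone_gap p (u x) (u y) (u x * log_cutoff N x) (u y * log_cutoff N y) \<le>
      C * N powr (- 1 - \<mu>) * (1 + real_of_int \<bar>x\<bar>) powr (- (\<gamma> * p)) *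
      ((log_size y - log_size x) powr p +
       (log_size y - log_size x) powr (p + \<mu>))"
    if N: "1 \<le> N" and xy: "\<bar>x\<bar> \<le> \<bar>y\<bar>" for N x y
  proof -
    define X where "X = 1 + real_of_int \<bar>x\<bar>"
    define l where "l = log_size y - ln X"
    define Z where "Z = X powr (- \<gamma>)"
    define d where "d = log_cutoff N x - log_cutoff N y"
    have X: "X \<ge> 1" by (simp add: X_def)
    have Z: "Z > 0" using X by (simp add: Z_def)
    have Zp: "X powr (- (\<gamma> * p)) = Z powr p" by (simp add: Z_def powr_powr)
    have "ln X \<le> log_size y" using xy X unfolding X_def by (subst ln_le_cancel_iff) auto
    then have l: "0 \<le> l" by (simp add: l_def)
    have mono: "ln X / N \<le> log_size y / N"
      using l N by (intro divide_right_mono) (auto simp: l_def)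
    then have cut: "0 \<le> log_cutoff N y" "log_cutoff N y \<le> log_cutoff N x" "log_cutoff N x \<le> 1"
      using N X by (auto simp: log_cutoff_def X_def)
    have d0: "0 \<le> d" using cut by (simp add: d_def)
    have dl: "d \<le> l / N"
      using mono unfolding d_def log_cutoff_def l_def X_def diff_divide_distrib by linarith
    have "l / N \<le> l" using l N by (simp add: divide_le_eq mult_left_le mult_le_cancel_left1)
    then have dl': "d \<le> l" using dl by simp
    have ux: "u x \<le> M * Z"
    proof -
      have "u x \<le> C1 * Z" using C1(2)[of "nat \<bar>x\<bar>"] u_abs[of x] by (simp add: Z_def X_def)
      also have "\<dots> \<le> M * Z" using M Z by (intro mult_right_mono) auto
      finally show ?thesis .
    qed
    have b: "0 < u y" "u y \<le> u x" using u_pos u_antimono xy by auto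
    have b': "u y \<le> M * Z" using b ux by simp
    have diff: "u x - u y \<le> M * Z * l"
    proof -
      have "u x - u y \<le> C2 * Z * l" using C2(2)[OF xy] by (simp add: Z_def l_def X_def)
      also have "\<dots> \<le> M * Z * l" using M Z l by (intro mult_right_mono) auto
      finally show ?thesis .
    qed
    have "u y * d \<le> (M * Z) * (l / N)" using b' dl d0 b M Z by (intro mult_mono) auto
    then have "(u y * d) powr (1 + \<mu>) \<le> (M * Z * (l / N)) powr (1 + \<mu>)"
      using b d0 \<mu> by (intro powr_mono2) auto
    moreover have "(u x - u y + u y * d) powr (p - 1 - \<mu>) \<le> (2 * (M * Z * l)) powr (p - 1 - \<mu>)"
    proof (rule powr_mono2)
      have "u y * d \<le> (M * Z) * l" using b' dl' d0 b M Z by (intro mult_mono) auto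
      then show "u x - u y + u y * d \<le> 2 * (M * Z * l)" using diff by simp
    qed (use \<mu> b d0 in auto)
    ultimately have "(u y * d) powr (1 + \<mu>) * (u x - u y + u y * d) powr (p - 1 - \<mu>)
        \<le> (M * Z * (l / N)) powr (1 + \<mu>) * (2 * (M * Z * l)) powr (p - 1 - \<mu>)"
      by (intro mult_mono) auto
    also have "\<dots> \<le> (2 * (M * Z * (l / N))) powr (1 + \<mu>) * (2 * (M * Z * l)) powr (p - 1 - \<mu>)"
    proof (intro mult_right_mono powr_mono2)
      have "0 \<le> M * Z * (l / N)" using M Z l N by simp
      then show "M * Z * (l / N) \<le> 2 * (M * Z * (l / N))" by linarith
    qed (use M Z l N \<mu> in auto)
    also have "\<dots> = (2 * (M * Z * l)) powr ((1 + \<mu>) + (p - 1 - \<mu>)) * N powr (- (1 + \<mu>))"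
    proof -
      have "2 * (M * Z * (l / N)) = 2 * (M * Z * l) / N" by simp
      moreover have "0 \<le> 2 * (M * Z * l)" using M Z l by simp
      ultimately have "(2 * (M * Z * (l / N))) powr (1 + \<mu>) = (2 * (M * Z * l)) powr (1 + \<mu>) * N powr (- (1 + \<mu>))"
        using N by (simp only: powr_divide_minus)
      then show ?thesis by (simp only: powr_add mult_ac)
    qed
    also have "\<dots> = (2 * M) powr p * N powr (- 1 - \<mu>) * Z powr p * l powr p"
      using M Z l by (simp add: powr_mult mult_ac)
    finally have first: "(u y * d) powr (1 + \<mu>) * (u x - u y + u y * d) powr (p - 1 - \<mu>)
        \<le> (2 * M) powr p * N powr (- 1 - \<mu>) * Z powr p * l powr p" .
    have "u y * (u x - u y) powr (p - 1) * d powr (1 + \<mu>) \<le> (M * Z) * (M * Z * l) powr (p - 1) * (l / N) powr (1 + \<mu>)"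
      using b b' diff dl d0 p \<mu> M Z l by (intro mult_mono powr_mono2) auto
    also have "\<dots> = (M * Z) powr (1 + (p - 1)) * l powr ((p - 1) + (1 + \<mu>)) * N powr (- (1 + \<mu>))"
    proof -
      have "(l / N) powr (1 + \<mu>) = l powr (1 + \<mu>) * N powr (- (1 + \<mu>))"
        using N l by (intro powr_divide_minus) auto
      moreover have "(M * Z * l) powr (p - 1) = (M * Z) powr (p - 1) * l powr (p - 1)"
        using M Z l by (simp add: powr_mult)
      moreover have "(M * Z) powr (1 + (p - 1)) = M * Z * (M * Z) powr (p - 1)"
        using M Z by (simp only: powr_add) simp
      ultimately show ?thesis by (simp only: powr_add[of l "p - 1"] mult_ac)
    qed
    also have "\<dots> = M powr p * N powr (- 1 - \<mu>) * Z powr p * l powr (p + \<mu>)"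
      using M Z l by (simp add: powr_mult mult_ac)
    finally have second: "u y * (u x - u y) powr (p - 1) * d powr (1 + \<mu>)
        \<le> M powr p * N powr (- 1 - \<mu>) * Z powr p * l powr (p + \<mu>)" .
    have "picone_gap p (u x) (u y) (u x * log_cutoff N x) (u y * log_cutoff N y) \<le>
       K * ((u y * d) powr (1 + \<mu>) * (u x - u y + u y * d) powr (p - 1 - \<mu>) + u y * (u x - u y) powr (p - 1) * d powr (1 + \<mu>))"
      unfolding K_def d_def by (rule picone_gap_upper[OF p b cut])
    also have "\<dots> \<le> K * ((2 * M) powr p * N powr (- 1 - \<mu>) * Z powr p * l powr p + M powr p * N powr (- 1 - \<mu>) * Z powr p * l powr (p + \<mu>))"
      using first second K by (intro mult_left_mono add_mono) auto
    also have "\<dots> \<le> K * (((2 * M) powr p + M powr p) * N powr (- 1 - \<mu>) * Z powr p * l powr p + ((2 * M) powr p + M powr p) * N powr (- 1 - \<mu>) * Z powr p * l powr (p + \<mu>))"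
      using K by (intro mult_left_mono add_mono mult_right_mono) auto
    also have "\<dots> = C * N powr (- 1 - \<mu>) * Z powr p * (l powr p + l powr (p + \<mu>))"
      by (simp add: C_def algebra_simps)
    finally show ?thesis unfolding Zp[symmetric] by (simp only: l_def X_def)
  qed
  moreover have "C > 0" using K M by (simp add: C_def add_pos_pos)
  ultimately show ?thesis using that by blast
qed

text \<open>Majorant of \<open>ln (1 + t)\<^sup>p + ln (1 +
  t)\<^sup>p\<^sup>+\<^sup>\<mu>\<close>, where \<open>t\<close> is the distance of two sites
  relative to their size. Summed against the kernel, the exponent near 0 has to exceed
  \<open>S\<close>, and the one at infinity to be less than \<open>S\<close>.\<close>

definition row_majorant :: "real \<Rightarrow> real \<Rightarrow> real" where
  "row_majorant K t = (if t \<le> 1 then 2 * t powr p else K * t powr (S / 2))"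

lemma row_majorant_nonneg: "0 < K \<Longrightarrow> 0 \<le> row_majorant K t"
  by (simp add: row_majorant_def)

text \<open>With distances up to \<open>X\<close> and beyond \<open>X\<close> treated
  separately, both parts of the sum scale like \<open>X\<close> to the power \<open>-
  S\<close>.\<close>

lemma kernel_row_sum:
  assumes "0 < K"
  obtains C where "0 < C"
    "\<And>X. 1 \<le> X \<Longrightarrow> (\<lambda>z. k z * row_majorant K (of_int \<bar>z\<bar> / real X)) summable_on UNIV"
    "\<And>X. 1 \<le> X \<Longrightarrow> (\<Sum>\<^sub>\<infinity>z. k z * row_majorant K (of_int \<bar>z\<bar> / real X)) \<le> C * real X powr (- S)"
proof -
  obtain Ck where Ck: "0 < Ck" "\<And>n. n \<ge> 1 \<Longrightarrow> k (int n) \<le> Ck * real n powr (- 1 - S)"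
    using k_upper by blast
  define g where "g = (\<lambda>X z. k z * row_majorant K (of_int \<bar>z\<bar> / real X))"
  define B where "B = 2 * Ck * max 1 (1 / (p - S)) + Ck * K * (2 / S)"
  have B: "0 < B" using Ck assms S by (simp add: B_def add_pos_pos)
  have pS: "0 < p - S" using p S by simp
  have partial: "(\<Sum>h=1..M. g X (int h)) \<le> B * real X powr (- S)" if X: "1 \<le> X" for X M
  proof -
    have g_low: "g X (int h) \<le> 2 * Ck * real X powr (- p) * real h powr (p - S - 1)" if "1 \<le> h" "h \<le> X" for h
    proof -
      have "g X (int h) = k (int h) * (2 * (real h powr p * real X powr (- p)))"
        using that X by (simp add: g_def row_majorant_def powr_divide powr_minus_divide)
      also have "\<dots> \<le> (Ck * real h powr (- 1 - S)) * (2 * (real h powr p * real X powr (- p)))"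
        using that by (intro mult_right_mono Ck) auto
      also have "\<dots> = 2 * Ck * real X powr (- p) * real h powr (p + (- 1 - S))"
        by (simp only: powr_add) simp
      finally show ?thesis by (simp add: algebra_simps)
    qed
    have g_high: "g X (int h) \<le> Ck * K * real X powr (- (S / 2)) * real h powr (- 1 - S / 2)" if "X < h" for h
    proof -
      have "g X (int h) = k (int h) * (K * (real h powr (S / 2) * real X powr (- (S / 2))))"
        using that X by (simp add: g_def row_majorant_def powr_divide powr_minus_divide)
      also have "\<dots> \<le> (Ck * real h powr (- 1 - S)) * (K * (real h powr (S / 2) * real X powr (- (S / 2))))"
        using that X assms by (intro mult_right_mono Ck) auto
      also have "\<dots> = Ck * K * real X powr (- (S / 2)) * real h powr (S / 2 + (- 1 - S))"
        by (simp only: powr_add) simp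
      also have "S / 2 + (- 1 - S) = - 1 - S / 2" by simp
      finally show ?thesis .
    qed
    have gnn: "0 \<le> g X z" for z using assms by (auto simp: g_def k_nonneg row_majorant_nonneg)
    have "(\<Sum>h=1..M. g X (int h)) \<le> (\<Sum>h\<in>{1..X} \<union> {Suc X..M}. g X (int h))"
      using gnn by (intro sum_mono2) auto
    also have "\<dots> = (\<Sum>h=1..X. g X (int h)) + (\<Sum>h=Suc X..M. g X (int h))"
      by (intro sum.union_disjoint) auto
    also have "\<dots> \<le> (\<Sum>h=1..X. 2 * Ck * real X powr (- p) * real h powr (p - S - 1))
        + (\<Sum>h=Suc X..M. Ck * K * real X powr (- (S / 2)) * real h powr (- 1 - S / 2))"
      by (intro add_mono sum_mono g_low g_high) auto
    also have "\<dots> = 2 * Ck * real X powr (- p) * (\<Sum>h=1..X. real h powr (p - S - 1))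
        + Ck * K * real X powr (- (S / 2)) * (\<Sum>h=Suc X..M. real h powr (- 1 - S / 2))"
      by (simp add: sum_distrib_left)
    also have "\<dots> \<le> 2 * Ck * real X powr (- p) * (max 1 (1 / (p - S)) * real X powr (p - S))
        + Ck * K * real X powr (- (S / 2)) * (real X powr (- (S / 2)) / (S / 2))"
      using Ck assms pS S X by (intro add_mono mult_left_mono sum_powr_le sum_powr_tail_le) auto
    also have "\<dots> = 2 * Ck * max 1 (1 / (p - S)) * real X powr (- p + (p - S)) + Ck * K * (2 / S) * real X powr (- (S / 2) + - (S / 2))"
      by (simp only: powr_add) simp
    also have "\<dots> = B * real X powr (- S)" by (simp add: B_def distrib_right)
    finally show ?thesis .
  qed
  have sm: "g X summable_on UNIV" "infsum (g X) UNIV \<le> 2 * (B * real X powr (- S))" if "1 \<le> X" for X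
    using even_summable_int[of "g X" "B * real X powr (- S)"] partial[OF that] assms
    by (auto simp: g_def k_nonneg row_majorant_nonneg)
  show ?thesis
  proof
    show "0 < 2 * B" using B by simp
    show "(\<lambda>z. k z * row_majorant K (of_int \<bar>z\<bar> / real X)) summable_on UNIV" if "1 \<le> X" for X
      using sm(1)[OF that] unfolding g_def .
    show "(\<Sum>\<^sub>\<infinity>z. k z * row_majorant K (of_int \<bar>z\<bar> / real X)) \<le> 2 * B * real X powr (- S)" if "1 \<le> X" for X
      using sm(2)[OF that] unfolding g_def mult.assoc .
  qed
qed

lemma log_growth_le:
  obtains K where "0 < K" "\<And>x y. \<bar>x\<bar> \<le> \<bar>y\<bar> \<Longrightarrow>
     (log_size y - log_size x) powr p +
     (log_size y - log_size x) powr (p + \<mu>) \<le>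
     row_majorant K (of_int \<bar>x - y\<bar> / (1 + of_int \<bar>x\<bar>))"
proof -
  obtain K1 where K1: "0 < K1" "\<And>z. 1 \<le> z \<Longrightarrow> ln (1 + z) powr p \<le> K1 * z powr (S / 2)"
    by (rule ln_power_bound[of p "S / 2"]) (use p S that in auto)
  obtain K2 where K2: "0 < K2" "\<And>z. 1 \<le> z \<Longrightarrow> ln (1 + z) powr (p + \<mu>) \<le> K2 * z powr (S / 2)"
    by (rule ln_power_bound[of "p + \<mu>" "S / 2"]) (use p S that in auto)
  have "(log_size y - log_size x) powr p +
     (log_size y - log_size x) powr (p + \<mu>) \<le>
     row_majorant (K1 + K2) (of_int \<bar>x - y\<bar> / (1 + of_int \<bar>x\<bar>))"
    if xy: "\<bar>x\<bar> \<le> \<bar>y\<bar>" for x y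
  proof -
    define X where "X = 1 + real_of_int \<bar>x\<bar>"
    define z where "z = real_of_int \<bar>x - y\<bar> / X"
    define l where "l = log_size y - ln X"
    have X: "X \<ge> 1" by (simp add: X_def)
    have z: "0 \<le> z" using X by (simp add: z_def)
    have "ln X \<le> log_size y" using xy X unfolding X_def by (subst ln_le_cancel_iff) auto
    then have l: "0 \<le> l" by (simp add: l_def)
    have "l = ln ((1 + real_of_int \<bar>y\<bar>) / X)" using X unfolding l_def by (subst ln_div) auto
    also have "\<dots> \<le> ln (1 + z)"
    proof (subst ln_le_cancel_iff)
      have "real_of_int \<bar>y\<bar> \<le> real_of_int \<bar>x\<bar> + real_of_int \<bar>x - y\<bar>" by linarith
      then have "(1 + real_of_int \<bar>y\<bar>) / X \<le> (X + real_of_int \<bar>x - y\<bar>) / X"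
        using X by (intro divide_right_mono) (auto simp: X_def)
      then show "(1 + real_of_int \<bar>y\<bar>) / X \<le> 1 + z"
        using X by (simp add: z_def add_divide_distrib)
    qed (use X z in auto)
    finally have lz: "l \<le> ln (1 + z)" .
    have "l powr p + l powr (p + \<mu>) \<le> row_majorant (K1 + K2) z"
    proof (cases "z \<le> 1")
      case z1: True
      have lz': "l \<le> z" using lz ln_add_one_self_le_self[OF z] by simp
      have "l powr p \<le> z powr p" using l lz' p by (intro powr_mono2) auto
      moreover have "l powr (p + \<mu>) \<le> z powr (p + \<mu>)" using l lz' p by (intro powr_mono2) auto
      moreover have "z powr (p + \<mu>) \<le> z powr p"
        using z z1 p by (intro powr_mono') auto
      ultimately show ?thesis using z1 by (simp add: row_majorant_def)
    next
      case False
      then have z1: "1 \<le> z" by simp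
      have "l powr p \<le> ln (1 + z) powr p" using l lz p by (intro powr_mono2) auto
      moreover have "l powr (p + \<mu>) \<le> ln (1 + z) powr (p + \<mu>)" using l lz p by (intro powr_mono2) auto
      ultimately show ?thesis using K1(2)[OF z1] K2(2)[OF z1] False by (simp add: row_majorant_def distrib_right)
    qed
    then show ?thesis by (simp add: l_def z_def X_def)
  qed
  then show ?thesis using that[of "K1 + K2"] K1 K2 by simp
qed

text \<open>The support is contained in an interval of radius \<open>exp N\<close>, so that the
  harmonic sum over it is of order \<open>N\<close>.\<close>

lemma log_cutoff_support:
  assumes "1 \<le> N"
  shows "finite {x. log_cutoff N x \<noteq> 0}"
    and "(\<Sum>x | log_cutoff N x \<noteq> 0. 1 / (1 + real_of_int \<bar>x\<bar>)) \<le> 12 * N"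
proof -
  define M where "M = nat \<lfloor>exp N\<rfloor>"
  have M: "real M \<le> exp N" by (simp add: M_def)
  have sub: "{x. log_cutoff N x \<noteq> 0} \<subseteq> int ` {..<Suc M} \<union> (\<lambda>i. - int i) ` {..<Suc M}"
  proof
    fix x assume "x \<in> {x. log_cutoff N x \<noteq> 0}"
    then have "log_size x < N" using assms by (auto simp: log_cutoff_def max_def field_simps split: if_splits)
    then have "1 + real_of_int \<bar>x\<bar> < exp N" by (metis add_pos_nonneg exp_less_cancel_iff exp_ln abs_ge_zero of_int_0_le_iff zero_less_one)
    then have "\<bar>x\<bar> \<le> \<lfloor>exp N\<rfloor>" by linarith
    then have x: "nat \<bar>x\<bar> \<in> {..<Suc M}" by (auto simp: M_def)
    show "x \<in> int ` {..<Suc M} \<union> (\<lambda>i. - int i) ` {..<Suc M}"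
    proof (cases "0 \<le> x")
      case True
      then have "x = int (nat \<bar>x\<bar>)" by simp
      then show ?thesis using x by blast
    next
      case False
      then have "x = - int (nat \<bar>x\<bar>)" by simp
      then show ?thesis using x by blast
    qed
  qed
  then show "finite {x. log_cutoff N x \<noteq> 0}" by (rule finite_subset) auto
  let ?f = "\<lambda>x. 1 / (1 + real_of_int \<bar>x\<bar>)"
  have "(\<Sum>x | log_cutoff N x \<noteq> 0. ?f x) \<le> sum ?f (int ` {..<Suc M} \<union> (\<lambda>i. - int i) ` {..<Suc M})"
    using sub by (intro sum_mono2) auto
  also have "\<dots> \<le> sum ?f (int ` {..<Suc M}) + sum ?f ((\<lambda>i. - int i) ` {..<Suc M})"
    using sum.union_inter[of "int ` {..<Suc M}" "(\<lambda>i. - int i) ` {..<Suc M}" ?f]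
      sum_nonneg[of "int ` {..<Suc M} \<inter> (\<lambda>i. - int i) ` {..<Suc M}" ?f] by simp
  also have "\<dots> = 2 * (\<Sum>i<Suc M. 1 / (1 + real i))"
    by (simp add: sum.reindex inj_on_def del: sum.lessThan_Suc)
  also have "\<dots> \<le> 2 * (2 * ln (1 + real (Suc M)))"
    by (intro mult_left_mono sum_inverse_le_ln) auto
  also have "\<dots> \<le> 4 * (N + 2)"
  proof -
    have "1 \<le> exp N" using assms by simp
    then have "1 + real (Suc M) \<le> 3 * exp N" using M by linarith
    also have "\<dots> \<le> exp 2 * exp N" using exp_ge_add_one_self[of "2::real"] by (intro mult_right_mono) auto
    finally have "ln (1 + real (Suc M)) \<le> ln (exp (2 + N))" by (subst ln_le_cancel_iff) (auto simp: exp_add)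
    then show ?thesis by simp
  qed
  also have "\<dots> \<le> 12 * N" using assms by simp
  finally show "(\<Sum>x | log_cutoff N x \<noteq> 0. 1 / (1 + real_of_int \<bar>x\<bar>)) \<le> 12 * N" .
qed

text \<open>Assign each pair of sites to the one that is closer to the origin; if it lies
  outside the support of the cutoff, then the gap of the pair is 0. The row of \<open>x\<close>
  then contributes at most \<open>1 / (1 + \<bar>x\<bar>)\<close> up to a constant and the power
  of \<open>N\<close>, by the assumption on the exponents.\<close>

lemma ground_state_deficit_le:
  assumes crit: "1 \<le> S + \<gamma> * p"
  obtains C where "0 < C" "\<And>N. 1 \<le> N \<Longrightarrow>
    p_energy p \<sigma> (\<lambda>x. u x * log_cutoff N x) -
     (\<Sum>x | u x * log_cutoff N x \<noteq> 0. \<bar>u x * log_cutoff N x\<bar> powr p / u x powr (p - 1) * frac_p_laplace p \<sigma> u x)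
     \<le> C * N powr (- \<mu>)"
proof -
  obtain C1 where C1: "0 < C1" "\<And>N x y. 1 \<le> N \<Longrightarrow> \<bar>x\<bar> \<le> \<bar>y\<bar> \<Longrightarrow>
    picone_gap p (u x) (u y) (u x * log_cutoff N x) (u y * log_cutoff N y) \<le>
      C1 * N powr (- 1 - \<mu>) * (1 + real_of_int \<bar>x\<bar>) powr (- (\<gamma> * p)) *
      ((log_size y - log_size x) powr p +
       (log_size y - log_size x) powr (p + \<mu>))"
    by (rule log_cutoff_gap_le) (rule that)
  obtain K where K: "0 < K" "\<And>x y. \<bar>x\<bar> \<le> \<bar>y\<bar> \<Longrightarrow>
     (log_size y - log_size x) powr p +
     (log_size y - log_size x) powr (p + \<mu>) \<le>
     row_majorant K (of_int \<bar>x - y\<bar> / (1 + of_int \<bar>x\<bar>))"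
    by (rule log_growth_le) (rule that)
  define G where "G = (\<lambda>X z. row_majorant K (of_int \<bar>z\<bar> / real X))"
  have G_eq: "row_majorant K (of_int \<bar>z\<bar> / real X) = G X z" for X z by (simp add: G_def)
  obtain C2 where C2: "0 < C2" "\<And>X. 1 \<le> X \<Longrightarrow> (\<lambda>z. k z * G X z) summable_on UNIV"
    "\<And>X. 1 \<le> X \<Longrightarrow> infsum (\<lambda>z. k z * G X z) UNIV \<le> C2 * real X powr (- S)"
    by (rule kernel_row_sum[OF K(1), unfolded G_eq]) (rule that)
  have K': "(log_size y - log_size x) powr p +
     (log_size y - log_size x) powr (p + \<mu>) \<le> G (Suc (nat \<bar>x\<bar>)) (x - y)"
    if "\<bar>x\<bar> \<le> \<bar>y\<bar>" for x y
    using K(2)[OF that] by (simp add: G_def add.commute)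
  have G0: "0 \<le> G X z" for X z using K by (simp add: G_def row_majorant_nonneg)
  have "p_energy p \<sigma> (\<lambda>x. u x * log_cutoff N x) -
     (\<Sum>x | u x * log_cutoff N x \<noteq> 0. \<bar>u x * log_cutoff N x\<bar> powr p / u x powr (p - 1) * frac_p_laplace p \<sigma> u x)
     \<le> (12 * C1 * C2) * N powr (- \<mu>)" if N: "1 \<le> N" for N
  proof -
    define F where "F = {x. log_cutoff N x \<noteq> 0}"
    define \<phi> where "\<phi> = (\<lambda>x. u x * log_cutoff N x)"
    have F: "finite F" "F = {x. \<phi> x \<noteq> 0}"
      using log_cutoff_support(1)[OF N] u_pos by (auto simp: F_def \<phi>_def less_imp_neq[THEN not_sym])
    define E where "E = p_energy p \<sigma> \<phi> - (\<Sum>x | \<phi> x \<noteq> 0. \<bar>\<phi> x\<bar> powr p / u x powr (p - 1) * frac_p_laplace p \<sigma> u x)"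
    define A where "A = (\<lambda>x. C1 * N powr (- 1 - \<mu>) * (1 + real_of_int \<bar>x\<bar>) powr (- (\<gamma> * p)))"
    define g where "g = (\<lambda>x y. A x * (k (x - y) * G (Suc (nat \<bar>x\<bar>)) (x - y)))"
    have A0: "0 \<le> A x" for x using C1 by (simp add: A_def)
    have row: "(g x has_sum A x * infsum (\<lambda>z. k z * G (Suc (nat \<bar>x\<bar>)) z) UNIV) UNIV" for x
    proof -
      have bij: "bij_betw (\<lambda>y. x - y) UNIV UNIV" by (rule bij_betwI[of _ _ _ "\<lambda>y. x - y"]) auto
      have "((\<lambda>z. k z * G (Suc (nat \<bar>x\<bar>)) z) has_sum infsum (\<lambda>z. k z * G (Suc (nat \<bar>x\<bar>)) z) UNIV) UNIV"
        by (intro has_sum_infsum C2) simp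
      then have "((\<lambda>y. k (x - y) * G (Suc (nat \<bar>x\<bar>)) (x - y)) has_sum infsum (\<lambda>z. k z * G (Suc (nat \<bar>x\<bar>)) z) UNIV) UNIV"
        using has_sum_reindex_bij_betw[OF bij, of "\<lambda>z. k z * G (Suc (nat \<bar>x\<bar>)) z"] by simp
      then show ?thesis unfolding g_def by (rule has_sum_cmult_right)
    qed
    define R where "R = (\<Sum>x\<in>F. A x * infsum (\<lambda>z. k z * G (Suc (nat \<bar>x\<bar>)) z) UNIV)"
    have rows: "((\<lambda>(x, y). if x \<in> F then g x y else 0) has_sum R) UNIV"
      unfolding R_def by (intro has_sum_finite_rows F row)
    have "R \<le> (\<Sum>x\<in>F. C1 * C2 * N powr (- 1 - \<mu>) * (1 / (1 + real_of_int \<bar>x\<bar>)))"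
      unfolding R_def
    proof (rule sum_mono)
      fix x
      define X where "X = 1 + real_of_int \<bar>x\<bar>"
      have X: "real (Suc (nat \<bar>x\<bar>)) = X" "X \<ge> 1" by (auto simp: X_def)
      have "A x * infsum (\<lambda>z. k z * G (Suc (nat \<bar>x\<bar>)) z) UNIV \<le> A x * (C2 * X powr (- S))"
        using C2(3)[of "Suc (nat \<bar>x\<bar>)"] A0 X by (intro mult_left_mono) auto
      also have "\<dots> = C1 * C2 * N powr (- 1 - \<mu>) * (X powr (- (\<gamma> * p)) * X powr (- S))"
        by (simp add: A_def X_def)
      also have "\<dots> = C1 * C2 * N powr (- 1 - \<mu>) * X powr (- (\<gamma> * p) - S)"
        by (simp add: powr_add[symmetric])
      also have "\<dots> \<le> C1 * C2 * N powr (- 1 - \<mu>) * X powr (- 1)"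
        using crit C1 C2 X by (intro mult_left_mono powr_mono) auto
      finally show "A x * infsum (\<lambda>z. k z * G (Suc (nat \<bar>x\<bar>)) z) UNIV \<le> C1 * C2 * N powr (- 1 - \<mu>) * (1 / (1 + real_of_int \<bar>x\<bar>))"
        using X by (simp add: X_def[symmetric] powr_minus_divide)
    qed
    also have "\<dots> = C1 * C2 * N powr (- 1 - \<mu>) * (\<Sum>x\<in>F. 1 / (1 + real_of_int \<bar>x\<bar>))"
      by (rule sum_distrib_left[symmetric])
    also have "\<dots> \<le> C1 * C2 * N powr (- 1 - \<mu>) * (12 * N)"
      using log_cutoff_support(2)[OF N] C1 C2 by (intro mult_left_mono) (auto simp: F_def)
    also have "\<dots> = 12 * C1 * C2 * N powr ((- 1 - \<mu>) + 1)"
      using N by (simp only: powr_add) simp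
    finally have R: "R \<le> 12 * C1 * C2 * N powr (- \<mu>)" by simp
    have "((\<lambda>(x, y). k (x - y) * picone_gap p (u x) (u y) (\<phi> x) (\<phi> y)) has_sum 2 * E) UNIV"
      unfolding E_def by (rule ground_state_representation[OF u_pos u_in_formal_domain]) (use F in simp)
    moreover have "((\<lambda>z. (case z of (x, y) \<Rightarrow> if x \<in> F then g x y else 0) +
        (case z of (x, y) \<Rightarrow> (\<lambda>(x, y). if x \<in> F then g x y else 0) (y, x))) has_sum R + R) UNIV"
      by (intro has_sum_add rows has_sum_swap_pairs)
    ultimately have "2 * E \<le> R + R"
    proof (rule has_sum_mono)
      fix z :: "int \<times> int"
      obtain x y where z: "z = (x, y)" by (cases z)
      have g0: "0 \<le> g x y" for x y unfolding g_def by (intro mult_nonneg_nonneg A0 k_nonneg G0)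
      have le: "k (x - y) * picone_gap p (u x) (u y) (\<phi> x) (\<phi> y) \<le> (if x \<in> F then g x y else 0)"
        if "\<bar>x\<bar> \<le> \<bar>y\<bar>" for x y
      proof (cases "x \<in> F")
        case True
        have "picone_gap p (u x) (u y) (\<phi> x) (\<phi> y) \<le> A x * G (Suc (nat \<bar>x\<bar>)) (x - y)"
          using C1(2)[OF N that] mult_left_mono[OF K'[OF that] A0[of x]] by (simp add: \<phi>_def A_def)
        then have "k (x - y) * picone_gap p (u x) (u y) (\<phi> x) (\<phi> y) \<le> k (x - y) * (A x * G (Suc (nat \<bar>x\<bar>)) (x - y))"
          by (intro mult_left_mono k_nonneg)
        then show ?thesis using True by (simp add: g_def mult_ac)
      next
        case False
        have "log_size x / N \<le> log_size y / N"
          using that N by (intro divide_right_mono) auto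
        then have "log_cutoff N y \<le> log_cutoff N x" "0 \<le> log_cutoff N y" by (auto simp: log_cutoff_def)
        then have "\<phi> x = 0" "\<phi> y = 0" using False by (auto simp: F_def \<phi>_def)
        then show ?thesis using False p by (simp add: picone_gap_def)
      qed
      have "k (x - y) * picone_gap p (u x) (u y) (\<phi> x) (\<phi> y) \<le> (if x \<in> F then g x y else 0) + (if y \<in> F then g y x else 0)"
      proof (cases "\<bar>x\<bar> \<le> \<bar>y\<bar>")
        case True
        then show ?thesis using le[of x y] g0[of y x] by simp
      next
        case False
        then have "k (y - x) * picone_gap p (u y) (u x) (\<phi> y) (\<phi> x) \<le> (if y \<in> F then g y x else 0)"
          by (intro le) simp
        then show ?thesis using g0[of x y] by (auto simp: k_commute[of x y] picone_gap_sym split: if_splits)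
      qed
      then show "(case z of (x, y) \<Rightarrow> k (x - y) * picone_gap p (u x) (u y) (\<phi> x) (\<phi> y))
        \<le> (case z of (x, y) \<Rightarrow> if x \<in> F then g x y else 0) + (case z of (x, y) \<Rightarrow> (\<lambda>(x, y). if x \<in> F then g x y else 0) (y, x))"
        by (simp add: z)
    qed
    then show ?thesis using R by (simp add: E_def \<phi>_def)
  qed
  then show ?thesis using that[of "12 * C1 * C2"] C1 C2 by simp
qed

definition w :: "int \<Rightarrow> real" where
  "w x = frac_p_laplace p \<sigma> u x / u x powr (p - 1)"

lemma u_positive_supersolution: "positive_supersolution p \<sigma> w u"
  unfolding positive_supersolution_def w_def using u_pos u_in_formal_domain
  by (auto simp: less_imp_neq[THEN not_sym])

theorem w_critical:
  assumes crit: "1 \<le> S + \<gamma> * p"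
  shows "p_critical p \<sigma> w" and "agmon_ground_state p \<sigma> w u"
proof -
  define \<phi> where "\<phi> = (\<lambda>n x. u x * log_cutoff (real (Suc n)) x)"
  obtain C where C: "0 < C" "\<And>N. 1 \<le> N \<Longrightarrow>
    p_energy p \<sigma> (\<lambda>x. u x * log_cutoff N x) -
     (\<Sum>x | u x * log_cutoff N x \<noteq> 0. \<bar>u x * log_cutoff N x\<bar> powr p / u x powr (p - 1) * frac_p_laplace p \<sigma> u x)
     \<le> C * N powr (- \<mu>)" by (rule ground_state_deficit_le[OF crit]) (rule that)
  have fin: "finite {x. \<phi> n x \<noteq> 0}" for n
    using log_cutoff_support(1)[of "real (Suc n)"] by (rule finite_subset[rotated]) (auto simp: \<phi>_def)
  have lim: "(\<lambda>n. \<phi> n x) \<longlonglongrightarrow> u x" for x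
  proof -
    have "(\<lambda>n. log_size x * inverse (real (Suc n))) \<longlonglongrightarrow> log_size x * 0"
      by (intro tendsto_mult tendsto_const LIMSEQ_inverse_real_of_nat)
    then have "(\<lambda>n. u x * max 0 (1 - log_size x / real (Suc n))) \<longlonglongrightarrow> u x * max 0 (1 - 0)"
      unfolding divide_inverse by (intro tendsto_intros) simp
    then show ?thesis by (simp add: \<phi>_def log_cutoff_def)
  qed
  have eq: "(\<Sum>\<^sub>\<infinity>x. w x * \<bar>\<phi> n x\<bar> powr p) = (\<Sum>x | \<phi> n x \<noteq> 0. \<bar>\<phi> n x\<bar> powr p / u x powr (p - 1) * frac_p_laplace p \<sigma> u x)" for n
    unfolding infsum_weighted_power[OF fin] by (simp add: w_def mult.commute)
  have le: "p_energy p \<sigma> (\<phi> n) - (\<Sum>\<^sub>\<infinity>x. w x * \<bar>\<phi> n x\<bar> powr p) \<le> C * real (Suc n) powr (- \<mu>)" for n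
    unfolding eq using C(2)[of "real (Suc n)"] by (simp add: \<phi>_def)
  have ge: "0 \<le> p_energy p \<sigma> (\<phi> n) - (\<Sum>\<^sub>\<infinity>x. w x * \<bar>\<phi> n x\<bar> powr p)" for n
    using hardy_type_weight_of_supersolution[OF u_positive_supersolution] fin by (auto simp: hardy_type_weight_def)
  have \<mu>: "\<mu> > 0" using p by simp
  \<comment> \<open>The deficit lies between 0 and a multiple of a negative power of
    \<open>n\<close>.\<close>
  have "(\<lambda>n. real (Suc n) powr (- \<mu>)) \<longlonglongrightarrow> 0"
    by (rule tendsto_neg_powr[OF _ filterlim_compose[OF filterlim_real_sequentially filterlim_Suc]]) (use \<mu> in auto)
  then have upper: "(\<lambda>n. C * real (Suc n) powr (- \<mu>)) \<longlonglongrightarrow> 0" by (rule tendsto_mult_right_zero)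
  have null: "(\<lambda>n. p_energy p \<sigma> (\<phi> n) - (\<Sum>\<^sub>\<infinity>x. w x * \<bar>\<phi> n x\<bar> powr p)) \<longlonglongrightarrow> 0"
    using le ge by (intro tendsto_sandwich[OF _ _ tendsto_const upper] always_eventually) auto
  show "p_critical p \<sigma> w" "agmon_ground_state p \<sigma> w u"
    using critical_of_null_sequence[OF u_positive_supersolution fin lim null] by auto
qed

text \<open>The ground state has a strict maximum at the origin.\<close>

lemma w_0_pos: "0 < w 0"
proof -
  have "0 < frac_p_laplace p \<sigma> u 0"
  proof (rule has_sum_strict_mono[OF has_sum_0 frac_p_laplace_has_sum[OF u_in_formal_domain]])
    fix y :: int
    show "0 \<le> k (0 - y) * signed_powr (u 0 - u y) (p - 1)"
      using u_antimono[of 0 y] by (simp add: signed_powr_nonneg k_nonneg)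
    show "0 < k (0 - 1) * signed_powr (u 0 - u 1) (p - 1)"
      using u_less_at_0[of 1] k_pos[of "0 - 1"] by (auto simp: signed_powr_nonneg intro!: mult_pos_pos)
  qed auto
  then show ?thesis using u_pos[of 0] by (simp add: w_def)
qed

end

section \<open>Sums as integrals of step functions\<close>

text \<open>If every level set of \<open>f\<close> that matters has the same
  \<open>v\<close>-measure \<open>c\<close>, then integrating \<open>g \<circ> f\<close> amounts
  to summing \<open>g\<close>.\<close>

lemma step_function_integral:
  fixes f :: "real \<Rightarrow> nat" and g :: "nat \<Rightarrow> real" and v :: "real \<Rightarrow> real"
  assumes f [measurable]: "f \<in> measurable borel (count_space UNIV)"
    and v [measurable]: "v \<in> borel_measurable borel"
    and v0: "\<And>r. 0 \<le> v r" and g0: "\<And>j. 0 \<le> g j" and c: "0 \<le> c"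
    and cell: "\<And>j. g j \<noteq> 0 \<Longrightarrow> has_bochner_integral lborel (\<lambda>r. v r * indicator {r. f r = j} r) c"
    and sum: "summable g"
  shows "has_bochner_integral lborel (\<lambda>r. v r * g (f r)) (c * suminf g)"
proof (rule has_bochner_integral_nn_integral)
  have [measurable]: "(\<lambda>r. g (f r)) \<in> borel_measurable borel"
    by (rule measurable_compose[OF f]) simp
  show "(\<lambda>r. v r * g (f r)) \<in> borel_measurable lborel" by simp
  show "AE r in lborel. 0 \<le> v r * g (f r)" using v0 g0 by simp
  show "0 \<le> c * suminf g" using c sum g0 by (intro mult_nonneg_nonneg suminf_nonneg) auto
  have "(\<integral>\<^sup>+r. ennreal (v r * g (f r)) \<partial>lborel) =
     (\<integral>\<^sup>+r. (\<Sum>j. ennreal (g j) * ennreal (v r * indicator {r. f r = j} r)) \<partial>lborel)"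
  proof (rule nn_integral_cong)
    fix r
    have "(\<Sum>j. ennreal (g j) * ennreal (v r * indicator {r. f r = j} r)) =
        (\<Sum>j\<in>{f r}. ennreal (g j) * ennreal (v r * indicator {r. f r = j} r))"
      by (rule suminf_finite) (auto simp: indicator_def)
    then show "ennreal (v r * g (f r)) = (\<Sum>j. ennreal (g j) * ennreal (v r * indicator {r. f r = j} r))"
      using v0 g0 by (simp add: ennreal_mult mult.commute)
  qed
  also have "\<dots> = (\<Sum>j. \<integral>\<^sup>+r. ennreal (g j) * ennreal (v r * indicator {r. f r = j} r) \<partial>lborel)"
    by (rule nn_integral_suminf) measurable
  also have "\<dots> = (\<Sum>j. ennreal (c * g j))"
  proof (rule suminf_cong)
    fix j
    have "(\<integral>\<^sup>+r. ennreal (g j) * ennreal (v r * indicator {r. f r = j} r) \<partial>lborel) =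
       ennreal (g j) * (\<integral>\<^sup>+r. ennreal (v r * indicator {r. f r = j} r) \<partial>lborel)"
      by (rule nn_integral_cmult) measurable
    also have "\<dots> = ennreal (c * g j)"
    proof (cases "g j = 0")
      case False
      have "(\<integral>\<^sup>+r. ennreal (v r * indicator {r. f r = j} r) \<partial>lborel) = ennreal c"
        using cell[OF False] v0 by (subst nn_integral_eq_integral) (auto simp: has_bochner_integral_iff)
      then show ?thesis using g0[of j] c by (simp add: ennreal_mult mult.commute)
    qed simp
    finally show "(\<integral>\<^sup>+r. ennreal (g j) * ennreal (v r * indicator {r. f r = j} r) \<partial>lborel) = ennreal (c * g j)" .
  qed
  also have "\<dots> = ennreal (\<Sum>j. c * g j)"
    using sum g0 c by (intro suminf_ennreal2) (auto intro: summable_mult)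
  also have "(\<Sum>j. c * g j) = c * suminf g" using sum by (rule suminf_mult)
  finally show "(\<integral>\<^sup>+r. ennreal (v r * g (f r)) \<partial>lborel) = ennreal (c * suminf g)" .
qed

lemma upper_sum_integral:
  fixes g :: "nat \<Rightarrow> real"
  assumes n: "1 \<le> n" and g0: "\<And>j. 0 \<le> g j" and supp: "\<And>j. g j \<noteq> 0 \<Longrightarrow> n < j" and sum: "summable g"
  shows "has_bochner_integral lborel (\<lambda>r. indicator {1<..} r * g (nat \<lceil>real n * r\<rceil>)) (suminf g / real n)"
proof -
  have "has_bochner_integral lborel (\<lambda>r. indicator {1<..} r * g (nat \<lceil>real n * r\<rceil>)) (1 / real n * suminf g)"
  proof (rule step_function_integral)
    fix j assume "g j \<noteq> 0"
    then have j: "n < j" by (rule supp)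
    have cell: "(1::real) < r \<and> nat \<lceil>real n * r\<rceil> = j \<longleftrightarrow> r \<in> {(real j - 1) / real n<..real j / real n}" for r
    proof -
      have "r \<in> {(real j - 1) / real n<..real j / real n} \<longleftrightarrow> real j - 1 < real n * r \<and> real n * r \<le> real j"
        using n by (auto simp: divide_less_eq le_divide_eq mult.commute)
      also have "\<dots> \<longleftrightarrow> \<lceil>real n * r\<rceil> = int j" by (auto simp: ceiling_eq_iff)
      also have "\<dots> \<longleftrightarrow> nat \<lceil>real n * r\<rceil> = j" using j by auto
      finally have *: "r \<in> {(real j - 1) / real n<..real j / real n} \<longleftrightarrow> nat \<lceil>real n * r\<rceil> = j" .
      moreover have "1 < r" if "r \<in> {(real j - 1) / real n<..real j / real n}"
      proof -
        have "1 \<le> (real j - 1) / real n" using n j by (simp add: le_divide_eq)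
        then show ?thesis using that by simp
      qed
      ultimately show ?thesis by blast
    qed
    have "has_bochner_integral lborel (indicat_real {(real j - 1) / real n<..real j / real n}) (1 / real n)"
      using has_bochner_integral_real_indicator[of "{(real j - 1) / real n<..real j / real n}" lborel] n
      by (simp add: divide_right_mono diff_divide_distrib[symmetric])
    also have "indicat_real {(real j - 1) / real n<..real j / real n} =
        (\<lambda>r. indicator {1<..} r * indicator {r. nat \<lceil>real n * r\<rceil> = j} r)"
      using cell by (auto simp: fun_eq_iff indicator_def)
    finally show "has_bochner_integral lborel (\<lambda>r. indicator {1<..} r * indicator {r. nat \<lceil>real n * r\<rceil> = j} r) (1 / real n)" .
  qed (use g0 sum in auto)
  then show ?thesis by simp
qed

lemma integral_inverse_square_tail:
  fixes a :: real
  assumes "0 < a"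
  shows "has_bochner_integral lborel (\<lambda>r. indicator {a..} r * r powr (- 2)) (1 / a)"
proof (rule has_bochner_integral_nn_integral)
  have "(\<integral>\<^sup>+r. ennreal (r powr (- 2)) * indicator {a..} r \<partial>lborel) = ennreal (0 - (- (1 / a)))"
  proof (rule nn_integral_FTC_atLeast)
    show "((\<lambda>r. - (1 / r)) has_real_derivative r powr (- 2)) (at r)" if "a \<le> r" for r
    proof -
      have "r powr (- 2) = 1 / (r * r)"
        using that assms by (simp add: powr_minus_divide power2_eq_square)
      then show ?thesis using that assms by (auto intro!: derivative_eq_intros)
    qed
    have "((\<lambda>r::real. inverse r) \<longlongrightarrow> 0) at_top"
      by (intro tendsto_inverse_0_at_top filterlim_ident)
    then show "((\<lambda>r::real. - (1 / r)) \<longlongrightarrow> 0) at_top"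
      using tendsto_minus by (fastforce simp: divide_inverse)
  qed auto
  moreover have "ennreal (r powr (- 2)) * indicator {a..} r = ennreal (indicator {a..} r * r powr (- 2))" for r
    by (auto simp: indicator_def)
  ultimately show "(\<integral>\<^sup>+r. ennreal (indicator {a..} r * r powr (- 2)) \<partial>lborel) = ennreal (1 / a)"
    by simp
qed (use assms in auto)

text \<open>The substitution \<open>t = 1 / r\<close> carried out for step functions: the cells
  \<open>{r. n / j \<le> r < n / (j - 1)}\<close> have mass \<open>1 / n\<close> for the density
  \<open>r\<close> to the power \<open>-2\<close>. In this way the sum over \<open>j < n\<close>
  becomes an integral over \<open>r > 1\<close>, just like the sum over \<open>j >
  n\<close>.\<close>

lemma lower_sum_integral:
  fixes g :: "nat \<Rightarrow> real"
  assumes n: "1 \<le> n" and g0: "\<And>j. 0 \<le> g j" and supp: "\<And>j. g j \<noteq> 0 \<Longrightarrow> 1 \<le> j \<and> j < n" and sum: "summable g"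
  shows "has_bochner_integral lborel (\<lambda>r. (indicator {1<..} r * r powr (- 2)) * g (nat \<lceil>real n / r\<rceil>)) (suminf g / real n)"
proof -
  have "has_bochner_integral lborel (\<lambda>r. (indicator {1<..} r * r powr (- 2)) * g (nat \<lceil>real n / r\<rceil>)) (1 / real n * suminf g)"
  proof (rule step_function_integral)
    fix j assume "g j \<noteq> 0"
    then have j: "1 \<le> j" "j < n" by (auto dest: supp)
    have le_iff: "\<lceil>real n / r\<rceil> \<le> int i \<longleftrightarrow> real n / real i \<le> r" if "0 < r" "1 \<le> i" for r i
    proof -
      have "\<lceil>real n / r\<rceil> \<le> int i \<longleftrightarrow> real n / r \<le> real i" by (simp add: ceiling_le_iff)
      also have "\<dots> \<longleftrightarrow> real n / real i \<le> r" using that by (auto simp: divide_le_eq le_divide_eq mult.commute)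
      finally show ?thesis .
    qed
    have pos: "0 < \<lceil>real n / r\<rceil>" if "0 < r" for r using that n by simp
    have gt1: "1 < real n / real i" if "1 \<le> i" "i \<le> j" for i using that j by (simp add: less_divide_eq)
    show "has_bochner_integral lborel (\<lambda>r. indicator {1<..} r * r powr (- 2) * indicator {r. nat \<lceil>real n / r\<rceil> = j} r) (1 / real n)"
    proof (cases "j = 1")
      case True
      have "indicator {1<..} r * r powr (- 2) * indicator {r. nat \<lceil>real n / r\<rceil> = j} r = indicator {real n..} r * r powr (- 2)" for r :: real
      proof (cases "0 < r")
        case r: True
        define c where "c = \<lceil>real n / r\<rceil>"
        have "c \<le> int 1 \<longleftrightarrow> real n / real 1 \<le> r" unfolding c_def by (rule le_iff[OF r]) simp
        moreover have "0 < c" unfolding c_def by (rule pos[OF r])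
        ultimately have "nat c = j \<longleftrightarrow> real n \<le> r" using True by auto
        then have "nat \<lceil>real n / r\<rceil> = j \<longleftrightarrow> real n \<le> r" by (simp only: c_def)
        then show ?thesis using gt1[of 1] True by (auto simp: indicator_def)
      qed (use n in \<open>auto simp: indicator_def\<close>)
      then have "(\<lambda>r. indicator {1<..} r * r powr (- 2) * indicator {r. nat \<lceil>real n / r\<rceil> = j} r)
          = (\<lambda>r. indicator {real n..} r * r powr (- 2))" by (rule ext)
      then show ?thesis using integral_inverse_square_tail[of "real n"] n by (simp only:)
    next
      case False
      define a where "a = real n / real j"
      define b where "b = real n / real (j - 1)"
      have ab: "0 < a" "0 < b" "a \<le> b" "1 < a"
        using j False n gt1[of j] by (auto simp: a_def b_def intro!: divide_left_mono)
      have eq: "indicator {1<..} r * r powr (- 2) * indicator {r. nat \<lceil>real n / r\<rceil> = j} r =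
          indicator {a..} r * r powr (- 2) - indicator {b..} r * r powr (- 2)" for r :: real
      proof (cases "0 < r")
        case r: True
        have "nat \<lceil>real n / r\<rceil> = j \<longleftrightarrow> \<lceil>real n / r\<rceil> \<le> int j \<and> \<not> \<lceil>real n / r\<rceil> \<le> int (j - 1)"
          using pos[OF r] j False by auto
        also have "\<dots> \<longleftrightarrow> a \<le> r \<and> \<not> b \<le> r"
          using le_iff[OF r, of j] le_iff[OF r, of "j - 1"] j False by (simp add: a_def b_def)
        finally show ?thesis using ab by (auto simp: indicator_def)
      qed (use ab in \<open>auto simp: indicator_def\<close>)
      have "has_bochner_integral lborel (\<lambda>r. indicator {a..} r * r powr (- 2) - indicator {b..} r * r powr (- 2)) (1 / a - 1 / b)"
        by (intro has_bochner_integral_diff integral_inverse_square_tail ab)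
      moreover have "1 / a - 1 / b = 1 / real n"
        using j False n by (simp add: a_def b_def of_nat_diff diff_divide_distrib[symmetric])
      ultimately show ?thesis by (simp only: eq)
    qed
  qed (use g0 sum in auto)
  then show ?thesis by simp
qed

lemma scaling_limit:
  fixes f :: "nat \<Rightarrow> real" and a :: "nat \<Rightarrow> nat"
  assumes f: "(\<lambda>n. f n * real n powr s) \<longlonglongrightarrow> L"
    and a: "(\<lambda>n. real (a n) / real n) \<longlonglongrightarrow> \<rho>" and \<rho>: "0 < \<rho>"
  shows "(\<lambda>n. f (a n) * real n powr s) \<longlonglongrightarrow> L * \<rho> powr (- s)"
proof -
  have ev: "eventually (\<lambda>n. \<rho> / 2 < real (a n) / real n) sequentially"
    using a \<rho> by (intro order_tendstoD) auto
  have "filterlim (\<lambda>n. real (a n)) at_top sequentially"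
  proof (rule filterlim_at_top_mono)
    show "filterlim (\<lambda>n. \<rho> / 2 * real n) at_top sequentially"
      using \<rho> by (intro filterlim_tendsto_pos_mult_at_top[OF tendsto_const] filterlim_real_sequentially) auto
    show "eventually (\<lambda>n. \<rho> / 2 * real n \<le> real (a n)) sequentially"
      using ev eventually_gt_at_top[of 0] by eventually_elim (simp add: less_divide_eq)
  qed
  then have "filterlim a at_top sequentially"
    unfolding filterlim_at_top by (metis (mono_tags, lifting) eventually_mono of_nat_le_iff)
  then have "(\<lambda>n. f (a n) * real (a n) powr s) \<longlonglongrightarrow> L"
    using filterlim_compose[OF f] by blast
  moreover have "(\<lambda>n. (real (a n) / real n) powr (- s)) \<longlonglongrightarrow> \<rho> powr (- s)"
    using a \<rho> by (intro tendsto_intros) auto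
  ultimately have "(\<lambda>n. f (a n) * real (a n) powr s * (real (a n) / real n) powr (- s)) \<longlonglongrightarrow> L * \<rho> powr (- s)"
    by (rule tendsto_mult)
  moreover have "eventually (\<lambda>n. f (a n) * real (a n) powr s * (real (a n) / real n) powr (- s) = f (a n) * real n powr s) sequentially"
    using ev eventually_gt_at_top[of 0]
  proof eventually_elim
    case (elim n)
    then have "0 < real (a n) / real n" using \<rho> by linarith
    then have "0 < real (a n)" using elim by (simp add: zero_less_divide_iff)
    then show ?case using elim by (simp add: powr_divide powr_minus_divide)
  qed
  ultimately show ?thesis by (rule Lim_transform_eventually)
qed

lemma ceiling_ratio_limit:
  fixes r :: real
  assumes "0 < r"
  shows "(\<lambda>n. real (nat \<lceil>real n * r\<rceil>) / real n) \<longlonglongrightarrow> r"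
proof (rule tendsto_sandwich)
  show "eventually (\<lambda>n. r \<le> real (nat \<lceil>real n * r\<rceil>) / real n) sequentially"
    using eventually_gt_at_top[of 0]
    by eventually_elim (use assms in \<open>auto simp: le_divide_eq mult.commute real_nat_ceiling_ge\<close>)
  show "eventually (\<lambda>n. real (nat \<lceil>real n * r\<rceil>) / real n \<le> r + inverse (real n)) sequentially"
    using eventually_gt_at_top[of 0]
  proof eventually_elim
    case (elim n)
    have "0 \<le> real n * r" using assms by simp
    then have "real (nat \<lceil>real n * r\<rceil>) \<le> real n * r + 1" by linarith
    then have "real (nat \<lceil>real n * r\<rceil>) / real n \<le> (real n * r + 1) / real n" by (rule divide_right_mono) simp
    also have "\<dots> = r + inverse (real n)" using elim by (simp add: add_divide_distrib inverse_eq_divide)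
    finally show ?case .
  qed
  show "(\<lambda>n. r + inverse (real n)) \<longlonglongrightarrow> r"
    using tendsto_add[OF tendsto_const lim_inverse_n, of r] by simp
qed auto

lemma measurable_step [measurable]:
  fixes f :: "real \<Rightarrow> nat" and g :: "nat \<Rightarrow> real"
  assumes [measurable]: "f \<in> measurable borel (count_space UNIV)"
  shows "(\<lambda>r. g (f r)) \<in> borel_measurable borel"
  by (rule measurable_compose[OF assms]) simp

section \<open>Asymptotics of the Hardy weight\<close>

context hardy_pair
begin

definition decr :: "nat \<Rightarrow> real" where
  "decr n = u (int n) - u (int (Suc n))"

lemma decr_bounds:
  obtains c C where "0 < c" "0 < C" "\<And>n. c * (1 + real n) powr (- \<gamma> - 1) \<le> decr n"
    "\<And>n. decr n \<le> C * (1 + real n) powr (- \<gamma> - 1)"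
proof -
  obtain C where C: "0 < C" "\<And>n. u (int n) - u (int (Suc n)) \<le> C * (1 + real n) powr (- \<gamma> - 1)"
    by (rule u_step_upper) (rule that)
  obtain c C' where c: "0 < c" "0 < C'" "\<And>n. c * (1 + real n) powr (- \<gamma>) \<le> u (int n)" "\<And>n. u (int n) \<le> C' * (1 + real n) powr (- \<gamma>)"
    by (rule u_bounds) (rule that)
  have "\<gamma> * c * (1 + real n) powr (- \<gamma> - 1) \<le> decr n" for n
  proof -
    have "\<gamma> * c * (1 + real n) powr (- \<gamma> - 1) = \<gamma> * (c * (1 + real n) powr (- \<gamma>)) / (1 + real n)"
      by (simp add: powr_diff)
    also have "\<dots> \<le> \<gamma> * u (int n) / (real n + (1 + \<gamma>) / 2)"
      using \<gamma> c u_pos[of "int n"] u_coeff_pos(1)[of n]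
      by (intro frac_le mult_left_mono) (auto simp: add_divide_distrib)
    finally show ?thesis unfolding decr_def u_step .
  qed
  then show ?thesis using that[of "\<gamma> * c" C] C c \<gamma> by (simp add: decr_def)
qed

lemma decr_decr:
  obtains C where "0 < C" "\<And>n. 0 \<le> decr n - decr (Suc n)" "\<And>n. decr n - decr (Suc n) \<le> C * (1 + real n) powr (- \<gamma> - 2)"
proof -
  obtain c C where c: "0 < c" "0 < C" "\<And>n. c * (1 + real n) powr (- \<gamma>) \<le> u (int n)" "\<And>n. u (int n) \<le> C * (1 + real n) powr (- \<gamma>)"
    by (rule u_bounds) (rule that)
  define b where "b = (1 + \<gamma>) / 2"
  have b: "1 / 2 < b" "b < 1" "(1 - \<gamma>) / 2 = b - \<gamma>" using \<gamma> by (auto simp: b_def field_simps)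
  have formula: "decr n - decr (Suc n) = \<gamma> * (1 + \<gamma>) * u (int n) / ((real n + b) * (real n + 1 + b))" for n
  proof -
    have pos: "0 < real n + b" "0 < real n + 1 + b" using b by auto
    have U: "u (int (Suc n)) = (real n + b - \<gamma>) * u (int n) / (real n + b)"
      using u_rec[of n] pos(1) unfolding b(3) b_def[symmetric] by (simp add: eq_divide_eq add_diff_eq mult.commute)
    have "decr n - decr (Suc n) = \<gamma> * u (int n) / (real n + b) - \<gamma> * u (int (Suc n)) / (real n + 1 + b)"
      unfolding decr_def u_step b_def by (simp add: add_ac)
    also have "\<dots> = \<gamma> * (1 + \<gamma>) * u (int n) / ((real n + b) * (real n + 1 + b))"
      unfolding U using pos by (simp add: divide_simps) (simp add: algebra_simps)
    finally show ?thesis .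
  qed
  have "0 \<le> decr n - decr (Suc n)" for n
    unfolding formula using \<gamma> b u_pos[of "int n"] by (intro divide_nonneg_nonneg mult_nonneg_nonneg) auto
  moreover have "decr n - decr (Suc n) \<le> 4 * C * (1 + real n) powr (- \<gamma> - 2)" for n
  proof -
    have "\<gamma> * (1 + \<gamma>) \<le> 1 * 2" using \<gamma> by (intro mult_mono) auto
    then have "decr n - decr (Suc n) \<le> 2 * (C * (1 + real n) powr (- \<gamma>)) / (((1 + real n) / 2) * (1 + real n))"
      unfolding formula using \<gamma> b c(2) c(4)[of n] u_pos[of "int n"]
      by (intro frac_le mult_mono) auto
    also have "\<dots> = 4 * C * ((1 + real n) powr (- \<gamma>) / (1 + real n)\<^sup>2)" by (simp add: power2_eq_square)
    also have "\<dots> = 4 * C * (1 + real n) powr (- \<gamma> - 2)" by (simp add: powr_diff)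
    finally show ?thesis .
  qed
  ultimately show ?thesis using that[of "4 * C"] c by simp
qed

text \<open>Let \<open>A\<close> and \<open>B\<close> be the increments of \<open>u\<close> to
  the right and to the left of \<open>x\<close>. Both are of order \<open>Q = m
  x\<^sup>-\<^sup>\<gamma>\<^sup>-\<^sup>1\<close>, but their difference is a second difference
  and smaller by a factor \<open>m / x\<close>. Hence \<open>B\<^sup>p\<^sup>-\<^sup>1 -
  A\<^sup>p\<^sup>-\<^sup>1\<close> gains this factor over either term, and this makes the sum
  over \<open>m\<close> against the kernel converge for every \<open>p > 1\<close>.\<close>

lemma symmetric_pair_bound:
  obtains C where "0 < C" "\<And>x m. 1 \<le> m \<Longrightarrow> 2 * m \<le> x \<Longrightarrow>
    \<bar>signed_powr (u (int x) - u (int (x + m))) (p - 1) + signed_powr (u (int x) - u (int (x - m))) (p - 1)\<bar>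
      \<le> C * real m powr p * real x powr (- p) * u (int x) powr (p - 1)"
proof -
  define e where "e = p - 1"
  have e: "0 < e" using p by (simp add: e_def)
  obtain d D where dD: "0 < d" "0 < D" "\<And>n. d * (1 + real n) powr (- \<gamma> - 1) \<le> decr n"
      "\<And>n. decr n \<le> D * (1 + real n) powr (- \<gamma> - 1)"
    by (rule decr_bounds) (rule that)
  obtain D' where D': "0 < D'" "\<And>n. 0 \<le> decr n - decr (Suc n)" "\<And>n. decr n - decr (Suc n) \<le> D' * (1 + real n) powr (- \<gamma> - 2)"
    by (rule decr_decr) (rule that)
  obtain c C' where c: "0 < c" "0 < C'" "\<And>n. c * (1 + real n) powr (- \<gamma>) \<le> u (int n)" "\<And>n. u (int n) \<le> C' * (1 + real n) powr (- \<gamma>)"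
    by (rule u_bounds) (rule that)
  define c1 where "c1 = d * 3 powr (- \<gamma> - 1)"
  define C1 where "C1 = D * (1/2) powr (- \<gamma> - 1)"
  define C2 where "C2 = D' * (1/2) powr (- \<gamma> - 2)"
  define C3 where "C3 = e * (c1 powr (e - 1) + C1 powr (e - 1)) * C2"
  define c4 where "c4 = (c * 2 powr (- \<gamma>)) powr e"
  have pos: "0 < c1" "0 < C1" "0 < C2" "0 < C3" "0 < c4"
    using dD D' c e by (auto simp: c1_def C1_def C2_def C3_def c4_def add_pos_pos)
  have anti: "decr j \<le> decr i" if "i \<le> j" for i j
    using lift_Suc_antimono_le[of decr i j] D'(2) that by simp
  have slope: "decr j - decr (j + m) \<le> real m * (D' * (1 + real j) powr (- \<gamma> - 2))" for j m
  proof -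
    have "decr j - decr (j + m) = (\<Sum>i<m. decr (j + i) - decr (Suc (j + i)))"
      using sum_lessThan_telescope'[of "\<lambda>i. decr (j + i)" m] by simp
    also have "\<dots> \<le> (\<Sum>i<m. D' * (1 + real j) powr (- \<gamma> - 2))"
    proof (rule sum_mono)
      fix i
      have "decr (j + i) - decr (Suc (j + i)) \<le> D' * (1 + real (j + i)) powr (- \<gamma> - 2)" by (rule D')
      also have "\<dots> \<le> D' * (1 + real j) powr (- \<gamma> - 2)"
        using D' \<gamma> by (intro mult_left_mono powr_mono2') auto
      finally show "decr (j + i) - decr (Suc (j + i)) \<le> D' * (1 + real j) powr (- \<gamma> - 2)" .
    qed
    finally show ?thesis by simp
  qed
  have main: "\<bar>signed_powr (u (int x) - u (int (x + m))) e + signed_powr (u (int x) - u (int (x - m))) e\<bar>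
      \<le> C3 / c4 * real m powr p * real x powr (- p) * u (int x) powr e"
    if m: "1 \<le> m" "2 * m \<le> x" for x m
  proof -
    define A where "A = u (int x) - u (int (x + m))"
    define B where "B = u (int (x - m)) - u (int x)"
    define Q where "Q = real m * real x powr (- \<gamma> - 1)"
    have x: "1 \<le> real x" "0 < real x" "0 < real m" using m by auto
    have Q: "0 < Q" using x by (simp add: Q_def)
    have A_sum: "A = (\<Sum>i<m. decr (x + i))"
      using sum_lessThan_telescope'[of "\<lambda>i. u (int (x + i))" m] by (simp add: A_def decr_def)
    have B_sum: "B = (\<Sum>i<m. decr (x - m + i))"
      using sum_lessThan_telescope'[of "\<lambda>i. u (int (x - m + i))" m] m by (simp add: B_def decr_def add_ac)
    have half: "1 / 2 * real x \<le> 1 + real (x - m + i)" for i using m by (simp add: of_nat_diff)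
    have A_low: "c1 * Q \<le> A"
    proof -
      have "c1 * Q = (\<Sum>i<m. d * (3 * real x) powr (- \<gamma> - 1))"
        using x by (simp add: c1_def Q_def powr_mult)
      also have "\<dots> \<le> A" unfolding A_sum
      proof (rule sum_mono)
        fix i assume "i \<in> {..<m}"
        then have "1 + real (x + i) \<le> 3 * real x" using m by simp
        then have "d * (3 * real x) powr (- \<gamma> - 1) \<le> d * (1 + real (x + i)) powr (- \<gamma> - 1)"
          using dD \<gamma> by (intro mult_left_mono powr_mono2') auto
        then show "d * (3 * real x) powr (- \<gamma> - 1) \<le> decr (x + i)" using dD(3)[of "x + i"] by simp
      qed
      finally show ?thesis .
    qed
    have B_up: "B \<le> C1 * Q"
    proof -
      have "B \<le> (\<Sum>i<m. D * (1 / 2 * real x) powr (- \<gamma> - 1))" unfolding B_sum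
      proof (rule sum_mono)
        fix i
        have "D * (1 + real (x - m + i)) powr (- \<gamma> - 1) \<le> D * (1 / 2 * real x) powr (- \<gamma> - 1)"
          using dD \<gamma> half x by (intro mult_left_mono powr_mono2') auto
        then show "decr (x - m + i) \<le> D * (1 / 2 * real x) powr (- \<gamma> - 1)" using dD(4)[of "x - m + i"] by simp
      qed
      also have "\<dots> = real m * (D * ((1 / 2) powr (- \<gamma> - 1) * real x powr (- \<gamma> - 1)))"
        using x by (simp only: sum_constant powr_mult card_lessThan)
      also have "\<dots> = C1 * Q" by (simp add: C1_def Q_def)
      finally show ?thesis .
    qed
    have BA: "0 \<le> B - A" "B - A \<le> C2 * (Q * real m / real x)"
    proof -
      have eq: "B - A = (\<Sum>i<m. decr (x - m + i) - decr (x - m + i + m))"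
        using m unfolding A_sum B_sum sum_subtractf[symmetric] by (intro sum.cong) (auto simp: add_ac)
      show "0 \<le> B - A" unfolding eq using anti by (intro sum_nonneg) simp
      have "B - A \<le> (\<Sum>i<m. real m * (D' * (1 / 2 * real x) powr (- \<gamma> - 2)))" unfolding eq
      proof (rule sum_mono)
        fix i
        have "real m * (D' * (1 + real (x - m + i)) powr (- \<gamma> - 2)) \<le> real m * (D' * (1 / 2 * real x) powr (- \<gamma> - 2))"
          using D' \<gamma> half x by (intro mult_left_mono powr_mono2') auto
        then show "decr (x - m + i) - decr (x - m + i + m) \<le> real m * (D' * (1 / 2 * real x) powr (- \<gamma> - 2))"
          using slope[of "x - m + i" m] by linarith
      qed
      also have "\<dots> = C2 * (real m * real m * real x powr (- \<gamma> - 2))"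
        using x unfolding C2_def by (simp only: sum_constant powr_mult card_lessThan) simp
      also have "real x powr (- \<gamma> - 2) = real x powr (- \<gamma> - 1) / real x"
      proof -
        have "- \<gamma> - 2 = (- \<gamma> - 1) - 1" by simp
        then show ?thesis using x by (simp only: powr_diff) simp
      qed
      finally show "B - A \<le> C2 * (Q * real m / real x)" by (simp add: Q_def mult_ac)
    qed
    have A0: "0 < A" using A_low pos Q by (meson less_le_trans mult_pos_pos)
    have diff: "B powr e - A powr e \<le> C3 * (Q powr e * real m / real x)"
    proof (cases "A = B")
      case True
      then show ?thesis using pos Q x by simp
    next
      case False
      then have AB: "A < B" using BA by simp
      obtain \<xi> where \<xi>: "A < \<xi>" "\<xi> < B" "B powr e - A powr e = e * \<xi> powr (e - 1) * (B - A)"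
        using powr_mean_value[of A B e] A0 AB e by auto
      have "\<xi> powr (e - 1) \<le> (c1 powr (e - 1) + C1 powr (e - 1)) * Q powr (e - 1)"
      \<comment> \<open>The exponent \<open>e - 1\<close> may have either sign; the two-sided
        bound on \<open>\<xi>\<close> covers both cases.\<close>
      proof (cases "1 \<le> e")
        case True
        have "\<xi> powr (e - 1) \<le> (C1 * Q) powr (e - 1)" using \<xi> A0 B_up True by (intro powr_mono2) auto
        also have "\<dots> = C1 powr (e - 1) * Q powr (e - 1)" using pos Q by (simp add: powr_mult)
        finally show ?thesis by (simp add: distrib_right add_increasing)
      next
        case False
        have "\<xi> powr (e - 1) \<le> (c1 * Q) powr (e - 1)" using \<xi> A_low pos Q False by (intro powr_mono2') auto
        also have "\<dots> = c1 powr (e - 1) * Q powr (e - 1)" using pos Q by (simp add: powr_mult)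
        finally show ?thesis by (simp add: distrib_right add_increasing2)
      qed
      then have "e * \<xi> powr (e - 1) * (B - A) \<le> e * ((c1 powr (e - 1) + C1 powr (e - 1)) * Q powr (e - 1)) * (C2 * (Q * real m / real x))"
        using e BA by (intro mult_mono) auto
      also have "\<dots> = C3 * ((Q powr (e - 1) * Q) * real m / real x)" by (simp add: C3_def)
      also have "Q powr (e - 1) * Q = Q powr e" using Q by (simp add: powr_diff)
      finally show ?thesis using \<xi>(3) by simp
    qed
    have u_low: "c4 * real x powr (- (\<gamma> * e)) \<le> u (int x) powr e"
    proof -
      have "c * (2 powr (- \<gamma>) * real x powr (- \<gamma>)) = c * (2 * real x) powr (- \<gamma>)" using x by (simp add: powr_mult)
      also have "\<dots> \<le> c * (1 + real x) powr (- \<gamma>)" using c \<gamma> x by (intro mult_left_mono powr_mono2') auto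
      also have "\<dots> \<le> u (int x)" by (rule c)
      finally have "(c * (2 powr (- \<gamma>) * real x powr (- \<gamma>))) powr e \<le> u (int x) powr e" using c e by (intro powr_mono2) auto
      moreover have "(c * (2 powr (- \<gamma>) * real x powr (- \<gamma>))) powr e = c4 * real x powr (- (\<gamma> * e))"
        using c x by (simp add: c4_def powr_mult powr_powr)
      ultimately show ?thesis by simp
    qed
    have "Q powr e * real m / real x = real m powr p * real x powr (- p) * real x powr (- (\<gamma> * e))"
    proof -
      have "real x powr ((- \<gamma> - 1) * e) = real x powr (- p + 1 + - (\<gamma> * e))"
        by (rule arg_cong) (simp add: e_def algebra_simps)
      also have "\<dots> = real x powr (- p) * real x * real x powr (- (\<gamma> * e))"
        using x by (simp only: powr_add) simp
      finally have "real x powr ((- \<gamma> - 1) * e) = real x powr (- p) * real x * real x powr (- (\<gamma> * e))" .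
      moreover have "real m powr p = real m powr e * real m" using x powr_add[of "real m" e 1] by (simp add: e_def)
      ultimately show ?thesis using x by (simp add: Q_def powr_mult powr_powr)
    qed
    then have "C3 * (Q powr e * real m / real x) = C3 / c4 * real m powr p * real x powr (- p) * (c4 * real x powr (- (\<gamma> * e)))"
      using pos by simp
    also have "\<dots> \<le> C3 / c4 * real m powr p * real x powr (- p) * u (int x) powr e"
      using u_low pos by (intro mult_left_mono) auto
    finally have "B powr e - A powr e \<le> C3 / c4 * real m powr p * real x powr (- p) * u (int x) powr e" using diff by simp
    moreover have "A powr e \<le> B powr e" using A0 BA e by (intro powr_mono2) auto
    moreover have "signed_powr (u (int x) - u (int (x + m))) e = A powr e"
      unfolding A_def[symmetric] using A0 by (simp add: signed_powr_nonneg)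
    moreover have "signed_powr (u (int x) - u (int (x - m))) e = - (B powr e)"
    proof -
      have "u (int x) - u (int (x - m)) = - B" by (simp add: B_def)
      then show ?thesis using A0 BA by (simp add: signed_powr_minus signed_powr_nonneg)
    qed
    ultimately show ?thesis by simp
  qed
  show ?thesis
  proof
    show "0 < C3 / c4" using pos by simp
  qed (use main in \<open>simp add: e_def\<close>)
qed

text \<open>Normalised by \<open>u x\<close>, so that the sum over \<open>y\<close> is \<open>w
  x\<close> itself.\<close>

definition w_summand :: "int \<Rightarrow> int \<Rightarrow> real" where
  "w_summand x y = k (x - y) * signed_powr (1 - u y / u x) (p - 1)"

lemma w_summand_has_sum: "(w_summand x has_sum w x) UNIV"
proof -
  have "((\<lambda>y. k (x - y) * signed_powr (u x - u y) (p - 1) * (1 / u x powr (p - 1))) has_sum w x) UNIV"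
    using has_sum_cmult_left[OF frac_p_laplace_has_sum[OF u_in_formal_domain, of x], of "1 / u x powr (p - 1)"]
    by (simp add: w_def)
  moreover have "k (x - y) * signed_powr (u x - u y) (p - 1) * (1 / u x powr (p - 1)) = w_summand x y" for y
    using signed_powr_divide[OF u_pos, of "u x - u y" x "p - 1"] u_pos[of x] by (simp add: w_summand_def diff_divide_distrib)
  ultimately show ?thesis by simp
qed

lemma w_minus: "w (- x) = w x"
proof -
  have "bij_betw uminus (UNIV :: int set) UNIV" by (rule bij_betwI[of _ _ _ uminus]) auto
  then have "((\<lambda>y. w_summand x (- y)) has_sum w x) UNIV"
    using w_summand_has_sum[of x] has_sum_reindex_bij_betw[of uminus UNIV UNIV "w_summand x"] by simp
  moreover have "w_summand x (- y) = w_summand (- x) y" for y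
    using k_minus[of "x + y"] by (simp add: w_summand_def add.commute)
  ultimately show ?thesis using w_summand_has_sum[of "- x"] has_sum_unique by fastforce
qed

definition folded_kernel :: "nat \<Rightarrow> nat \<Rightarrow> real" where
  "folded_kernel n j = k (int n - int j) + k (int n + int j)"

text \<open>The parameter \<open>\<delta>\<close> cuts out the sites near \<open>n\<close>; the
  summands above the cut are nonnegative, those below are nonpositive and are taken with the
  opposite sign in the next definition.\<close>

definition upper_part :: "real \<Rightarrow> nat \<Rightarrow> nat \<Rightarrow> real" where
  "upper_part \<delta> n j = (if (1 + \<delta>) * real n < real j then folded_kernel n j * (1 - u (int j) / u (int n)) powr (p - 1) else 0)"

definition lower_part :: "real \<Rightarrow> nat \<Rightarrow> nat \<Rightarrow> real" where
  "lower_part \<delta> n j = (if 1 \<le> j \<and> real j < (1 - \<delta>) * real n then folded_kernel n j * (u (int j) / u (int n) - 1) powr (p - 1) else 0)"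

lemma folded_kernel_nonneg: "0 \<le> folded_kernel n j"
  by (simp add: folded_kernel_def k_nonneg)

lemma folded_kernel_upper:
  obtains C where "0 < C"
    "\<And>n j a. 0 < a \<Longrightarrow> a \<le> \<bar>real n - real j\<bar> \<Longrightarrow> folded_kernel n j \<le> C * a powr (- 1 - S)"
proof -
  obtain C where C: "0 < C" "\<And>n. n \<ge> 1 \<Longrightarrow> k (int n) \<le> C * real n powr (- 1 - S)"
    using k_upper by blast
  have kz: "k z \<le> C * a powr (- 1 - S)" if a: "0 < a" "a \<le> of_int \<bar>z\<bar>" for a :: real and z
  proof -
    have "k z = k (int (nat \<bar>z\<bar>))" by (cases "0 \<le> z") auto
    also have "\<dots> \<le> C * real (nat \<bar>z\<bar>) powr (- 1 - S)" using a by (intro C) (cases "z = 0"; auto)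
    also have "\<dots> \<le> C * a powr (- 1 - S)" using a C S by (intro mult_left_mono powr_mono2') auto
    finally show ?thesis .
  qed
  have bound: "folded_kernel n j \<le> 2 * C * a powr (- 1 - S)" if "0 < a" "a \<le> \<bar>real n - real j\<bar>" for n j a
  proof -
    have "a \<le> real n + real j" using that by linarith
    then show ?thesis using kz[of a "int n - int j"] kz[of a "int n + int j"] that by (simp add: folded_kernel_def)
  qed
  show ?thesis by (rule that[of "2 * C", OF _ bound]) (use C in simp)
qed

lemma u_ratio_bound:
  obtains C where "0 < C" "\<And>n j. u (int j) / u (int n) \<le> C * ((1 + real n) / (1 + real j)) powr \<gamma>"
proof -
  obtain c C where c: "0 < c" "0 < C" "\<And>n. c * (1 + real n) powr (- \<gamma>) \<le> u (int n)" "\<And>n. u (int n) \<le> C * (1 + real n) powr (- \<gamma>)"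
    by (rule u_bounds) (rule that)
  have "u (int j) / u (int n) \<le> C / c * ((1 + real n) / (1 + real j)) powr \<gamma>" for n j
  proof -
    have "u (int j) / u (int n) \<le> (C * (1 + real j) powr (- \<gamma>)) / (c * (1 + real n) powr (- \<gamma>))"
      using c(1,2) c(3)[of n] c(4)[of j] u_pos[of "int j"] by (intro frac_le) auto
    also have "\<dots> = C / c * ((1 + real n) / (1 + real j)) powr \<gamma>"
      by (simp add: powr_divide powr_minus_divide)
    finally show ?thesis .
  qed
  then show ?thesis using that[of "C / c"] c by simp
qed

lemma u_ratio_limit:
  assumes "(\<lambda>n. real (a n) / real n) \<longlonglongrightarrow> \<rho>" "0 < \<rho>"
  shows "(\<lambda>n. u (int (a n)) / u (int n)) \<longlonglongrightarrow> \<rho> powr (- \<gamma>)"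
proof -
  obtain L where L: "0 < L" "(\<lambda>n. u (int n) * real n powr \<gamma>) \<longlonglongrightarrow> L" by (rule u_asymptotics)
  have "(\<lambda>n. (u (int (a n)) * real n powr \<gamma>) / (u (int n) * real n powr \<gamma>)) \<longlonglongrightarrow> (L * \<rho> powr (- \<gamma>)) / L"
    using L by (intro tendsto_divide scaling_limit[OF L(2) assms]) auto
  then have "(\<lambda>n. (u (int (a n)) * real n powr \<gamma>) / (u (int n) * real n powr \<gamma>)) \<longlonglongrightarrow> \<rho> powr (- \<gamma>)"
    using L by simp
  then show ?thesis
    by (rule Lim_transform_eventually) (use eventually_gt_at_top[of 0] in eventually_elim, simp)
qed

definition k_const :: real where
  "k_const = (SOME L. 0 < L \<and> (\<lambda>n. k (int n) * real n powr (1 + S)) \<longlonglongrightarrow> L)"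

lemma k_const: "0 < k_const" "(\<lambda>n. k (int n) * real n powr (1 + S)) \<longlonglongrightarrow> k_const"
proof -
  have "\<exists>L. 0 < L \<and> (\<lambda>n. k (int n) * real n powr (1 + S)) \<longlonglongrightarrow> L"
    by (rule k_asymptotics) blast
  from someI_ex[OF this] show "0 < k_const" "(\<lambda>n. k (int n) * real n powr (1 + S)) \<longlonglongrightarrow> k_const"
    unfolding k_const_def by auto
qed

text \<open>Both distances \<open>\<bar>n - a n\<bar>\<close> and \<open>n + a n\<close> are
  asymptotically proportional to \<open>n\<close>, so the power law of the kernel applies to
  each of them.\<close>

lemma folded_kernel_limit:
  assumes a: "(\<lambda>n. real (a n) / real n) \<longlonglongrightarrow> \<rho>" "0 < \<rho>" "\<rho> \<noteq> 1"
  shows "(\<lambda>n. folded_kernel n (a n) * real n powr (1 + S)) \<longlonglongrightarrow>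
     k_const * \<bar>\<rho> - 1\<bar> powr (- 1 - S) + k_const * (\<rho> + 1) powr (- 1 - S)"
proof -
  have pos: "eventually (\<lambda>n. 0 < n) sequentially" by (rule eventually_gt_at_top)
  have "(\<lambda>n. \<bar>real (a n) / real n - 1\<bar>) \<longlonglongrightarrow> \<bar>\<rho> - 1\<bar>" by (intro tendsto_intros a)
  then have "(\<lambda>n. real (nat \<bar>int n - int (a n)\<bar>) / real n) \<longlonglongrightarrow> \<bar>\<rho> - 1\<bar>"
  proof (rule Lim_transform_eventually)
    show "eventually (\<lambda>n. \<bar>real (a n) / real n - 1\<bar> = real (nat \<bar>int n - int (a n)\<bar>) / real n) sequentially"
      using pos
    proof eventually_elim
      case (elim n)
      have "\<bar>real (a n) / real n - 1\<bar> = \<bar>(real (a n) - real n) / real n\<bar>" using elim by (simp add: diff_divide_distrib)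
      also have "\<dots> = real (nat \<bar>int n - int (a n)\<bar>) / real n" by (simp add: abs_divide abs_minus_commute)
      finally show ?case .
    qed
  qed
  then have "(\<lambda>n. k (int (nat \<bar>int n - int (a n)\<bar>)) * real n powr (1 + S)) \<longlonglongrightarrow> k_const * \<bar>\<rho> - 1\<bar> powr (- (1 + S))"
    using a by (intro scaling_limit[OF k_const(2)]) auto
  moreover have "k (int (nat \<bar>int n - int (a n)\<bar>)) = k (int n - int (a n))" for n
    using k_minus[of "int n - int (a n)"] by (cases "int n \<le> int (a n)") auto
  moreover have "(\<lambda>n. real (n + a n) / real n) \<longlonglongrightarrow> \<rho> + 1"
  proof (rule Lim_transform_eventually)
    show "(\<lambda>n. real (a n) / real n + 1) \<longlonglongrightarrow> \<rho> + 1" by (intro tendsto_intros a)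
    show "eventually (\<lambda>n. real (a n) / real n + 1 = real (n + a n) / real n) sequentially"
      using pos by eventually_elim (simp add: add_divide_distrib)
  qed
  then have "(\<lambda>n. k (int (n + a n)) * real n powr (1 + S)) \<longlonglongrightarrow> k_const * (\<rho> + 1) powr (- (1 + S))"
    using a by (intro scaling_limit[OF k_const(2)]) auto
  ultimately show ?thesis
    unfolding folded_kernel_def distrib_right by (intro tendsto_add) simp_all
qed

text \<open>The pointwise limit of the rescaled terms of the upper part, as a function of
  \<open>r = j / n\<close>.\<close>

definition upper_profile :: "real \<Rightarrow> real" where
  "upper_profile r = (k_const * \<bar>r - 1\<bar> powr (- 1 - S) + k_const * (r + 1) powr (- 1 - S)) * (1 - r powr (- \<gamma>)) powr (p - 1)"

text \<open>The pointwise limit of the rescaled terms of the lower part, as a function of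
  \<open>r = n / j\<close>, including the density \<open>r\<close> to the power
  \<open>-2\<close>.\<close>

definition lower_profile :: "real \<Rightarrow> real" where
  "lower_profile r = r powr (- 2) * ((k_const * \<bar>1 / r - 1\<bar> powr (- 1 - S) + k_const * (1 / r + 1) powr (- 1 - S)) *
     ((1 / r) powr (- \<gamma>) - 1) powr (p - 1))"

lemma powr_minus_\<gamma>_less: "1 < r \<Longrightarrow> r powr (- \<gamma>) < 1"
  using powr_less_mono[of "- \<gamma>" 0 r] \<gamma> by simp

lemma upper_profile_pos: "1 < r \<Longrightarrow> 0 < upper_profile r"
  using powr_minus_\<gamma>_less[of r] k_const(1) unfolding upper_profile_def
  by (intro mult_pos_pos add_pos_pos) auto

text \<open>The homogeneity of the profile under \<open>r \<mapsto> 1 / r\<close>, from which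
  the sign of the limit of the weight is read off.\<close>

lemma lower_profile_eq:
  assumes "1 < r"
  shows "lower_profile r = upper_profile r * r powr (S + \<gamma> * (p - 1) - 1)"
proof -
  have "(1 / r) powr (- \<gamma>) - 1 = r powr \<gamma> * (1 - r powr (- \<gamma>))"
    using assms by (simp add: powr_divide powr_minus_divide field_simps)
  then have 1: "((1 / r) powr (- \<gamma>) - 1) powr (p - 1) = r powr (\<gamma> * (p - 1)) * (1 - r powr (- \<gamma>)) powr (p - 1)"
    using powr_minus_\<gamma>_less[OF assms] assms by (simp add: powr_mult powr_powr)
  have "\<bar>1 / r - 1\<bar> = \<bar>r - 1\<bar> / r" using assms by (simp add: field_simps)
  then have 2: "\<bar>1 / r - 1\<bar> powr (- 1 - S) = \<bar>r - 1\<bar> powr (- 1 - S) * r powr (1 + S)"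
    using assms powr_divide_minus[of "\<bar>r - 1\<bar>" r "- 1 - S"] by (simp add: add.commute)
  have "1 / r + 1 = (r + 1) / r" using assms by (simp add: field_simps)
  then have 3: "(1 / r + 1) powr (- 1 - S) = (r + 1) powr (- 1 - S) * r powr (1 + S)"
    using assms powr_divide_minus[of "r + 1" r "- 1 - S"] by (simp add: add.commute)
  have "lower_profile r = upper_profile r * (r powr (- 2) * r powr (1 + S) * r powr (\<gamma> * (p - 1)))"
    unfolding lower_profile_def upper_profile_def 1 2 3 by (simp add: algebra_simps)
  also have "r powr (- 2) * r powr (1 + S) * r powr (\<gamma> * (p - 1)) = r powr (- 2 + (1 + S) + \<gamma> * (p - 1))"
    by (simp only: powr_add)
  also have "- 2 + (1 + S) + \<gamma> * (p - 1) = S + \<gamma> * (p - 1) - 1" by simp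
  finally show ?thesis .
qed

lemma upper_part_le:
  assumes "0 < \<delta>" "\<delta> \<le> 1"
  obtains C where "0 < C" "\<And>n r. 1 \<le> n \<Longrightarrow> 1 < r \<Longrightarrow> real n powr (1 + S) * upper_part \<delta> n (nat \<lceil>real n * r\<rceil>) \<le> C * r powr (- 1 - S)"
proof -
  define b where "b = \<delta> / 2"
  have b: "0 < b" "b \<le> 1 / 2" "\<delta> = 2 * b" using assms by (auto simp: b_def)
  obtain C where C: "0 < C" "\<And>n j a. 0 < a \<Longrightarrow> a \<le> \<bar>real n - real j\<bar> \<Longrightarrow> folded_kernel n j \<le> C * a powr (- 1 - S)"
    by (rule folded_kernel_upper) (rule that)
  have "real n powr (1 + S) * upper_part \<delta> n (nat \<lceil>real n * r\<rceil>) \<le> C * b powr (- 1 - S) * r powr (- 1 - S)"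
    if n: "1 \<le> n" and r: "1 < r" for n r
  proof -
    define j where "j = nat \<lceil>real n * r\<rceil>"
    have j: "real n * r \<le> real j" by (simp add: j_def real_nat_ceiling_ge)
    show ?thesis
    proof (cases "(1 + \<delta>) * real n < real j")
      case True
      \<comment> \<open>As \<open>j\<close> exceeds \<open>(1 + \<delta>) n\<close>, the
        distance \<open>j - n\<close> is at least the fraction \<open>b = \<delta> / 2\<close>
        of \<open>j\<close>, and \<open>j\<close> is at least \<open>n r\<close>.\<close>
      have "real n \<le> real j / (1 + \<delta>)" using True assms by (simp add: le_divide_eq mult.commute)
      moreover have "real j / (1 + \<delta>) \<le> real j * (1 - b)"
      proof -
        have "b * b \<le> b * (1 / 2)" using b by (intro mult_left_mono) auto
        then have "1 \<le> (1 - b) * (1 + \<delta>)" unfolding b(3) by (simp add: algebra_simps)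
        then have "1 / (1 + \<delta>) \<le> 1 - b" using assms by (simp add: divide_le_eq)
        then have "real j * (1 / (1 + \<delta>)) \<le> real j * (1 - b)" by (intro mult_left_mono) auto
        then show ?thesis by simp
      qed
      ultimately have "real j * b \<le> real j - real n" by (simp add: algebra_simps)
      moreover have "real n * r * b \<le> real j * b" using j b by (intro mult_right_mono) auto
      ultimately have a: "real n * r * b \<le> \<bar>real n - real j\<bar>" by linarith
      have "1 * real n \<le> (1 + \<delta>) * real n" using assms by (intro mult_right_mono) auto
      then have "n \<le> j" using True by linarith
      then have "u (int j) \<le> u (int n)" by (rule u_nat_antimono)
      then have "0 \<le> 1 - u (int j) / u (int n)" "1 - u (int j) / u (int n) \<le> 1"
        using u_pos[of "int n"] u_pos[of "int j"] by (auto simp: divide_le_eq)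
      then have "(1 - u (int j) / u (int n)) powr (p - 1) \<le> 1 powr (p - 1)" using p by (intro powr_mono2) auto
      then have "folded_kernel n j * (1 - u (int j) / u (int n)) powr (p - 1) \<le> folded_kernel n j * 1 powr (p - 1)"
        by (intro mult_left_mono folded_kernel_nonneg)
      then have "upper_part \<delta> n j \<le> folded_kernel n j * 1"
        using True by (simp add: upper_part_def)
      also have "\<dots> \<le> C * (real n * r * b) powr (- 1 - S)"
        using C(2)[OF _ a] n r b by simp
      also have "\<dots> = C * b powr (- 1 - S) * r powr (- 1 - S) * real n powr (- (1 + S))"
        using n r b by (simp add: powr_mult)
      finally have "real n powr (1 + S) * upper_part \<delta> n j \<le>
          real n powr (1 + S) * (C * b powr (- 1 - S) * r powr (- 1 - S) * real n powr (- (1 + S)))"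
        by (intro mult_left_mono) auto
      also have "\<dots> = C * b powr (- 1 - S) * r powr (- 1 - S) * (real n powr (1 + S) * real n powr (- (1 + S)))"
        by simp
      also have "real n powr (1 + S) * real n powr (- (1 + S)) = 1" using n unfolding powr_add[symmetric] by simp
      finally show ?thesis by (simp add: j_def)
    next
      case False
      then show ?thesis using C(1) by (simp add: upper_part_def j_def)
    qed
  qed
  then show ?thesis using that[of "C * b powr (- 1 - S)"] C b by simp
qed

lemma lower_part_le:
  assumes "0 < \<delta>" "\<delta> < 1"
  obtains C where "0 < C" "\<And>n r. 1 \<le> n \<Longrightarrow> 1 < r \<Longrightarrow> real n powr (1 + S) * lower_part \<delta> n (nat \<lceil>real n / r\<rceil>) \<le> C * r powr (\<gamma> * (p - 1))"
proof -
  obtain C where C: "0 < C" "\<And>n j a. 0 < a \<Longrightarrow> a \<le> \<bar>real n - real j\<bar> \<Longrightarrow> folded_kernel n j \<le> C * a powr (- 1 - S)"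
    by (rule folded_kernel_upper) (rule that)
  obtain D where D: "0 < D" "\<And>n j. u (int j) / u (int n) \<le> D * ((1 + real n) / (1 + real j)) powr \<gamma>"
    by (rule u_ratio_bound) (rule that)
  have "real n powr (1 + S) * lower_part \<delta> n (nat \<lceil>real n / r\<rceil>) \<le> C * \<delta> powr (- 1 - S) * D powr (p - 1) * r powr (\<gamma> * (p - 1))"
    if n: "1 \<le> n" and r: "1 < r" for n r
  proof -
    define j where "j = nat \<lceil>real n / r\<rceil>"
    have j: "real n / r \<le> real j" by (simp add: j_def real_nat_ceiling_ge)
    show ?thesis
    proof (cases "1 \<le> j \<and> real j < (1 - \<delta>) * real n")
      case True
      then have "real j < real n - \<delta> * real n" by (simp add: algebra_simps)
      then have a: "\<delta> * real n \<le> \<bar>real n - real j\<bar>" by linarith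
      have "(1 - \<delta>) * real n \<le> 1 * real n" using assms by (intro mult_right_mono) auto
      then have "j \<le> n" using True by linarith
      then have "u (int n) \<le> u (int j)" by (rule u_nat_antimono)
      then have ge: "0 \<le> u (int j) / u (int n) - 1" using u_pos[of "int n"] by (simp add: le_divide_eq)
      have "real n \<le> real j * r" using j r by (simp add: divide_le_eq)
      then have "1 + real n \<le> r * (1 + real j)" using r by (simp add: algebra_simps)
      then have "(1 + real n) / (1 + real j) \<le> r" by (simp add: divide_le_eq)
      then have "D * ((1 + real n) / (1 + real j)) powr \<gamma> \<le> D * r powr \<gamma>"
        using D \<gamma> by (intro mult_left_mono powr_mono2) auto
      then have "u (int j) / u (int n) - 1 \<le> D * r powr \<gamma>" using D(2)[of j n] by linarith
      then have "(u (int j) / u (int n) - 1) powr (p - 1) \<le> (D * r powr \<gamma>) powr (p - 1)"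
        using ge p by (intro powr_mono2) auto
      also have "\<dots> = D powr (p - 1) * r powr (\<gamma> * (p - 1))" using D r by (simp add: powr_mult powr_powr)
      finally have "folded_kernel n j * (u (int j) / u (int n) - 1) powr (p - 1) \<le> folded_kernel n j * (D powr (p - 1) * r powr (\<gamma> * (p - 1)))"
        by (intro mult_left_mono folded_kernel_nonneg)
      then have "lower_part \<delta> n j \<le> folded_kernel n j * (D powr (p - 1) * r powr (\<gamma> * (p - 1)))"
        using True by (simp add: lower_part_def)
      also have "\<dots> \<le> C * (\<delta> * real n) powr (- 1 - S) * (D powr (p - 1) * r powr (\<gamma> * (p - 1)))"
        using C(2)[OF _ a] n assms by (intro mult_right_mono) auto
      also have "\<dots> = C * \<delta> powr (- 1 - S) * D powr (p - 1) * r powr (\<gamma> * (p - 1)) * real n powr (- (1 + S))"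
        using n assms by (simp add: powr_mult)
      finally have "real n powr (1 + S) * lower_part \<delta> n j \<le>
          real n powr (1 + S) * (C * \<delta> powr (- 1 - S) * D powr (p - 1) * r powr (\<gamma> * (p - 1)) * real n powr (- (1 + S)))"
        by (intro mult_left_mono) auto
      also have "\<dots> = C * \<delta> powr (- 1 - S) * D powr (p - 1) * r powr (\<gamma> * (p - 1)) * (real n powr (1 + S) * real n powr (- (1 + S)))"
        by simp
      also have "real n powr (1 + S) * real n powr (- (1 + S)) = 1" using n unfolding powr_add[symmetric] by simp
      finally show ?thesis by (simp add: j_def)
    next
      case False
      then show ?thesis using C(1) D(1) by (auto simp: lower_part_def j_def)
    qed
  qed
  then show ?thesis using that[of "C * \<delta> powr (- 1 - S) * D powr (p - 1)"] C D assms by simp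
qed

lemma profiles_measurable [measurable]: "upper_profile \<in> borel_measurable borel" "lower_profile \<in> borel_measurable borel"
  unfolding upper_profile_def[abs_def] lower_profile_def[abs_def] by measurable

lemma upper_part_nonneg: "0 \<le> upper_part \<delta> n j"
  by (simp add: upper_part_def folded_kernel_nonneg)

lemma lower_part_nonneg: "0 \<le> lower_part \<delta> n j"
  by (simp add: lower_part_def folded_kernel_nonneg)

definition folded_summand :: "nat \<Rightarrow> nat \<Rightarrow> real" where
  "folded_summand n j = (if j = 0 then 0 else w_summand (int n) (int j) + w_summand (int n) (- int j))"

lemma folded_summand_sums: "folded_summand n sums (w (int n) - w_summand (int n) 0)" and folded_summand_summable: "summable (\<lambda>j. \<bar>folded_summand n j\<bar>)"
  using has_sum_int_split[OF w_summand_has_sum[of "int n"]] by (simp_all add: folded_summand_def[abs_def])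

lemma folded_summand_eq: "j \<noteq> 0 \<Longrightarrow> folded_summand n j = folded_kernel n j * signed_powr (1 - u (int j) / u (int n)) (p - 1)"
  by (simp add: folded_summand_def w_summand_def folded_kernel_def distrib_right)

lemma folded_summand_above:
  assumes "0 \<le> \<delta>" "(1 + \<delta>) * real n < real j"
  shows "folded_summand n j = upper_part \<delta> n j"
proof -
  have "1 * real n \<le> (1 + \<delta>) * real n" using assms by (intro mult_right_mono) auto
  then have j: "n \<le> j" "j \<noteq> 0" using assms by auto
  then have "u (int j) \<le> u (int n)" by (intro u_nat_antimono)
  then have "u (int j) / u (int n) \<le> 1" using u_pos[of "int n"] by (simp add: divide_le_eq)
  then show ?thesis using assms j by (simp add: folded_summand_eq upper_part_def signed_powr_nonneg)
qed

lemma folded_summand_below: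
  assumes "0 \<le> \<delta>" "1 \<le> j" "real j < (1 - \<delta>) * real n"
  shows "folded_summand n j = - lower_part \<delta> n j"
proof -
  have "(1 - \<delta>) * real n \<le> 1 * real n" using assms by (intro mult_right_mono) auto
  then have "j \<le> n" using assms by linarith
  then have "u (int n) \<le> u (int j)" by (intro u_nat_antimono)
  then have "1 \<le> u (int j) / u (int n)" using u_pos[of "int n"] by (simp add: le_divide_eq)
  then show ?thesis
    using assms signed_powr_minus[of "u (int j) / u (int n) - 1" "p - 1"]
    by (simp add: folded_summand_eq lower_part_def signed_powr_nonneg)
qed

lemma parts_summable:
  assumes "0 \<le> \<delta>"
  shows "summable (upper_part \<delta> n)" "summable (lower_part \<delta> n)"
proof -
  have "\<bar>upper_part \<delta> n j\<bar> \<le> \<bar>folded_summand n j\<bar>" for j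
    using folded_summand_above[OF assms, of n j] by (cases "(1 + \<delta>) * real n < real j") (auto simp: upper_part_def)
  then show "summable (upper_part \<delta> n)" by (intro summable_comparison_test'[OF folded_summand_summable, of 0]) auto
  have "\<bar>lower_part \<delta> n j\<bar> \<le> \<bar>folded_summand n j\<bar>" for j
    using folded_summand_below[OF assms, of j n] by (cases "1 \<le> j \<and> real j < (1 - \<delta>) * real n") (auto simp: lower_part_def)
  then show "summable (lower_part \<delta> n)" by (intro summable_comparison_test'[OF folded_summand_summable, of 0]) auto
qed

text \<open>Dominated convergence; the indicator of the cut converges except at the single point
  \<open>r = 1 + \<delta>\<close>.\<close>

lemma upper_part_limit:
  assumes \<delta>: "0 < \<delta>" "\<delta> \<le> 1"
  shows "integrable lborel (\<lambda>r. indicator {1 + \<delta><..} r * upper_profile r)"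
    and "(\<lambda>n. real n powr S * suminf (upper_part \<delta> n)) \<longlonglongrightarrow> (LBINT r. indicator {1 + \<delta><..} r * upper_profile r)"
proof -
  define s where "s = (\<lambda>n r. real n powr (1 + S) * (indicator {1<..} r * upper_part \<delta> n (nat \<lceil>real n * r\<rceil>)))"
  define f where "f = (\<lambda>r. indicator {1 + \<delta><..} r * upper_profile r)"
  obtain C where C: "0 < C" "\<And>n r. 1 \<le> n \<Longrightarrow> 1 < r \<Longrightarrow> real n powr (1 + S) * upper_part \<delta> n (nat \<lceil>real n * r\<rceil>) \<le> C * r powr (- 1 - S)"
    by (rule upper_part_le[OF \<delta>]) (rule that)
  define W where "W = (\<lambda>r::real. C * (indicator {1<..} r * r powr (- 1 - S)))"
  have fm: "f \<in> borel_measurable lborel" unfolding f_def by measurable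
  have sm: "s n \<in> borel_measurable lborel" for n unfolding s_def by measurable
  have W: "integrable lborel W"
    using set_integrable_powr_at_infinity[of "- 1 - S" 1] S
    unfolding W_def set_integrable_def by (intro integrable_mult_right) simp
  have lim: "AE r in lborel. (\<lambda>n. s n r) \<longlonglongrightarrow> f r"
    using AE_lborel_singleton[of "1 + \<delta>"]
  proof eventually_elim
    case (elim r)
    show ?case
    proof (cases "1 < r")
      case False
      then show ?thesis using \<delta> by (simp add: s_def f_def indicator_def)
    next
      case r: True
      define j where "j = (\<lambda>n. nat \<lceil>real n * r\<rceil>)"
      have j: "(\<lambda>n. real (j n) / real n) \<longlonglongrightarrow> r" unfolding j_def using r by (intro ceiling_ratio_limit) simp
      show ?thesis
      proof (cases "1 + \<delta> < r")
        case True
        have "(\<lambda>n. 1 - u (int (j n)) / u (int n)) \<longlonglongrightarrow> 1 - r powr (- \<gamma>)"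
          using r by (intro tendsto_diff tendsto_const u_ratio_limit[OF j]) simp
        then have "(\<lambda>n. (1 - u (int (j n)) / u (int n)) powr (p - 1)) \<longlonglongrightarrow> (1 - r powr (- \<gamma>)) powr (p - 1)"
          using powr_minus_\<gamma>_less[OF r] by (intro tendsto_powr tendsto_const) auto
        then have "(\<lambda>n. folded_kernel n (j n) * real n powr (1 + S) * (1 - u (int (j n)) / u (int n)) powr (p - 1)) \<longlonglongrightarrow> upper_profile r"
          unfolding upper_profile_def using r by (intro tendsto_mult folded_kernel_limit[OF j]) auto
        moreover have "eventually (\<lambda>n. folded_kernel n (j n) * real n powr (1 + S) * (1 - u (int (j n)) / u (int n)) powr (p - 1) = s n r) sequentially"
          using order_tendstoD(1)[OF j True] eventually_gt_at_top[of 0]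
        proof eventually_elim
          case (elim n)
          then have "(1 + \<delta>) * real n < real (j n)" by (simp add: less_divide_eq)
          then show ?case using r by (simp add: s_def upper_part_def j_def)
        qed
        ultimately have "(\<lambda>n. s n r) \<longlonglongrightarrow> upper_profile r" by (rule Lim_transform_eventually)
        then show ?thesis using True by (simp add: f_def)
      next
        case False
        then have "r < 1 + \<delta>" using elim by simp
        have "eventually (\<lambda>n. 0 = s n r) sequentially"
          using order_tendstoD(2)[OF j \<open>r < 1 + \<delta>\<close>] eventually_gt_at_top[of 0]
        proof eventually_elim
          case (elim n)
          then have "\<not> (1 + \<delta>) * real n < real (j n)" by (simp add: divide_less_eq)
          then show ?case by (simp add: s_def upper_part_def j_def)
        qed
        then have "(\<lambda>n. s n r) \<longlonglongrightarrow> 0" by (rule Lim_transform_eventually[OF tendsto_const])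
        then show ?thesis using False by (simp add: f_def)
      qed
    qed
  qed
  have dom: "AE r in lborel. norm (s n r) \<le> W r" for n
  proof (rule AE_I2)
    fix r :: real
    show "norm (s n r) \<le> W r"
    proof (cases "1 < r \<and> 1 \<le> n")
      case True
      then show ?thesis using C(2)[of n r] upper_part_nonneg by (simp add: s_def W_def)
    next
      case False
      then have "r \<le> 1 \<or> n = 0" by auto
      then show ?thesis using C(1) by (auto simp: s_def W_def indicator_def)
    qed
  qed
  show "integrable lborel (\<lambda>r. indicator {1 + \<delta><..} r * upper_profile r)"
    using integrable_dominated_convergence[OF fm sm W lim dom] by (simp add: f_def)
  have "(\<lambda>n. LBINT r. s n r) \<longlonglongrightarrow> (LBINT r. f r)"
    by (rule integral_dominated_convergence[OF fm sm W lim dom])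
  moreover have "eventually (\<lambda>n. (LBINT r. s n r) = real n powr S * suminf (upper_part \<delta> n)) sequentially"
    using eventually_ge_at_top[of 1]
  proof eventually_elim
    case (elim n)
    have "has_bochner_integral lborel (\<lambda>r. indicator {1<..} r * upper_part \<delta> n (nat \<lceil>real n * r\<rceil>)) (suminf (upper_part \<delta> n) / real n)"
    proof (rule upper_sum_integral[OF elim upper_part_nonneg _ parts_summable(1)])
      fix j assume "upper_part \<delta> n j \<noteq> 0"
      then have "(1 + \<delta>) * real n < real j" by (auto simp: upper_part_def split: if_splits)
      moreover have "1 * real n \<le> (1 + \<delta>) * real n" using \<delta> by (intro mult_right_mono) auto
      ultimately show "n < j" by linarith
    qed (use \<delta> in simp)
    then have "(LBINT r. s n r) = real n powr (1 + S) * (suminf (upper_part \<delta> n) / real n)"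
      unfolding s_def by (simp add: has_bochner_integral_iff)
    also have "\<dots> = real n powr S * suminf (upper_part \<delta> n)" using elim by (simp add: powr_add)
    finally show ?case .
  qed
  ultimately show "(\<lambda>n. real n powr S * suminf (upper_part \<delta> n)) \<longlonglongrightarrow> (LBINT r. indicator {1 + \<delta><..} r * upper_profile r)"
    unfolding f_def by (rule Lim_transform_eventually)
qed

text \<open>Dominated convergence as for the upper part. The dominating function grows with
  exponent \<open>\<gamma> (p - 1) - 2\<close>, where \<open>\<gamma> (p - 1)\<close> reflects
  the size of \<open>u\<close> near the origin relative to \<open>u n\<close>.\<close>

lemma lower_part_limit:
  assumes \<delta>: "0 < \<delta>" "\<delta> < 1" and sub: "\<gamma> * (p - 1) < 1"
  shows "integrable lborel (\<lambda>r. indicator {1 / (1 - \<delta>)<..} r * lower_profile r)"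
    and "(\<lambda>n. real n powr S * suminf (lower_part \<delta> n)) \<longlonglongrightarrow> (LBINT r. indicator {1 / (1 - \<delta>)<..} r * lower_profile r)"
proof -
  define s where "s = (\<lambda>n r. real n powr (1 + S) * ((indicator {1<..} r * r powr (- 2)) * lower_part \<delta> n (nat \<lceil>real n / r\<rceil>)))"
  define f where "f = (\<lambda>r. indicator {1 / (1 - \<delta>)<..} r * lower_profile r)"
  obtain C where C: "0 < C" "\<And>n r. 1 \<le> n \<Longrightarrow> 1 < r \<Longrightarrow> real n powr (1 + S) * lower_part \<delta> n (nat \<lceil>real n / r\<rceil>) \<le> C * r powr (\<gamma> * (p - 1))"
    by (rule lower_part_le[OF \<delta>]) (rule that)
  define W where "W = (\<lambda>r::real. C * (indicator {1<..} r * r powr (- 2 + \<gamma> * (p - 1))))"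
  have fm: "f \<in> borel_measurable lborel" unfolding f_def by measurable
  have sm: "s n \<in> borel_measurable lborel" for n unfolding s_def by measurable
  have W: "integrable lborel W"
    using set_integrable_powr_at_infinity[of "- 2 + \<gamma> * (p - 1)" 1] sub
    unfolding W_def set_integrable_def by (intro integrable_mult_right) simp
  have cut: "1 / (1 - \<delta>) < r \<longleftrightarrow> 1 / r < 1 - \<delta>" "r < 1 / (1 - \<delta>) \<longleftrightarrow> 1 - \<delta> < 1 / r" if "1 < r" for r
    using that \<delta> by (auto simp: divide_less_eq less_divide_eq mult.commute)
  have one: "1 < 1 / (1 - \<delta>)" using \<delta> by (simp add: less_divide_eq)
  have lim: "AE r in lborel. (\<lambda>n. s n r) \<longlonglongrightarrow> f r"
    using AE_lborel_singleton[of "1 / (1 - \<delta>)"]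
  proof eventually_elim
    case (elim r)
    show ?case
    proof (cases "1 < r")
      case False
      then show ?thesis using one by (simp add: s_def f_def indicator_def)
    next
      case r: True
      define j where "j = (\<lambda>n. nat \<lceil>real n / r\<rceil>)"
      have "0 < 1 / r" using r by simp
      from ceiling_ratio_limit[OF this] have j: "(\<lambda>n. real (j n) / real n) \<longlonglongrightarrow> 1 / r" by (simp add: j_def)
      show ?thesis
      proof (cases "1 / (1 - \<delta>) < r")
        case True
        have lt: "1 < (1 / r) powr (- \<gamma>)"
        proof -
          have "(1 / r) powr (- \<gamma>) = r powr \<gamma>" using r by (simp add: powr_divide powr_minus_divide)
          then show ?thesis using r \<gamma> by (simp add: gr_one_powr)
        qed
        have "(\<lambda>n. u (int (j n)) / u (int n) - 1) \<longlonglongrightarrow> (1 / r) powr (- \<gamma>) - 1"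
          using r by (intro tendsto_diff tendsto_const u_ratio_limit[OF j]) simp
        then have "(\<lambda>n. (u (int (j n)) / u (int n) - 1) powr (p - 1)) \<longlonglongrightarrow> ((1 / r) powr (- \<gamma>) - 1) powr (p - 1)"
          using lt by (intro tendsto_powr tendsto_const) auto
        then have "(\<lambda>n. r powr (- 2) * (folded_kernel n (j n) * real n powr (1 + S) * (u (int (j n)) / u (int n) - 1) powr (p - 1))) \<longlonglongrightarrow> lower_profile r"
          unfolding lower_profile_def using r by (intro tendsto_mult tendsto_const folded_kernel_limit[OF j]) auto
        moreover have below: "1 / r < 1 - \<delta>" using True cut(1)[OF r] by simp
        have "eventually (\<lambda>n. r powr (- 2) * (folded_kernel n (j n) * real n powr (1 + S) * (u (int (j n)) / u (int n) - 1) powr (p - 1)) = s n r) sequentially"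
          using order_tendstoD(2)[OF j below] order_tendstoD(1)[OF j \<open>0 < 1 / r\<close>] eventually_gt_at_top[of 0]
        proof eventually_elim
          case (elim n)
          then have "real (j n) < (1 - \<delta>) * real n" "1 \<le> j n" by (auto simp: divide_less_eq zero_less_divide_iff)
          then show ?case using r by (simp add: s_def lower_part_def j_def)
        qed
        ultimately have "(\<lambda>n. s n r) \<longlonglongrightarrow> lower_profile r" by (rule Lim_transform_eventually)
        then show ?thesis using True by (simp add: f_def)
      next
        case False
        then have "1 - \<delta> < 1 / r" using elim cut(2)[OF r] by simp
        have "eventually (\<lambda>n. 0 = s n r) sequentially"
          using order_tendstoD(1)[OF j \<open>1 - \<delta> < 1 / r\<close>] eventually_gt_at_top[of 0]
        proof eventually_elim
          case (elim n)
          then have "\<not> real (j n) < (1 - \<delta>) * real n" by (simp add: less_divide_eq)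
          then show ?case by (simp add: s_def lower_part_def j_def)
        qed
        then have "(\<lambda>n. s n r) \<longlonglongrightarrow> 0" by (rule Lim_transform_eventually[OF tendsto_const])
        then show ?thesis using False by (simp add: f_def)
      qed
    qed
  qed
  have dom: "AE r in lborel. norm (s n r) \<le> W r" for n
  proof (rule AE_I2)
    fix r :: real
    show "norm (s n r) \<le> W r"
    proof (cases "1 < r \<and> 1 \<le> n")
      case True
      then have "r powr (- 2) * (real n powr (1 + S) * lower_part \<delta> n (nat \<lceil>real n / r\<rceil>)) \<le> r powr (- 2) * (C * r powr (\<gamma> * (p - 1)))"
        by (intro mult_left_mono C) auto
      also have "\<dots> = C * r powr (- 2 + \<gamma> * (p - 1))" by (simp only: powr_add) simp
      finally show ?thesis using True lower_part_nonneg by (simp add: s_def W_def mult_ac)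
    next
      case False
      then have "r \<le> 1 \<or> n = 0" by auto
      then show ?thesis using C(1) by (auto simp: s_def W_def indicator_def)
    qed
  qed
  show "integrable lborel (\<lambda>r. indicator {1 / (1 - \<delta>)<..} r * lower_profile r)"
    using integrable_dominated_convergence[OF fm sm W lim dom] by (simp add: f_def)
  have "(\<lambda>n. LBINT r. s n r) \<longlonglongrightarrow> (LBINT r. f r)"
    by (rule integral_dominated_convergence[OF fm sm W lim dom])
  moreover have "eventually (\<lambda>n. (LBINT r. s n r) = real n powr S * suminf (lower_part \<delta> n)) sequentially"
    using eventually_ge_at_top[of 1]
  proof eventually_elim
    case (elim n)
    have "has_bochner_integral lborel (\<lambda>r. (indicator {1<..} r * r powr (- 2)) * lower_part \<delta> n (nat \<lceil>real n / r\<rceil>)) (suminf (lower_part \<delta> n) / real n)"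
    proof (rule lower_sum_integral[OF elim lower_part_nonneg _ parts_summable(2)])
      fix j assume "lower_part \<delta> n j \<noteq> 0"
      then have j: "1 \<le> j" "real j < (1 - \<delta>) * real n" by (auto simp: lower_part_def split: if_splits)
      moreover have "(1 - \<delta>) * real n \<le> 1 * real n" using \<delta> by (intro mult_right_mono) auto
      ultimately show "1 \<le> j \<and> j < n" by linarith
    qed (use \<delta> in simp)
    then have "(LBINT r. s n r) = real n powr (1 + S) * (suminf (lower_part \<delta> n) / real n)"
      unfolding s_def by (simp add: has_bochner_integral_iff)
    also have "\<dots> = real n powr S * suminf (lower_part \<delta> n)" using elim by (simp add: powr_add)
    finally show ?case .
  qed
  ultimately show "(\<lambda>n. real n powr S * suminf (lower_part \<delta> n)) \<longlonglongrightarrow> (LBINT r. indicator {1 / (1 - \<delta>)<..} r * lower_profile r)"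
    unfolding f_def by (rule Lim_transform_eventually)
qed

definition near_sum :: "nat \<Rightarrow> nat \<Rightarrow> real" where
  "near_sum n h = (\<Sum>j=n - h..n + h. folded_summand n j)"

lemma w_decomposition:
  assumes \<delta>: "0 < \<delta>" "\<delta> \<le> 1 / 2" and n: "1 \<le> n"
  shows "w (int n) = suminf (upper_part \<delta> n) - suminf (lower_part \<delta> n) + near_sum n (nat \<lfloor>\<delta> * real n\<rfloor>) + w_summand (int n) 0"
proof -
  define h where "h = nat \<lfloor>\<delta> * real n\<rfloor>"
  have h: "real h \<le> \<delta> * real n" "\<delta> * real n < real h + 1" using \<delta> by (auto simp: h_def)
  have dn: "0 \<le> \<delta> * real n" using \<delta> by simp
  have "folded_summand n j - upper_part \<delta> n j + lower_part \<delta> n j = (if j \<in> {n - h..n + h} then folded_summand n j else 0)" for j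
  proof -
    consider "j = 0" "n - h > j" | "n + h < j" | "1 \<le> j" "j + h < n" | "j \<in> {n - h..n + h}"
      by (cases "j = 0"; cases "n + h < j"; cases "j + h < n") auto
    then show ?thesis
    proof cases
      case 1
      have "\<not> (1 + \<delta>) * real n < 0" using \<delta> by (simp add: not_less)
      then show ?thesis using 1 by (simp add: folded_summand_def upper_part_def lower_part_def)
    next
      case 2
      then have "real n + real h + 1 \<le> real j" by linarith
      then have up: "(1 + \<delta>) * real n < real j" using h by (simp add: distrib_right)
      moreover have "\<not> real j < (1 - \<delta>) * real n"
        using up dn by (simp add: distrib_right left_diff_distrib)
      ultimately show ?thesis using folded_summand_above[of \<delta> n j] \<delta> 2 by (simp add: lower_part_def)
    next
      case 3
      then have "real j + real h + 1 \<le> real n" by linarith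
      then have low: "real j < (1 - \<delta>) * real n" using h by (simp add: left_diff_distrib)
      moreover have "\<not> (1 + \<delta>) * real n < real j"
        using low dn by (simp add: distrib_right left_diff_distrib)
      ultimately show ?thesis using folded_summand_below[of \<delta> j n] \<delta> 3 by (simp add: upper_part_def)
    next
      case 4
      then have "real j \<le> real n + real h" "real n \<le> real j + real h" by auto
      then have "\<not> (1 + \<delta>) * real n < real j" "\<not> real j < (1 - \<delta>) * real n"
        using h by (auto simp: distrib_right left_diff_distrib)
      then show ?thesis using 4 by (simp add: upper_part_def lower_part_def)
    qed
  qed
  then have eq: "(\<lambda>j. if j \<in> {n - h..n + h} then folded_summand n j else 0) = (\<lambda>j. folded_summand n j - upper_part \<delta> n j + lower_part \<delta> n j)" by simp
  have "(\<lambda>j. folded_summand n j - upper_part \<delta> n j + lower_part \<delta> n j) sums (w (int n) - w_summand (int n) 0 - suminf (upper_part \<delta> n) + suminf (lower_part \<delta> n))"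
    using \<delta> by (intro sums_add sums_diff folded_summand_sums summable_sums parts_summable) auto
  moreover have "(\<lambda>j. if j \<in> {n - h..n + h} then folded_summand n j else 0) sums near_sum n h"
    unfolding near_sum_def by (rule sums_If_finite_set) simp
  ultimately have "w (int n) - w_summand (int n) 0 - suminf (upper_part \<delta> n) + suminf (lower_part \<delta> n) = near_sum n h"
    unfolding eq by (rule sums_unique2)
  then show ?thesis by (simp add: h_def)
qed

text \<open>The half of the folded kernel that is singular at \<open>j = n\<close> is summed in
  symmetric pairs, which yields the power \<open>p - S\<close> of \<open>\<delta>\<close>. The
  other half is bounded by the number of its terms.\<close>

lemma near_sum_bound:
  obtains C where "0 < C" "\<And>\<delta> n. 0 < \<delta> \<Longrightarrow> \<delta> \<le> 1 / 2 \<Longrightarrow> 1 \<le> n \<Longrightarrow>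
    \<bar>near_sum n (nat \<lfloor>\<delta> * real n\<rfloor>)\<bar> \<le> C * (\<delta> powr (p - S) + 2 * \<delta> + 1 / real n) * real n powr (- S)"
proof -
  obtain Ck where Ck: "0 < Ck" "\<And>n. n \<ge> 1 \<Longrightarrow> k (int n) \<le> Ck * real n powr (- 1 - S)"
    using k_upper by blast
  obtain Cp where Cp: "0 < Cp" "\<And>x m. 1 \<le> m \<Longrightarrow> 2 * m \<le> x \<Longrightarrow>
    \<bar>signed_powr (u (int x) - u (int (x + m))) (p - 1) + signed_powr (u (int x) - u (int (x - m))) (p - 1)\<bar>
      \<le> Cp * real m powr p * real x powr (- p) * u (int x) powr (p - 1)"
    by (rule symmetric_pair_bound) (rule that)
  obtain D where D: "0 < D" "\<And>n j. u (int j) / u (int n) \<le> D * ((1 + real n) / (1 + real j)) powr \<gamma>"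
    by (rule u_ratio_bound) (rule that)
  define M where "M = (1 + D * 2 powr \<gamma>) powr (p - 1)"
  define c0 where "c0 = max 1 (1 / (p - S))"
  define C where "C = Ck * Cp * c0 + Ck * M"
  \<comment> \<open>The constant \<open>M\<close> bounds the power \<open>p - 1\<close> of the
    increments of \<open>u\<close> relative to \<open>u n\<close> at sites \<open>j \<ge> n /
    2\<close>.\<close>
  have pS: "0 < p - S" using p S by simp
  have M: "0 < M" using D by (simp add: M_def add_pos_pos less_imp_neq[THEN not_sym])
  have c0: "0 < c0" by (simp add: c0_def)
  have main: "\<bar>near_sum n (nat \<lfloor>\<delta> * real n\<rfloor>)\<bar> \<le> C * (\<delta> powr (p - S) + 2 * \<delta> + 1 / real n) * real n powr (- S)"
    if \<delta>: "0 < \<delta>" "\<delta> \<le> 1 / 2" and n: "1 \<le> n" for \<delta> n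
  proof -
    define h where "h = nat \<lfloor>\<delta> * real n\<rfloor>"
    have h: "real h \<le> \<delta> * real n" using \<delta> by (simp add: h_def)
    have "\<delta> * real n \<le> 1 / 2 * real n" using \<delta> by (intro mult_right_mono) auto
    then have hn: "2 * h \<le> n" "h < n" using h n by linarith+
    define sg where "sg = (\<lambda>j. signed_powr (1 - u (int j) / u (int n)) (p - 1))"
    have sg_eq: "sg j = signed_powr (u (int n) - u (int j)) (p - 1) / u (int n) powr (p - 1)" for j
      using signed_powr_divide[OF u_pos, of "u (int n) - u (int j)" "int n" "p - 1"] u_pos[of "int n"]
      by (simp add: sg_def diff_divide_distrib)
    have split: "near_sum n h = (\<Sum>j=n - h..n + h. k (int n - int j) * sg j) + (\<Sum>j=n - h..n + h. k (int n + int j) * sg j)"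
      unfolding near_sum_def sum.distrib[symmetric]
      by (intro sum.cong refl) (use hn in \<open>auto simp: folded_summand_eq folded_kernel_def sg_def distrib_right\<close>)
    have "\<bar>\<Sum>j=n - h..n + h. k (int n - int j) * sg j\<bar> = \<bar>\<Sum>m=1..h. k (int m) * (sg (n + m) + sg (n - m))\<bar>"
    proof -
      have "k (int n - int (n + m)) * sg (n + m) + k (int n - int (n - m)) * sg (n - m) = k (int m) * (sg (n + m) + sg (n - m))"
        if "m \<in> {1..h}" for m
      proof -
        have "int n - int (n + m) = - int m" "int n - int (n - m) = int m" using that hn by auto
        then show ?thesis by (simp only: k_minus distrib_left)
      qed
      then show ?thesis
        using sum_symmetric_interval[of h n "\<lambda>j. k (int n - int j) * sg j"] hn by simp
    qed
    also have "\<dots> \<le> (\<Sum>m=1..h. Ck * Cp * real n powr (- p) * real m powr (p - S - 1))"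
    proof (rule order_trans[OF sum_abs], rule sum_mono)
      fix m assume m: "m \<in> {1..h}"
      have "\<bar>sg (n + m) + sg (n - m)\<bar> = \<bar>signed_powr (u (int n) - u (int (n + m))) (p - 1) + signed_powr (u (int n) - u (int (n - m))) (p - 1)\<bar> / u (int n) powr (p - 1)"
        unfolding sg_eq add_divide_distrib[symmetric] by (simp add: abs_divide)
      also have "\<dots> \<le> Cp * real m powr p * real n powr (- p) * u (int n) powr (p - 1) / u (int n) powr (p - 1)"
        using m hn by (intro divide_right_mono Cp) auto
      also have "\<dots> = Cp * real m powr p * real n powr (- p)" using u_pos[of "int n"] by simp
      finally have "k (int m) * \<bar>sg (n + m) + sg (n - m)\<bar> \<le> (Ck * real m powr (- 1 - S)) * (Cp * real m powr p * real n powr (- p))"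
        using m Ck by (intro mult_mono) (auto simp: k_nonneg)
      also have "\<dots> = Ck * Cp * real n powr (- p) * (real m powr (- 1 - S) * real m powr p)" by simp
      also have "real m powr (- 1 - S) * real m powr p = real m powr (p - S - 1)"
        unfolding powr_add[symmetric] by (simp add: algebra_simps)
      finally show "\<bar>k (int m) * (sg (n + m) + sg (n - m))\<bar> \<le> Ck * Cp * real n powr (- p) * real m powr (p - S - 1)"
        by (simp add: abs_mult k_nonneg)
    qed
    also have "\<dots> = Ck * Cp * real n powr (- p) * (\<Sum>m=1..h. real m powr (p - S - 1))" by (simp add: sum_distrib_left)
    also have "\<dots> \<le> Ck * Cp * real n powr (- p) * (c0 * real h powr (p - S))"
      unfolding c0_def using Ck Cp by (intro mult_left_mono sum_powr_le pS) auto
    also have "\<dots> \<le> Ck * Cp * real n powr (- p) * (c0 * (\<delta> * real n) powr (p - S))"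
      using Ck Cp c0 h pS by (intro mult_left_mono powr_mono2) auto
    also have "\<dots> = Ck * Cp * c0 * \<delta> powr (p - S) * (real n powr (- p) * real n powr (p - S))"
      using \<delta> by (simp add: powr_mult)
    also have "real n powr (- p) * real n powr (p - S) = real n powr (- S)"
      unfolding powr_add[symmetric] by simp
    finally have first: "\<bar>\<Sum>j=n - h..n + h. k (int n - int j) * sg j\<bar> \<le> Ck * Cp * c0 * \<delta> powr (p - S) * real n powr (- S)" .
    have "\<bar>\<Sum>j=n - h..n + h. k (int n + int j) * sg j\<bar> \<le> (\<Sum>j=n - h..n + h. Ck * M * real n powr (- 1 - S))"
    proof (rule order_trans[OF sum_abs], rule sum_mono)
      fix j assume j: "j \<in> {n - h..n + h}"
      have "1 + real n \<le> 2 * (1 + real j)" using j hn by auto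
      then have "((1 + real n) / (1 + real j)) powr \<gamma> \<le> 2 powr \<gamma>"
        using \<gamma> by (intro powr_mono2) (auto simp: divide_le_eq)
      then have "D * ((1 + real n) / (1 + real j)) powr \<gamma> \<le> D * 2 powr \<gamma>" using D by (intro mult_left_mono) auto
      then have "u (int j) / u (int n) \<le> D * 2 powr \<gamma>" using D(2)[of j n] by linarith
      moreover have "0 < u (int j) / u (int n)" using u_pos by simp
      ultimately have "\<bar>1 - u (int j) / u (int n)\<bar> \<le> 1 + D * 2 powr \<gamma>" by linarith
      then have sgM: "\<bar>sg j\<bar> \<le> M" unfolding sg_def M_def abs_signed_powr using p by (intro powr_mono2) auto
      have "k (int (n + j)) \<le> Ck * real (n + j) powr (- 1 - S)" using n by (intro Ck) simp
      also have "\<dots> \<le> Ck * real n powr (- 1 - S)" using Ck S n by (intro mult_left_mono powr_mono2') auto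
      finally have "k (int (n + j)) * \<bar>sg j\<bar> \<le> (Ck * real n powr (- 1 - S)) * M"
        using sgM Ck by (intro mult_mono) auto
      then show "\<bar>k (int n + int j) * sg j\<bar> \<le> Ck * M * real n powr (- 1 - S)"
        by (simp add: abs_mult k_nonneg mult_ac)
    qed
    also have "\<dots> = (2 * real h + 1) * (Ck * M * real n powr (- 1 - S))" using hn by simp
    also have "\<dots> \<le> (2 * (\<delta> * real n) + 1) * (Ck * M * real n powr (- 1 - S))"
      using h Ck M by (intro mult_right_mono) auto
    also have "\<dots> = Ck * M * (2 * \<delta> + 1 / real n) * (real n * real n powr (- 1 - S))"
      using n by (simp add: field_simps)
    also have "real n * real n powr (- 1 - S) = real n powr (- S)"
      using n powr_add[of "real n" 1 "- 1 - S"] by simp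
    finally have second: "\<bar>\<Sum>j=n - h..n + h. k (int n + int j) * sg j\<bar> \<le> Ck * M * (2 * \<delta> + 1 / real n) * real n powr (- S)" .
    have "\<bar>near_sum n h\<bar> \<le> Ck * Cp * c0 * \<delta> powr (p - S) * real n powr (- S) + Ck * M * (2 * \<delta> + 1 / real n) * real n powr (- S)"
      using first second unfolding split by linarith
    also have "\<dots> \<le> C * \<delta> powr (p - S) * real n powr (- S) + C * (2 * \<delta> + 1 / real n) * real n powr (- S)"
      using Ck Cp c0 M \<delta> unfolding C_def by (intro add_mono mult_right_mono) auto
    also have "\<dots> = C * (\<delta> powr (p - S) + 2 * \<delta> + 1 / real n) * real n powr (- S)" by (simp add: algebra_simps)
    finally show ?thesis by (simp add: h_def)
  qed
  have "0 < C" using Ck Cp c0 M by (simp add: C_def add_pos_pos)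
  then show ?thesis using main by (rule that)
qed

lemma w_summand_0_bound:
  obtains C where "0 < C" "\<And>n. 1 \<le> n \<Longrightarrow> \<bar>w_summand (int n) 0\<bar> \<le> C * real n powr (\<gamma> * (p - 1) - 1) * real n powr (- S)"
proof -
  obtain Ck where Ck: "0 < Ck" "\<And>n. n \<ge> 1 \<Longrightarrow> k (int n) \<le> Ck * real n powr (- 1 - S)"
    using k_upper by blast
  obtain D where D: "0 < D" "\<And>n j. u (int j) / u (int n) \<le> D * ((1 + real n) / (1 + real j)) powr \<gamma>"
    by (rule u_ratio_bound) (rule that)
  have main: "\<bar>w_summand (int n) 0\<bar> \<le> Ck * (D * 2 powr \<gamma>) powr (p - 1) * real n powr (\<gamma> * (p - 1) - 1) * real n powr (- S)"
    if n: "1 \<le> n" for n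
  proof -
    have "u (int 0) / u (int n) \<le> D * (1 + real n) powr \<gamma>" using D(2)[of 0 n] by simp
    also have "\<dots> \<le> D * (2 * real n) powr \<gamma>" using D \<gamma> n by (intro mult_left_mono powr_mono2) auto
    finally have up: "u 0 / u (int n) \<le> D * 2 powr \<gamma> * real n powr \<gamma>" by (simp add: powr_mult)
    have "1 \<le> u 0 / u (int n)" using u_antimono[of 0 "int n"] u_pos[of "int n"] by (simp add: le_divide_eq)
    then have "\<bar>1 - u 0 / u (int n)\<bar> powr (p - 1) \<le> (D * 2 powr \<gamma> * real n powr \<gamma>) powr (p - 1)"
      using up p by (intro powr_mono2) auto
    also have "\<dots> = (D * 2 powr \<gamma>) powr (p - 1) * real n powr (\<gamma> * (p - 1))"
      using D n by (simp add: powr_mult powr_powr)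
    finally have "k (int n) * \<bar>1 - u 0 / u (int n)\<bar> powr (p - 1) \<le> (Ck * real n powr (- 1 - S)) * ((D * 2 powr \<gamma>) powr (p - 1) * real n powr (\<gamma> * (p - 1)))"
      using Ck n by (intro mult_mono) auto
    also have "\<dots> = Ck * (D * 2 powr \<gamma>) powr (p - 1) * (real n powr (\<gamma> * (p - 1)) * real n powr (- 1 - S))" by simp
    also have "real n powr (\<gamma> * (p - 1)) * real n powr (- 1 - S) = real n powr (\<gamma> * (p - 1) - 1) * real n powr (- S)"
      unfolding powr_add[symmetric] by (simp add: algebra_simps)
    finally show ?thesis by (simp add: w_summand_def abs_mult k_nonneg mult.assoc)
  qed
  have "0 < Ck * (D * 2 powr \<gamma>) powr (p - 1)" using Ck D by simp
  then show ?thesis using main by (rule that)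
qed

text \<open>Restricting both integrals to \<open>r > 2\<close> only discards nonnegative
  contributions, because \<open>1 + \<delta> \<le> 1 / (1 - \<delta>) \<le> 2\<close> and the
  lower profile is at most the upper one. Beyond 2 the difference of the profiles is positive
  and does not depend on \<open>\<delta>\<close>.\<close>

lemma limit_gap:
  assumes sub: "S + \<gamma> * (p - 1) < 1"
  obtains c where "0 < c" "\<And>\<delta>. 0 < \<delta> \<Longrightarrow> \<delta> \<le> 1 / 2 \<Longrightarrow>
    c \<le> (LBINT r. indicator {1 + \<delta><..} r * upper_profile r) - (LBINT r. indicator {1 / (1 - \<delta>)<..} r * lower_profile r)"
proof -
  define \<eta> where "\<eta> = S + \<gamma> * (p - 1) - 1"
  have \<eta>: "\<eta> < 0" using sub by (simp add: \<eta>_def)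
  have sub': "\<gamma> * (p - 1) < 1" using sub S by simp
  define F where "F = (\<lambda>r. indicator {2<..} r * (upper_profile r * (1 - r powr \<eta>)))"
  have less1: "r powr \<eta> < 1" if "1 < r" for r using powr_less_mono[of \<eta> 0 r] \<eta> that by simp
  have F0: "0 \<le> F r" for r
    using upper_profile_pos[of r] less1[of r] by (auto simp: F_def indicator_def intro!: mult_nonneg_nonneg)
  have Fint: "integrable lborel F"
  proof (rule Bochner_Integration.integrable_bound)
    show "integrable lborel (\<lambda>r. indicator {1 + 1<..} r * upper_profile r)" by (rule upper_part_limit) auto
    show "F \<in> borel_measurable lborel" unfolding F_def by measurable
    show "AE r in lborel. norm (F r) \<le> norm (indicator {1 + 1<..} r * upper_profile r)"
    proof (rule AE_I2)
      fix r :: real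
      show "norm (F r) \<le> norm (indicator {1 + 1<..} r * upper_profile r)"
      proof (cases "2 < r")
        case True
        then have "upper_profile r * (1 - r powr \<eta>) \<le> upper_profile r * 1" using upper_profile_pos[of r] by (intro mult_left_mono) auto
        then show ?thesis using True F0[of r] upper_profile_pos[of r] by (simp add: F_def)
      qed (simp add: F_def)
    qed
  qed
  have pos: "0 < (LBINT r. F r)"
    by (rule integral_pos_on_interval[OF Fint F0, of 2 3]) (use upper_profile_pos less1 in \<open>auto simp: F_def\<close>)
  have le: "(LBINT r. F r) \<le> (LBINT r. indicator {1 + \<delta><..} r * upper_profile r) - (LBINT r. indicator {1 / (1 - \<delta>)<..} r * lower_profile r)"
    if \<delta>: "0 < \<delta>" "\<delta> \<le> 1 / 2" for \<delta>
  proof -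
    have i1: "integrable lborel (\<lambda>r. indicator {1 + \<delta><..} r * upper_profile r)" using \<delta> by (intro upper_part_limit) auto
    have i2: "integrable lborel (\<lambda>r. indicator {1 / (1 - \<delta>)<..} r * lower_profile r)" using \<delta> sub' by (intro lower_part_limit) auto
    have "(LBINT r. F r) \<le> (LBINT r. indicator {1 + \<delta><..} r * upper_profile r - indicator {1 / (1 - \<delta>)<..} r * lower_profile r)"
    proof (rule integral_mono[OF Fint Bochner_Integration.integrable_diff[OF i1 i2]])
      fix r :: real
      have "(1 + \<delta>) * (1 - \<delta>) \<le> 1" by (simp add: algebra_simps)
      then have b1: "1 + \<delta> \<le> 1 / (1 - \<delta>)" using \<delta> by (simp add: le_divide_eq)
      have b2: "1 / (1 - \<delta>) \<le> 2" using \<delta> by (simp add: divide_le_eq)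
      have low: "lower_profile r = upper_profile r * r powr \<eta>" if "1 < r" using lower_profile_eq[OF that] by (simp add: \<eta>_def)
      have dec: "upper_profile r * r powr \<eta> \<le> upper_profile r" if "1 < r" using upper_profile_pos[OF that] less1[OF that] by (simp add: mult_le_cancel_left1)
      consider "2 < r" | "1 / (1 - \<delta>) < r" "r \<le> 2" | "r \<le> 1 / (1 - \<delta>)" by linarith
      then show "F r \<le> indicator {1 + \<delta><..} r * upper_profile r - indicator {1 / (1 - \<delta>)<..} r * lower_profile r"
      proof cases
        case 1
        then show ?thesis using b1 b2 low by (simp add: F_def right_diff_distrib)
      next
        case 2
        then have "1 < r" using b1 \<delta> by linarith
        then show ?thesis using 2 b1 low dec by (simp add: F_def)
      next
        case 3
        show ?thesis using 3 b2 \<delta> upper_profile_pos[of r] by (auto simp: F_def indicator_def)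
      qed
    qed
    also have "\<dots> = (LBINT r. indicator {1 + \<delta><..} r * upper_profile r) - (LBINT r. indicator {1 / (1 - \<delta>)<..} r * lower_profile r)"
      using i1 i2 by (rule Bochner_Integration.integral_diff)
    finally show ?thesis .
  qed
  show ?thesis using pos le by (rule that)
qed

text \<open>The limit of the two main parts is at least \<open>c\<close> for every
  \<open>\<delta>\<close>. Choosing \<open>\<delta>\<close> so small that the near terms amount
  to at most \<open>c / 4\<close>, and then \<open>n\<close> large, leaves at least a quarter of
  \<open>c\<close>.\<close>

theorem w_asymptotics:
  assumes sub: "S + \<gamma> * (p - 1) < 1"
  obtains c C N where "0 < c" "0 < C" "0 < N"
    "\<And>x. int N \<le> \<bar>x\<bar> \<Longrightarrow> c * of_int \<bar>x\<bar> powr (- S) \<le> w x"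
    "\<And>x. int N \<le> \<bar>x\<bar> \<Longrightarrow> w x \<le> C * of_int \<bar>x\<bar> powr (- S)"
proof -
  obtain C1 where C1: "0 < C1" "\<And>\<delta> n. 0 < \<delta> \<Longrightarrow> \<delta> \<le> 1 / 2 \<Longrightarrow> 1 \<le> n \<Longrightarrow>
    \<bar>near_sum n (nat \<lfloor>\<delta> * real n\<rfloor>)\<bar> \<le> C1 * (\<delta> powr (p - S) + 2 * \<delta> + 1 / real n) * real n powr (- S)"
    by (rule near_sum_bound) (rule that)
  obtain C2 where C2: "0 < C2" "\<And>n. 1 \<le> n \<Longrightarrow> \<bar>w_summand (int n) 0\<bar> \<le> C2 * real n powr (\<gamma> * (p - 1) - 1) * real n powr (- S)"
    by (rule w_summand_0_bound) (rule that)
  obtain c where c: "0 < c" "\<And>\<delta>. 0 < \<delta> \<Longrightarrow> \<delta> \<le> 1 / 2 \<Longrightarrow>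
    c \<le> (LBINT r. indicator {1 + \<delta><..} r * upper_profile r) - (LBINT r. indicator {1 / (1 - \<delta>)<..} r * lower_profile r)"
    by (rule limit_gap[OF sub]) (rule that)
  have sub': "\<gamma> * (p - 1) < 1" using sub S by simp
  obtain \<delta> where \<delta>: "0 < \<delta>" "\<delta> \<le> 1 / 2" "C1 * (\<delta> powr (p - S) + 2 * \<delta>) < c / 4"
  proof -
    have "((\<lambda>\<delta>::real. \<delta> powr (p - S)) \<longlongrightarrow> 0 powr (p - S)) (at_right 0)"
      using p S by (intro tendsto_powr' tendsto_intros) (auto simp: eventually_at_filter)
    then have "((\<lambda>\<delta>::real. C1 * (\<delta> powr (p - S) + 2 * \<delta>)) \<longlongrightarrow> C1 * (0 + 2 * 0)) (at_right 0)"
      by (intro tendsto_intros) simp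
    then have "eventually (\<lambda>\<delta>. C1 * (\<delta> powr (p - S) + 2 * \<delta>) < c / 4) (at_right 0)"
      using c(1) by (intro order_tendstoD) auto
    moreover have "eventually (\<lambda>\<delta>::real. \<delta> \<in> {0<..<1/2}) (at_right 0)"
      by (rule eventually_at_right_real) simp
    ultimately have "eventually (\<lambda>\<delta>. C1 * (\<delta> powr (p - S) + 2 * \<delta>) < c / 4 \<and> \<delta> \<in> {0<..<1/2}) (at_right (0::real))"
      by (rule eventually_conj)
    then obtain d where "C1 * (d powr (p - S) + 2 * d) < c / 4 \<and> d \<in> {0<..<1/2::real}"
      using eventually_happens'[OF trivial_limit_at_right_real] by blast
    then show ?thesis using that[of d] by auto
  qed
  define J where "J = (LBINT r. indicator {1 + \<delta><..} r * upper_profile r) - (LBINT r. indicator {1 / (1 - \<delta>)<..} r * lower_profile r)"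
  have J: "c \<le> J" unfolding J_def using c \<delta> by simp
  define a where "a = (\<lambda>n. real n powr S * suminf (upper_part \<delta> n) - real n powr S * suminf (lower_part \<delta> n))"
  have lim: "a \<longlonglongrightarrow> J"
    unfolding a_def J_def using \<delta> sub' by (intro tendsto_diff upper_part_limit lower_part_limit) auto
  have "(\<lambda>n. C1 * (1 / real n) + C2 * real n powr (\<gamma> * (p - 1) - 1)) \<longlonglongrightarrow> C1 * 0 + C2 * 0"
    using sub' by (intro tendsto_add tendsto_mult tendsto_const lim_1_over_n tendsto_neg_powr filterlim_real_sequentially) auto
  then have small: "eventually (\<lambda>n. C1 * (1 / real n) + C2 * real n powr (\<gamma> * (p - 1) - 1) < c / 4) sequentially"
    using c(1) by (intro order_tendstoD) auto
  have lo: "J - c / 4 < J" and hi: "J < J + c / 4" using c(1) by auto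
  have "eventually (\<lambda>n. (c / 4) * real n powr (- S) \<le> w (int n) \<and> w (int n) \<le> (J + c) * real n powr (- S)) sequentially"
    using small order_tendstoD(1)[OF lim lo] order_tendstoD(2)[OF lim hi] eventually_ge_at_top[of 1]
  proof eventually_elim
    case (elim n)
    define P where "P = real n powr (- S)"
    have P: "0 < P" using elim by (simp add: P_def)
    \<comment> \<open>All error terms are multiples of \<open>P\<close>, and so is the main part
      after this rescaling.\<close>
    have inv: "real n powr S * P = 1" using elim unfolding P_def powr_add[symmetric] by simp
    have "suminf (upper_part \<delta> n) - suminf (lower_part \<delta> n) = (real n powr S * P) * suminf (upper_part \<delta> n) - (real n powr S * P) * suminf (lower_part \<delta> n)"
      by (simp only: inv)
    also have "\<dots> = a n * P" by (simp add: a_def algebra_simps)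
    finally have main: "w (int n) = a n * P + near_sum n (nat \<lfloor>\<delta> * real n\<rfloor>) + w_summand (int n) 0"
      using w_decomposition[OF \<delta>(1,2), of n] elim by simp
    have "\<bar>near_sum n (nat \<lfloor>\<delta> * real n\<rfloor>)\<bar> \<le> C1 * (\<delta> powr (p - S) + 2 * \<delta> + 1 / real n) * P"
      unfolding P_def using \<delta> elim by (intro C1) auto
    moreover have "\<bar>w_summand (int n) 0\<bar> \<le> C2 * real n powr (\<gamma> * (p - 1) - 1) * P"
      unfolding P_def using elim by (intro C2) auto
    moreover have "C1 * (\<delta> powr (p - S) + 2 * \<delta> + 1 / real n) * P + C2 * real n powr (\<gamma> * (p - 1) - 1) * P \<le> (c / 2) * P"
    proof -
      have "C1 * (\<delta> powr (p - S) + 2 * \<delta> + 1 / real n) + C2 * real n powr (\<gamma> * (p - 1) - 1) \<le> c / 2"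
      proof -
        have "C1 * (\<delta> powr (p - S) + 2 * \<delta> + 1 / real n) = C1 * (\<delta> powr (p - S) + 2 * \<delta>) + C1 * (1 / real n)"
          by (rule distrib_left)
        then show ?thesis using \<delta>(3) elim(1) by linarith
      qed
      then have "(C1 * (\<delta> powr (p - S) + 2 * \<delta> + 1 / real n) + C2 * real n powr (\<gamma> * (p - 1) - 1)) * P \<le> (c / 2) * P"
        using P by (intro mult_right_mono) auto
      then show ?thesis by (simp only: distrib_right)
    qed
    ultimately have close: "\<bar>w (int n) - a n * P\<bar> \<le> (c / 2) * P" unfolding main by linarith
    have an: "(J - c / 4) * P \<le> a n * P" "a n * P \<le> (J + c / 4) * P"
      using elim P by (auto intro!: mult_right_mono)
    have "(c / 4) * P + (c / 2) * P \<le> (J - c / 4) * P"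
      unfolding distrib_right[symmetric] using J P by (intro mult_right_mono) auto
    then have "(c / 4) * P \<le> w (int n)" using close an(1) by linarith
    moreover have "(J + c / 4) * P + (c / 2) * P \<le> (J + c) * P"
      unfolding distrib_right[symmetric] using c(1) P by (intro mult_right_mono) auto
    then have "w (int n) \<le> (J + c) * P" using close an(2) by linarith
    ultimately have "(c / 4) * P \<le> w (int n) \<and> w (int n) \<le> (J + c) * P" by simp
    then show ?case by (simp add: P_def)
  qed
  then obtain N where N: "\<And>n. N \<le> n \<Longrightarrow> (c / 4) * real n powr (- S) \<le> w (int n) \<and> w (int n) \<le> (J + c) * real n powr (- S)"
    by (auto simp: eventually_sequentially)
  have "(c / 4) * of_int \<bar>x\<bar> powr (- S) \<le> w x \<and> w x \<le> (J + c) * of_int \<bar>x\<bar> powr (- S)" if "int (Suc N) \<le> \<bar>x\<bar>" for x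
  proof -
    have "w x = w (int (nat \<bar>x\<bar>))" using w_minus[of x] by (cases "0 \<le> x") auto
    moreover have "N \<le> nat \<bar>x\<bar>" using that by linarith
    ultimately show ?thesis using N[of "nat \<bar>x\<bar>"] by simp
  qed
  then show ?thesis using that[of "c / 4" "J + c" "Suc N"] c(1) J by simp
qed

text \<open>The summand is at least a multiple of \<open>\<bar>x\<bar>\<close> to the power
  \<open>- S - \<gamma> p\<close>, and the harmonic series diverges.\<close>

theorem ground_state_not_summable:
  assumes sub: "S + \<gamma> * p \<le> 1"
  shows "\<not> (\<lambda>x. \<bar>w x\<bar> * u x powr p) summable_on UNIV"
proof
  assume summ: "(\<lambda>x. \<bar>w x\<bar> * u x powr p) summable_on UNIV"
  have "S + \<gamma> * (p - 1) < 1" using sub \<gamma> by (simp add: right_diff_distrib)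
  then obtain c C N where w: "0 < c" "0 < N" "\<And>x. int N \<le> \<bar>x\<bar> \<Longrightarrow> c * of_int \<bar>x\<bar> powr (- S) \<le> w x"
    by (rule w_asymptotics) (rule that)
  obtain d D where d: "0 < d" "0 < D" "\<And>n. d * (1 + real n) powr (- \<gamma>) \<le> u (int n)" "\<And>n. u (int n) \<le> D * (1 + real n) powr (- \<gamma>)"
    by (rule u_bounds) (rule that)
  define b where "b = c * (d * 2 powr (- \<gamma>)) powr p"
  have b: "0 < b" using w d by (simp add: b_def)
  have "(\<lambda>n. \<bar>w (int n)\<bar> * u (int n) powr p) summable_on UNIV"
  proof -
    have "(\<lambda>x. \<bar>w x\<bar> * u x powr p) summable_on range int"
      by (rule summable_on_subset_banach[OF summ]) simp
    then show ?thesis by (subst (asm) summable_on_reindex) (auto simp: o_def)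
  qed
  then have s: "summable (\<lambda>n. \<bar>w (int n)\<bar> * u (int n) powr p)" by (rule summable_on_imp_summable)
  have le: "b * (1 / real n) \<le> \<bar>w (int n)\<bar> * u (int n) powr p" if n: "N \<le> n" for n
  proof -
    have n1: "1 \<le> real n" using n w(2) by simp
    have "d * 2 powr (- \<gamma>) * real n powr (- \<gamma>) = d * (2 * real n) powr (- \<gamma>)" using n1 by (simp add: powr_mult)
    also have "\<dots> \<le> d * (1 + real n) powr (- \<gamma>)" using d \<gamma> n1 by (intro mult_left_mono powr_mono2') auto
    also have "\<dots> \<le> u (int n)" by (rule d)
    finally have "(d * 2 powr (- \<gamma>) * real n powr (- \<gamma>)) powr p \<le> u (int n) powr p"
      using d p by (intro powr_mono2) auto
    moreover have "c * real n powr (- S) \<le> \<bar>w (int n)\<bar>" using w(3)[of "int n"] n by simp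
    ultimately have "(c * real n powr (- S)) * (d * 2 powr (- \<gamma>) * real n powr (- \<gamma>)) powr p \<le> \<bar>w (int n)\<bar> * u (int n) powr p"
      using w by (intro mult_mono) auto
    moreover have "(d * 2 powr (- \<gamma>) * real n powr (- \<gamma>)) powr p = (d * 2 powr (- \<gamma>)) powr p * real n powr (- (\<gamma> * p))"
      using d n1 by (simp add: powr_mult powr_powr)
    ultimately have "b * (real n powr (- S) * real n powr (- (\<gamma> * p))) \<le> \<bar>w (int n)\<bar> * u (int n) powr p"
      by (simp add: b_def mult_ac)
    moreover have "real n powr (- 1) \<le> real n powr (- S) * real n powr (- (\<gamma> * p))"
      unfolding powr_add[symmetric] using sub n1 by (intro powr_mono) auto
    then have "b * real n powr (- 1) \<le> b * (real n powr (- S) * real n powr (- (\<gamma> * p)))"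
      using b by (intro mult_left_mono) auto
    ultimately show ?thesis using n1 by (simp add: powr_minus_divide)
  qed
  have "summable (\<lambda>n. b * (1 / real n))"
    using le b by (intro summable_comparison_test'[OF s, of N]) auto
  then have "summable (\<lambda>n. inverse b * (b * (1 / real n)))" by (rule summable_mult)
  then have "summable (\<lambda>n. 1 / real n)" using b by simp
  then show False using not_summable_harmonic[where ?'a = real] by (simp add: inverse_eq_divide)
qed

end

section \<open>Optimality of the Hardy weight\<close>

theorem theorem2p3:
  fixes p q \<sigma> \<alpha> :: real and w :: "int \<Rightarrow> real"
  assumes "1 < p" and "1 < q"
    and "0 < \<sigma>" and "\<sigma> < 1 / p"
    and "0 < \<alpha>" and "\<alpha> < 1 / q"
    and "w = (\<lambda>x. frac_p_laplace p \<sigma> (kappa q (- \<alpha>)) x / kappa q (- \<alpha>) x powr (p - 1))"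
  shows "kappa q (- \<alpha>) \<in> formal_domain p \<sigma> \<and>
    (p * (\<sigma> + 1 - q * \<alpha>) \<ge> 1 \<longrightarrow> p_critical p \<sigma> w) \<and>
    (p * (\<sigma> + 1 - q * \<alpha>) \<le> 1 \<longrightarrow>
       \<not> (\<lambda>x. \<bar>w x\<bar> * kappa q (- \<alpha>) x powr p) summable_on UNIV) \<and>
    (p * (\<sigma> + 1 - q * \<alpha>) = 1 \<longrightarrow> optimal_hardy_weight p \<sigma> w) \<and>
    w 0 > 0 \<and>
    (\<alpha> > (p - 2 + p * \<sigma>) / ((p - 1) * q) \<longrightarrow>
       (\<exists>K. finite K \<and> (\<forall>x. x \<notin> K \<longrightarrow> w x > 0)) \<and>
       (\<exists>C1>0. \<exists>C2>0. \<exists>N::int. N > 0 \<and>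
          (\<forall>x. \<bar>x\<bar> \<ge> N \<longrightarrow>
             C1 * of_int \<bar>x\<bar> powr (- (p * \<sigma>)) \<le> w x \<and>
             w x \<le> C2 * of_int \<bar>x\<bar> powr (- (p * \<sigma>)))))"
proof -
  interpret hardy_pair p \<sigma> q \<alpha> by unfold_locales (use assms in auto)
  have w: "w = hardy_pair.w p \<sigma> q \<alpha>"
    unfolding assms(7) by (simp add: fun_eq_iff hardy_pair.w_def[OF hardy_pair_axioms])
  have exponent: "p * (\<sigma> + 1 - q * \<alpha>) = S + \<gamma> * p"
    by (simp add: S_def \<gamma>_def algebra_simps)
  have a: "p_critical p \<sigma> w" "agmon_ground_state p \<sigma> w (kappa q (- \<alpha>))" if "p * (\<sigma> + 1 - q * \<alpha>) \<ge> 1"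
    using w_critical that unfolding exponent w by auto
  have b: "\<not> (\<lambda>x. \<bar>w x\<bar> * kappa q (- \<alpha>) x powr p) summable_on UNIV" if "p * (\<sigma> + 1 - q * \<alpha>) \<le> 1"
    using ground_state_not_summable that unfolding exponent w by auto
  have optimal: "optimal_hardy_weight p \<sigma> w" if "p * (\<sigma> + 1 - q * \<alpha>) = 1"
    unfolding optimal_hardy_weight_def p_null_critical_def using a b that by (auto simp: p_critical_def)
  have asymp: "(\<exists>K. finite K \<and> (\<forall>x. x \<notin> K \<longrightarrow> w x > 0)) \<and>
       (\<exists>C1>0. \<exists>C2>0. \<exists>N::int. N > 0 \<and>
          (\<forall>x. \<bar>x\<bar> \<ge> N \<longrightarrow>
             C1 * of_int \<bar>x\<bar> powr (- (p * \<sigma>)) \<le> w x \<and>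
             w x \<le> C2 * of_int \<bar>x\<bar> powr (- (p * \<sigma>))))"
    if large: "\<alpha> > (p - 2 + p * \<sigma>) / ((p - 1) * q)"
  proof -
    have "p - 2 + p * \<sigma> < \<alpha> * ((p - 1) * q)" using large assms by (simp add: pos_divide_less_eq)
    then have "S + \<gamma> * (p - 1) < 1" by (simp add: S_def \<gamma>_def algebra_simps)
    then obtain c C N where cCN: "0 < c" "0 < C" "0 < N"
      "\<And>x. int N \<le> \<bar>x\<bar> \<Longrightarrow> c * of_int \<bar>x\<bar> powr (- S) \<le> w x"
      "\<And>x. int N \<le> \<bar>x\<bar> \<Longrightarrow> w x \<le> C * of_int \<bar>x\<bar> powr (- S)"
      by (rule w_asymptotics[folded w]) (rule that)
    have "0 < w x" if "x \<notin> {- int N..int N}" for x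
    proof -
      have x: "int N \<le> \<bar>x\<bar>" "x \<noteq> 0" using that by auto
      then have "0 < c * of_int \<bar>x\<bar> powr (- S)" using cCN(1) by simp
      then show ?thesis using cCN(4)[OF x(1)] by linarith
    qed
    then have "\<exists>K. finite K \<and> (\<forall>x. x \<notin> K \<longrightarrow> w x > 0)" by (intro exI[of _ "{- int N..int N}"]) auto
    moreover have "\<exists>C1>0. \<exists>C2>0. \<exists>N::int. N > 0 \<and>
          (\<forall>x. \<bar>x\<bar> \<ge> N \<longrightarrow>
             C1 * of_int \<bar>x\<bar> powr (- (p * \<sigma>)) \<le> w x \<and>
             w x \<le> C2 * of_int \<bar>x\<bar> powr (- (p * \<sigma>)))"
      using cCN unfolding S_def by (intro exI[of _ c] exI[of _ C] exI[of _ "int N"] conjI) auto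
    ultimately show ?thesis by blast
  qed
  show ?thesis
    using u_in_formal_domain a(1) b optimal w_0_pos asymp unfolding w by blast
qed

end
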